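(* Let $S$ be a regular $F$-finite domain and let $R$ be an $F$-finite ring. Suppose that $R\subseteq S$ and that $R$ is a direct summand of $S$. Let $I\subseteq R$ be an ideal. Then the set of $F$-jumping numbers of $I$ in $R$ is a subset of the set of $F$-jumping numbers of $IS$ in $S$. In particular, the set of $F$-jumping numbers of $I$ in $R$ is formed by rational numbers and has no accumulation points. As a consequence, the $F$-pure threshold of $I$ is a rational number.
   Context: All rings are commutative, Noetherian and contain a field of characteristic $p>0$. For such a ring $R$, $F^e_*R$ is $R$ viewed as an $R$-module via the $e$-th iterate of Frobenius: $r\cdot F^e_*x=F^e_*(r^{p^e}x)$. $R$ is $F$-finite if $F^e_*R$ is a finitely generated $R$-module. $R$ is a direct summand of $S$ if there is an $R$-linear $\beta:S\to R$ with $\beta|_R=\mathrm{id}_R$; direct summands of regular $F$-finite domains are strongly $F$-regular. A $p^{-e}$-linear map is an additive map $\phi:R\to R$ with $\phi(r^{p^e}g)=r\phi(g)$; $\mathcal{C}^e_R$ is the set of all of them (so $\mathcal{C}^e_R\cong \mathrm{Hom}_R(F^e_*R,R)$), and for an ideal $J$, $\mathcal{C}^e_RJ$ is the ideal generated by all $\phi(g)$ with $\phi\in\mathcal{C}^e_R$, $g\in J$. For $R$ strongly $F$-regular, an ideal $I\subseteq R$ and $\lambda\in\mathbb{R}_{>0}$, the test ideal is $\tau_R(I^\lambda)=\bigcup_{e\in\mathbb{N}}\mathcal{C}^e_R I^{\lceil p^e\lambda\rceil}$ (an increasing union). A real number $\lambda>0$ is an $F$-jumping number of $I$ (in $R$)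 if $\tau_R(I^\lambda)\neq\tau_R(I^{\lambda-\epsilon})$ for every $\epsilon>0$ (with $\lambda-\epsilon>0$). The $F$-pure threshold of $I$ is the first (smallest) $F$-jumping number of $I$, when there is one. *)

theory Defs
  imports
    "HOL-Library.Extended_Nat"
    "HOL-Computational_Algebra.Primes"
    "HOL-Analysis.Elementary_Topology"
    "HOL-Algebra.Subrings"
    "HOL-Algebra.Ideal_Product"
    "HOL-Algebra.Ring_Divisibility"
    "HOL-Algebra.Module"
begin

definition loc_rel :: "('a, 'm) ring_scheme \<Rightarrow> 'a set \<Rightarrow> (('a \<times> 'a) \<times> ('a \<times> 'a)) set" where
  "loc_rel A M = {((a, s), (b, t)). a \<in> carrier A \<and> b \<in> carrier A \<and> s \<in> M \<and> t \<in> M \<and>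
     (\<exists>u\<in>M. u \<otimes>\<^bsub>A\<^esub> (a \<otimes>\<^bsub>A\<^esub> t) = u \<otimes>\<^bsub>A\<^esub> (b \<otimes>\<^bsub>A\<^esub> s))}"

definition loc_frac :: "('a, 'm) ring_scheme \<Rightarrow> 'a set \<Rightarrow> 'a \<Rightarrow> 'a \<Rightarrow> ('a \<times> 'a) set" where
  "loc_frac A M a s = loc_rel A M `` {(a, s)}"

definition localization :: "('a, 'm) ring_scheme \<Rightarrow> 'a set \<Rightarrow> ('a \<times> 'a) set ring" where
  "localization A M =
     \<lparr> carrier = (carrier A \<times> M) // loc_rel A M,
       mult = (\<lambda>U V. \<Union>x\<in>U. \<Union>y\<in>V. loc_frac A M (fst x \<otimes>\<^bsub>A\<^esub> fst y) (snd x \<otimes>\<^bsub>A\<^esub> snd y)),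
       one = loc_frac A M \<one>\<^bsub>A\<^esub> \<one>\<^bsub>A\<^esub>,
       zero = loc_frac A M \<zero>\<^bsub>A\<^esub> \<one>\<^bsub>A\<^esub>,
       add = (\<lambda>U V. \<Union>x\<in>U. \<Union>y\<in>V.
                loc_frac A M ((fst x \<otimes>\<^bsub>A\<^esub> snd y) \<oplus>\<^bsub>A\<^esub> (fst y \<otimes>\<^bsub>A\<^esub> snd x)) (snd x \<otimes>\<^bsub>A\<^esub> snd y)) \<rparr>"

locale loc_setup = cring A + submonoid M A for A (structure) and M
begin

lemma M_carrier: "s \<in> M \<Longrightarrow> s \<in> carrier A"
  using subset by auto

lemma equiv_loc_rel: "equiv (carrier A \<times> M) (loc_rel A M)"
proof (rule equivI)
  show "loc_rel A M \<subseteq> (carrier A \<times> M) \<times> (carrier A \<times> M)"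
    by (auto simp: loc_rel_def)
  show "refl_on (carrier A \<times> M) (loc_rel A M)"
    by (auto simp: loc_rel_def refl_on_def)
  show "sym (loc_rel A M)"
    by (rule symI) (auto simp: loc_rel_def, metis)
  show "trans (loc_rel A M)"
  proof (rule transI)
    fix x y z assume xy: "(x, y) \<in> loc_rel A M" and yz: "(y, z) \<in> loc_rel A M"
    obtain a s where x: "x = (a, s)" by (cases x)
    obtain b t where y: "y = (b, t)" by (cases y)
    obtain c r where z: "z = (c, r)" by (cases z)
    from xy x y obtain u where abc: "a \<in> carrier A" "b \<in> carrier A" "s \<in> M" "t \<in> M" "u \<in> M"
      and u: "u \<otimes> (a \<otimes> t) = u \<otimes> (b \<otimes> s)" by (auto simp: loc_rel_def)
    from yz y z obtain v where c: "c \<in> carrier A" "r \<in> M" "v \<in> M"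
      and v: "v \<otimes> (b \<otimes> r) = v \<otimes> (c \<otimes> t)" by (auto simp: loc_rel_def)
    note car = abc c M_carrier[OF abc(3)] M_carrier[OF abc(4)] M_carrier[OF abc(5)]
      M_carrier[OF c(2)] M_carrier[OF c(3)]
    have "(u \<otimes> v \<otimes> t) \<otimes> (a \<otimes> r) = v \<otimes> r \<otimes> (u \<otimes> (a \<otimes> t))"
      using car by (simp add: m_ac)
    also have "\<dots> = u \<otimes> s \<otimes> (v \<otimes> (b \<otimes> r))"
      unfolding u using car by (simp add: m_ac)
    also have "\<dots> = (u \<otimes> v \<otimes> t) \<otimes> (c \<otimes> s)"
      unfolding v using car by (simp add: m_ac)
    finally have "(u \<otimes> v \<otimes> t) \<otimes> (a \<otimes> r) = (u \<otimes> v \<otimes> t) \<otimes> (c \<otimes> s)" .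
    moreover have "u \<otimes> v \<otimes> t \<in> M" using abc c by blast
    ultimately show "(x, z) \<in> loc_rel A M"
      unfolding x z loc_rel_def using abc c by blast
  qed
qed

lemma loc_frac_eq_iff:
  assumes "a \<in> carrier A" "b \<in> carrier A" "s \<in> M" "t \<in> M"
  shows "loc_frac A M a s = loc_frac A M b t \<longleftrightarrow> (\<exists>u\<in>M. u \<otimes> (a \<otimes> t) = u \<otimes> (b \<otimes> s))"
  using assms eq_equiv_class_iff[OF equiv_loc_rel, of "(a, s)" "(b, t)"]
  by (auto simp: loc_frac_def loc_rel_def)

lemma loc_frac_cancel:
  assumes "a \<in> carrier A" "s \<in> M" "t \<in> M"
  shows "loc_frac A M (a \<otimes> t) (s \<otimes> t) = loc_frac A M a s"
proof -
  have "\<one> \<otimes> ((a \<otimes> t) \<otimes> s) = \<one> \<otimes> (a \<otimes> (s \<otimes> t))"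
    using assms M_carrier by (simp add: m_ac)
  then show ?thesis
    using assms M_carrier by (subst loc_frac_eq_iff) auto
qed

lemma loc_carrier: "carrier (localization A M) = {loc_frac A M a s |a s. a \<in> carrier A \<and> s \<in> M}"
  by (auto simp: localization_def loc_frac_def quotient_def)

lemma loc_carrierE:
  assumes "U \<in> carrier (localization A M)"
  obtains a s where "U = loc_frac A M a s" "a \<in> carrier A" "s \<in> M"
  using assms loc_carrier by auto

lemma loc_frac_in_carrier:
  "a \<in> carrier A \<Longrightarrow> s \<in> M \<Longrightarrow> loc_frac A M a s \<in> carrier (localization A M)"
  using loc_carrier by auto

lemma loc_mult_frac:
  assumes "a \<in> carrier A" "b \<in> carrier A" "s \<in> M" "t \<in> M"
  shows "loc_frac A M a s \<otimes>\<^bsub>localization A M\<^esub> loc_frac A M b t = loc_frac A M (a \<otimes> b) (s \<otimes> t)"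
proof -
  define f where "f = (\<lambda>(a, s) (b, t). loc_frac A M (a \<otimes> b) (s \<otimes> t))"
  have "f x y = f x' y'"
    if "(x, x') \<in> loc_rel A M" "(y, y') \<in> loc_rel A M" for x x' y y'
  proof -
    obtain a s where x: "x = (a, s)" by (cases x)
    obtain a' s' where x': "x' = (a', s')" by (cases x')
    obtain b t where y: "y = (b, t)" by (cases y)
    obtain b' t' where y': "y' = (b', t')" by (cases y')
    from that(1) x x' obtain u where 1: "a \<in> carrier A" "a' \<in> carrier A" "s \<in> M" "s' \<in> M" "u \<in> M"
      and u: "u \<otimes> (a \<otimes> s') = u \<otimes> (a' \<otimes> s)" by (auto simp: loc_rel_def)
    from that(2) y y' obtain v where 2: "b \<in> carrier A" "b' \<in> carrier A" "t \<in> M" "t' \<in> M" "v \<in> M"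
      and v: "v \<otimes> (b \<otimes> t') = v \<otimes> (b' \<otimes> t)" by (auto simp: loc_rel_def)
    note car = 1 2 1(3-5)[THEN M_carrier] 2(3-5)[THEN M_carrier]
    have "(u \<otimes> v) \<otimes> ((a \<otimes> b) \<otimes> (s' \<otimes> t')) = (u \<otimes> (a \<otimes> s')) \<otimes> (v \<otimes> (b \<otimes> t'))"
      using car by (simp add: m_ac)
    also have "\<dots> = (u \<otimes> v) \<otimes> ((a' \<otimes> b') \<otimes> (s \<otimes> t))"
      unfolding u v using car by (simp add: m_ac)
    finally show ?thesis
      unfolding x x' y y' f_def using car by (auto simp: loc_frac_eq_iff)
  qed
  then have "congruent2 (loc_rel A M) (loc_rel A M) f"
    by (auto simp: congruent2_def)
  from UN_equiv_class2[OF equiv_loc_rel equiv_loc_rel this, of "(a, s)" "(b, t)"]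
  show ?thesis
    using assms by (simp add: localization_def f_def loc_frac_def case_prod_beta)
qed

lemma loc_add_frac:
  assumes "a \<in> carrier A" "b \<in> carrier A" "s \<in> M" "t \<in> M"
  shows "loc_frac A M a s \<oplus>\<^bsub>localization A M\<^esub> loc_frac A M b t
    = loc_frac A M ((a \<otimes> t) \<oplus> (b \<otimes> s)) (s \<otimes> t)"
proof -
  define f where "f = (\<lambda>(a, s) (b, t). loc_frac A M ((a \<otimes> t) \<oplus> (b \<otimes> s)) (s \<otimes> t))"
  have "f x y = f x' y'"
    if "(x, x') \<in> loc_rel A M" "(y, y') \<in> loc_rel A M" for x x' y y'
  proof -
    obtain a s where x: "x = (a, s)" by (cases x)
    obtain a' s' where x': "x' = (a', s')" by (cases x')
    obtain b t where y: "y = (b, t)" by (cases y)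
    obtain b' t' where y': "y' = (b', t')" by (cases y')
    from that(1) x x' obtain u where 1: "a \<in> carrier A" "a' \<in> carrier A" "s \<in> M" "s' \<in> M" "u \<in> M"
      and u: "u \<otimes> (a \<otimes> s') = u \<otimes> (a' \<otimes> s)" by (auto simp: loc_rel_def)
    from that(2) y y' obtain v where 2: "b \<in> carrier A" "b' \<in> carrier A" "t \<in> M" "t' \<in> M" "v \<in> M"
      and v: "v \<otimes> (b \<otimes> t') = v \<otimes> (b' \<otimes> t)" by (auto simp: loc_rel_def)
    note car = 1 2 1(3-5)[THEN M_carrier] 2(3-5)[THEN M_carrier]
    have "(u \<otimes> v) \<otimes> (((a \<otimes> t) \<oplus> (b \<otimes> s)) \<otimes> (s' \<otimes> t'))
      = (v \<otimes> t \<otimes> t') \<otimes> (u \<otimes> (a \<otimes> s')) \<oplus> (u \<otimes> s \<otimes> s') \<otimes> (v \<otimes> (b \<otimes> t'))"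
      using car by (simp add: m_ac l_distr r_distr)
    also have "\<dots> = (u \<otimes> v) \<otimes> (((a' \<otimes> t') \<oplus> (b' \<otimes> s')) \<otimes> (s \<otimes> t))"
      unfolding u v using car by (simp add: m_ac l_distr r_distr)
    finally show ?thesis
      unfolding x x' y y' f_def using car by (auto simp: loc_frac_eq_iff)
  qed
  then have "congruent2 (loc_rel A M) (loc_rel A M) f"
    by (auto simp: congruent2_def)
  from UN_equiv_class2[OF equiv_loc_rel equiv_loc_rel this, of "(a, s)" "(b, t)"]
  show ?thesis
    using assms by (simp add: localization_def f_def loc_frac_def case_prod_beta)
qed

lemma loc_one: "\<one>\<^bsub>localization A M\<^esub> = loc_frac A M \<one> \<one>"
  and loc_zero: "\<zero>\<^bsub>localization A M\<^esub> = loc_frac A M \<zero> \<one>"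
  by (simp_all add: localization_def)

lemma cring_localization: "cring (localization A M)"
proof (rule cringI)
  note facts = loc_mult_frac loc_add_frac loc_one loc_zero loc_frac_in_carrier M_carrier
  show "abelian_group (localization A M)"
  proof (rule abelian_groupI)
    fix U assume "U \<in> carrier (localization A M)"
    then obtain a s where U: "U = loc_frac A M a s" "a \<in> carrier A" "s \<in> M" by (rule loc_carrierE)
    have "loc_frac A M (\<ominus> a) s \<oplus>\<^bsub>localization A M\<^esub> U = \<zero>\<^bsub>localization A M\<^esub>"
      using U loc_frac_cancel[of \<zero> \<one> "s \<otimes> s"] by (simp add: facts l_minus l_neg)
    moreover have "loc_frac A M (\<ominus> a) s \<in> carrier (localization A M)"
      using U by (simp add: facts)
    ultimately show "\<exists>V\<in>carrier (localization A M).
        V \<oplus>\<^bsub>localization A M\<^esub> U = \<zero>\<^bsub>localization A M\<^esub>" by blast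
  qed (auto elim!: loc_carrierE simp: facts m_ac a_ac l_distr r_distr)
  show "comm_monoid (localization A M)"
    by (rule comm_monoidI) (auto elim!: loc_carrierE simp: facts m_ac)
  fix U V W
  assume "U \<in> carrier (localization A M)" "V \<in> carrier (localization A M)"
    "W \<in> carrier (localization A M)"
  then obtain a s b t c r where
    U: "U = loc_frac A M a s" "a \<in> carrier A" "s \<in> M"
    and V: "V = loc_frac A M b t" "b \<in> carrier A" "t \<in> M"
    and W: "W = loc_frac A M c r" "c \<in> carrier A" "r \<in> M"
    by (metis loc_carrierE)
  have "loc_frac A M ((a \<otimes> c \<otimes> (t \<otimes> r) \<oplus> b \<otimes> c \<otimes> (s \<otimes> r))) (s \<otimes> r \<otimes> (t \<otimes> r))
      = loc_frac A M ((((a \<otimes> t) \<oplus> (b \<otimes> s)) \<otimes> c) \<otimes> r) (((s \<otimes> t) \<otimes> r) \<otimes> r)"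
    using U V W M_carrier by (simp add: m_ac l_distr r_distr)
  also have "\<dots> = loc_frac A M (((a \<otimes> t) \<oplus> (b \<otimes> s)) \<otimes> c) ((s \<otimes> t) \<otimes> r)"
    using U V W M_carrier by (subst loc_frac_cancel) auto
  finally show "(U \<oplus>\<^bsub>localization A M\<^esub> V) \<otimes>\<^bsub>localization A M\<^esub> W
      = U \<otimes>\<^bsub>localization A M\<^esub> W \<oplus>\<^bsub>localization A M\<^esub> V \<otimes>\<^bsub>localization A M\<^esub> W"
    using U V W by (simp add: facts)
qed

end

definition krull_dim :: "('a, 'm) ring_scheme \<Rightarrow> enat" where
  "krull_dim A = Sup {enat n |n. \<exists>C :: nat \<Rightarrow> 'a set.
     (\<forall>i\<le>n. primeideal (C i) A) \<and> (\<forall>i<n. C i \<subset> C (Suc i))}"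

text \<open>By Krull's height theorem the maximal ideal of a Noetherian local ring \<open>A\<close> never has fewer
  than \<open>dim A\<close> generators, so regularity asks for a generating set of exactly that size.\<close>

definition regular_local_ring :: "('a, 'm) ring_scheme \<Rightarrow> bool" where
  "regular_local_ring A \<longleftrightarrow> cring A \<and> noetherian_ring A \<and>
     (\<exists>m. {n. maximalideal n A} = {m} \<and>
       (\<exists>U \<subseteq> carrier A. finite U \<and> m = Idl\<^bsub>A\<^esub> U \<and> enat (card U) = krull_dim A))"

definition regular_ring :: "('a, 'm) ring_scheme \<Rightarrow> bool" where
  "regular_ring A \<longleftrightarrow> cring A \<and> noetherian_ring A \<and>
     (\<forall>P. primeideal P A \<longrightarrow> regular_local_ring (localization A (carrier A - P)))"

definition contains_field_of_char :: "nat \<Rightarrow> ('a, 'm) ring_scheme \<Rightarrow> bool" where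
  "contains_field_of_char p A \<longleftrightarrow> Factorial_Ring.prime p \<and> (\<exists>K. subfield K A \<and> add_pow A p \<one>\<^bsub>A\<^esub> = \<zero>\<^bsub>A\<^esub>)"

definition frob_pushforward :: "nat \<Rightarrow> nat \<Rightarrow> ('a, 'm) ring_scheme \<Rightarrow> ('a, 'a) module" where
  "frob_pushforward p e A =
     \<lparr> carrier = carrier A, mult = mult A, one = \<one>\<^bsub>A\<^esub>, zero = \<zero>\<^bsub>A\<^esub>, add = add A,
       smult = (\<lambda>r x. (r [^]\<^bsub>A\<^esub> (p ^ e)) \<otimes>\<^bsub>A\<^esub> x) \<rparr>"

definition fin_gen_module :: "('a, 'm) ring_scheme \<Rightarrow> ('a, 'b, 'n) module_scheme \<Rightarrow> bool" where
  "fin_gen_module A N \<longleftrightarrow> (\<exists>U \<subseteq> carrier N. finite U \<and>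
     (\<forall>y\<in>carrier N. \<exists>c \<in> U \<rightarrow> carrier A. y = (\<Oplus>\<^bsub>N\<^esub>x\<in>U. c x \<odot>\<^bsub>N\<^esub> x)))"

text \<open>The condition does not depend on the choice of the exponent \<open>e > 0\<close>
  (for \<open>e = 0\<close> it is void).\<close>

definition F_finite :: "nat \<Rightarrow> ('a, 'm) ring_scheme \<Rightarrow> bool" where
  "F_finite p A \<longleftrightarrow> (\<exists>e>0. fin_gen_module A (frob_pushforward p e A))"

text \<open>Values outside the carrier are unconstrained; only the values on the carrier are ever used.\<close>

definition cartier_maps :: "nat \<Rightarrow> nat \<Rightarrow> ('a, 'm) ring_scheme \<Rightarrow> ('a \<Rightarrow> 'a) set" where
  "cartier_maps p e A = {\<phi> \<in> carrier A \<rightarrow> carrier A.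
     (\<forall>g\<in>carrier A. \<forall>h\<in>carrier A. \<phi> (g \<oplus>\<^bsub>A\<^esub> h) = \<phi> g \<oplus>\<^bsub>A\<^esub> \<phi> h) \<and>
     (\<forall>r\<in>carrier A. \<forall>g\<in>carrier A. \<phi> ((r [^]\<^bsub>A\<^esub> (p ^ e)) \<otimes>\<^bsub>A\<^esub> g) = r \<otimes>\<^bsub>A\<^esub> \<phi> g)}"

definition cartier_ideal :: "nat \<Rightarrow> nat \<Rightarrow> ('a, 'm) ring_scheme \<Rightarrow> 'a set \<Rightarrow> 'a set" where
  "cartier_ideal p e A J = Idl\<^bsub>A\<^esub> {\<phi> g |\<phi> g. \<phi> \<in> cartier_maps p e A \<and> g \<in> J}"

text \<open>The exponent \<open>\<lceil>p\<^sup>e c\<rceil>\<close> is nonnegative for \<open>c > 0\<close>, so that the conversion to natural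
  numbers is harmless. Powers of ideals are taken in the library's monoid of ideals, whose
  neutral element is the unit ideal. The union is that of an increasing chain, hence an ideal,
  when \<open>A\<close> is strongly \<open>F\<close>-regular; for other \<open>A\<close> the formula is still meaningful as a set.\<close>

definition test_ideal :: "nat \<Rightarrow> ('a, 'm) ring_scheme \<Rightarrow> 'a set \<Rightarrow> real \<Rightarrow> 'a set" where
  "test_ideal p A I c =
     (\<Union>e::nat. cartier_ideal p e A (I [^]\<^bsub>ideals_set A\<^esub> (nat \<lceil>real (p ^ e) * c\<rceil>)))"

definition F_jumping_numbers :: "nat \<Rightarrow> ('a, 'm) ring_scheme \<Rightarrow> 'a set \<Rightarrow> real set" where
  "F_jumping_numbers p A I =
     {c. c > 0 \<and> (\<forall>\<epsilon>>0. c - \<epsilon> > 0 \<longrightarrow> test_ideal p A I c \<noteq> test_ideal p A I (c - \<epsilon>))}"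

definition is_F_pure_threshold :: "nat \<Rightarrow> ('a, 'm) ring_scheme \<Rightarrow> 'a set \<Rightarrow> real \<Rightarrow> bool" where
  "is_F_pure_threshold p A I c \<longleftrightarrow>
     c \<in> F_jumping_numbers p A I \<and> (\<forall>d\<in>F_jumping_numbers p A I. c \<le> d)"

definition is_direct_summand :: "'a set \<Rightarrow> ('a, 'm) ring_scheme \<Rightarrow> bool" where
  "is_direct_summand R S \<longleftrightarrow> (\<exists>\<beta> \<in> carrier S \<rightarrow> R.
     (\<forall>x\<in>carrier S. \<forall>y\<in>carrier S. \<beta> (x \<oplus>\<^bsub>S\<^esub> y) = \<beta> x \<oplus>\<^bsub>S\<^esub> \<beta> y) \<and>
     (\<forall>r\<in>R. \<forall>x\<in>carrier S. \<beta> (r \<otimes>\<^bsub>S\<^esub> x) = r \<otimes>\<^bsub>S\<^esub> \<beta> x) \<and>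
     (\<forall>r\<in>R. \<beta> r = r))"

end

theory Submission
  imports Defs
begin

text \<open>
  Write \<open>C e J\<close> for the ideal generated by the images of \<open>J\<close> under the Cartier maps of level
  \<open>e\<close>. Everything about \<open>S\<close> rests on one consequence of regularity: \<open>F\<^sub>*S\<close> is locally free, hence
  \<open>J\<close> is contained in the \<open>p\<^sup>e\<close>-th Frobenius power of \<open>C e J\<close>
  (\<open>regular_subset_frobenius_power\<close>, \<open>subset_frobenius_power\<close>). This direction of Kunz's theorem
  is proved inside \<open>S\<close>, with ideals saturated at a prime \<open>P\<close> in place of ideals of the local ring.
  Krull's principal ideal theorem shows that generators \<open>x\<^sub>1, \<dots>, x\<^sub>d\<close> of the maximal ideal of a
  \<open>d\<close>-dimensional local ring form a regular sequence in any order, with prime quotients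
  (\<open>regular_parameters_subset\<close>); so do their \<open>p\<close>-th powers (\<open>parameter_powers_primary\<close>). A minimal
  generating set of \<open>F\<^sub>*S\<close> at \<open>P\<close> then satisfies no relation: coefficients of a relation lie in
  \<open>(x\<^sub>1, \<dots>, x\<^sub>d)\<close> by minimality, and Nakayama's lemma removes the parameters one by one
  (\<open>relation_mod_parameters\<close>). The coordinate functions are Cartier maps, which yields the
  inclusion.

  \<^emph>\<open>Direct summands.\<close> If \<open>C e (I\<^sup>m S) \<subseteq> C e (I\<^sup>n S)\<close>, then every \<open>f \<in> I\<^sup>m\<close> is a sum of terms
  \<open>s \<phi>(h)\<^sup>q\<close> with \<open>q = p\<^sup>e\<close>, \<open>h \<in> I\<^sup>n\<close> and Cartier maps \<open>\<phi>\<close> of \<open>S\<close>. For a Cartier map \<open>\<psi>\<close> of \<open>R\<close> and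
  the splitting \<open>\<beta>\<close>, each \<open>h \<mapsto> \<psi> (\<beta> (s \<phi>(h)\<^sup>q))\<close> is a Cartier map of \<open>R\<close>, so \<open>\<psi> f\<close> lies in
  \<open>C e (I\<^sup>n)\<close> formed in \<open>R\<close>. Hence where the test ideals of \<open>IS\<close> do not jump, neither do those of \<open>I\<close>
  (\<open>C_ideal_sub_subset\<close>, \<open>F_jumping_numbers_sub_subset\<close>).

  \<^emph>\<open>Discreteness and rationality in \<open>S\<close>.\<close> Let \<open>I\<close> have \<open>r\<close> generators. The set of jumping numbers is
  stable under multiplication by \<open>p\<close> and, above \<open>r\<close>, under subtraction of 1 (Skoda's theorem). It
  does not accumulate from the right, by the ascending chain condition. It does not accumulate
  from the left at \<open>c = a / (q - 1) > r\<close>: the test ideals just below \<open>c\<close> are members of the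
  descending chain obtained from the unit ideal by iterating \<open>K \<mapsto> C e (I\<^sup>a K)\<close>, and such chains
  stabilise (\<open>inverse_linear_chain_stabilises\<close>). These properties suffice. Left limit points
  would form a set without decreasing sequences that is closed under increasing limits and stable
  under multiplication by \<open>p\<close> modulo 1. Such a set contains a periodic point, that is, a number
  \<open>a / (q - 1)\<close> (\<open>limits_empty\<close>). So the jumping numbers are discrete. Those in \<open>(r, r + 1]\<close> are
  then finite in number, so their orbits under multiplication by \<open>p\<close> modulo 1 are eventually
  periodic, and they are rational.
\<close>

section \<open>Ideals of a Noetherian commutative ring\<close>

locale noetherian_cring = cring + noetherian_ring

context cring
begin

abbreviation ipow :: "'a set \<Rightarrow> nat \<Rightarrow> 'a set" where
  "ipow J n \<equiv> J [^]\<^bsub>ideals_set R\<^esub> n"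

lemma ideal_carrier: "ideal K R \<Longrightarrow> x \<in> K \<Longrightarrow> x \<in> carrier R"
  by (rule ideal.Icarr)

lemma ideal_subset: "ideal K R \<Longrightarrow> K \<subseteq> carrier R"
  by (rule subsetI) (rule ideal.Icarr)

lemma ideal_zero: "ideal K R \<Longrightarrow> \<zero> \<in> K"
  by (simp add: additive_subgroup.zero_closed ideal.axioms(1))

lemma ideal_add: "ideal K R \<Longrightarrow> x \<in> K \<Longrightarrow> y \<in> K \<Longrightarrow> x \<oplus> y \<in> K"
  by (simp add: additive_subgroup.a_closed ideal.axioms(1))

lemma ideal_mult: "ideal K R \<Longrightarrow> x \<in> K \<Longrightarrow> a \<in> carrier R \<Longrightarrow> a \<otimes> x \<in> K"
  by (rule ideal.I_l_closed)

lemma ideal_mult': "ideal K R \<Longrightarrow> x \<in> K \<Longrightarrow> a \<in> carrier R \<Longrightarrow> x \<otimes> a \<in> K"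
  by (rule ideal.I_r_closed)

lemma ideal_uminus: "ideal K R \<Longrightarrow> x \<in> K \<Longrightarrow> \<ominus> x \<in> K"
  by (simp add: additive_subgroup.a_inv_closed ideal.axioms(1))

lemma ideal_diff: "ideal K R \<Longrightarrow> x \<in> K \<Longrightarrow> y \<in> K \<Longrightarrow> x \<ominus> y \<in> K"
  by (simp add: a_minus_def ideal_add ideal_uminus)

lemma ideal_cancel:
  assumes "ideal K R" "x \<in> K" "y \<in> carrier R" "x \<oplus> y \<in> K"
  shows "y \<in> K"
proof -
  have "y = \<ominus> x \<oplus> (x \<oplus> y)"
    using assms ideal_carrier by (simp add: r_neg1)
  then show ?thesis
    using assms ideal_add ideal_uminus by metis
qed

lemma idealI_mult:
  assumes "K \<subseteq> carrier R" "\<zero> \<in> K"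
    and "\<And>x y. x \<in> K \<Longrightarrow> y \<in> K \<Longrightarrow> x \<oplus> y \<in> K"
    and "\<And>a x. a \<in> carrier R \<Longrightarrow> x \<in> K \<Longrightarrow> a \<otimes> x \<in> K"
  shows "ideal K R"
proof (rule idealI[OF ring_axioms])
  show "subgroup K (add_monoid R)"
  proof (rule add.subgroupI)
    fix x assume x: "x \<in> K"
    have "x \<in> carrier R"
      using x assms(1) by (rule rev_subsetD)
    then have "\<ominus> x = \<ominus> \<one> \<otimes> x"
      by (simp add: l_minus)
    then show "\<ominus> x \<in> K"
      using x assms(4)[of "\<ominus> \<one>" x] by simp
  qed (use assms(1-3) in auto)
next
  fix a x assume "a \<in> K" "x \<in> carrier R"
  moreover from this have "a \<otimes> x = x \<otimes> a"
    using assms(1) by (intro m_comm) auto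
  ultimately show "x \<otimes> a \<in> K" "a \<otimes> x \<in> K"
    using assms(4)[of x a] by simp_all
qed

lemma prime_ideal: "primeideal P R \<Longrightarrow> ideal P R"
  by (rule primeideal.axioms(1))

lemma prime_one: "primeideal P R \<Longrightarrow> \<one> \<notin> P"
  using ideal.one_imp_carrier primeideal.I_notcarr prime_ideal by metis

lemma prime_mult:
  "primeideal P R \<Longrightarrow> a \<in> carrier R - P \<Longrightarrow> b \<in> carrier R - P \<Longrightarrow> a \<otimes> b \<in> carrier R - P"
  by (auto dest: primeideal.I_prime)

lemma prime_cancel:
  "primeideal P R \<Longrightarrow> a \<otimes> b \<in> P \<Longrightarrow> a \<in> carrier R - P \<Longrightarrow> b \<in> carrier R \<Longrightarrow> b \<in> P"
  by (auto dest: primeideal.I_prime)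

definition colon :: "'a set \<Rightarrow> 'a \<Rightarrow> 'a set" where
  "colon K s = {x \<in> carrier R. s \<otimes> x \<in> K}"

lemma colon_ideal: "ideal K R \<Longrightarrow> s \<in> carrier R \<Longrightarrow> ideal (colon K s) R"
  unfolding colon_def by (rule ideal.helper_max_prime[OF _ cring_axioms])

lemma colon_set_ideal:
  assumes "ideal K R" "N \<subseteq> carrier R"
  shows "ideal {s \<in> carrier R. \<forall>x\<in>N. s \<otimes> x \<in> K} R"
proof (rule idealI_mult)
  let ?A = "{s \<in> carrier R. \<forall>x\<in>N. s \<otimes> x \<in> K}"
  note c = subsetD[OF assms(2)]
  show "\<zero> \<in> ?A" using c ideal_zero[OF assms(1)] by simp
  show "a \<oplus> b \<in> ?A" if "a \<in> ?A" "b \<in> ?A" for a b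
    using that c ideal_add[OF assms(1)] by (simp add: l_distr)
  show "a \<otimes> b \<in> ?A" if "a \<in> carrier R" "b \<in> ?A" for a b
    using that c ideal_mult[OF assms(1)] by (simp add: m_assoc)
qed auto

definition adjoin :: "'a set \<Rightarrow> 'a \<Rightarrow> 'a set" where
  "adjoin K x = {k \<oplus> b \<otimes> x |k b. k \<in> K \<and> b \<in> carrier R}"

lemma adjoinI: "k \<in> K \<Longrightarrow> b \<in> carrier R \<Longrightarrow> k \<oplus> b \<otimes> x \<in> adjoin K x"
  by (auto simp: adjoin_def)

lemma adjoinE:
  assumes "y \<in> adjoin K x"
  obtains k b where "k \<in> K" "b \<in> carrier R" "y = k \<oplus> b \<otimes> x"
  using assms by (auto simp: adjoin_def)

lemma multiples_ideal:
  assumes "ideal K R" "ideal J R" "x \<in> carrier R"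
  shows "ideal {k \<oplus> b \<otimes> x |k b. k \<in> K \<and> b \<in> J} R" (is "ideal ?W R")
proof (rule idealI_mult)
  note c = ideal_carrier[OF assms(1)] ideal_carrier[OF assms(2)]
  show "?W \<subseteq> carrier R"
    using c assms(3) by auto
  have "\<zero> = \<zero> \<oplus> \<zero> \<otimes> x" using assms(3) by simp
  then show "\<zero> \<in> ?W"
    using ideal_zero assms by blast
  fix y z assume "y \<in> ?W" "z \<in> ?W"
  then obtain k b k' b' where *: "k \<in> K" "b \<in> J" "y = k \<oplus> b \<otimes> x"
    "k' \<in> K" "b' \<in> J" "z = k' \<oplus> b' \<otimes> x" by blast
  then have "y \<oplus> z = (k \<oplus> k') \<oplus> (b \<oplus> b') \<otimes> x"
    using c assms(3) by (simp add: l_distr a_ac)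
  then show "y \<oplus> z \<in> ?W"
    using * ideal_add assms by blast
next
  note c = ideal_carrier[OF assms(1)] ideal_carrier[OF assms(2)]
  fix a y assume a: "a \<in> carrier R" and "y \<in> ?W"
  then obtain k b where *: "k \<in> K" "b \<in> J" "y = k \<oplus> b \<otimes> x" by blast
  then have "a \<otimes> y = (a \<otimes> k) \<oplus> (a \<otimes> b) \<otimes> x"
    using c a assms(3) by (simp add: r_distr m_assoc)
  then show "a \<otimes> y \<in> ?W"
    using * ideal_mult a assms by blast
qed

lemma adjoin_ideal: "ideal K R \<Longrightarrow> x \<in> carrier R \<Longrightarrow> ideal (adjoin K x) R"
  unfolding adjoin_def by (rule multiples_ideal[OF _ oneideal])

lemma adjoin_superset:
  assumes "ideal K R" "x \<in> carrier R"
  shows "K \<subseteq> adjoin K x"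
proof
  fix k assume k: "k \<in> K"
  then have "k = k \<oplus> \<zero> \<otimes> x" using assms ideal_carrier by simp
  then show "k \<in> adjoin K x" using adjoinI[OF k zero_closed] by metis
qed

lemma adjoin_self:
  assumes "ideal K R" "x \<in> carrier R"
  shows "x \<in> adjoin K x"
proof -
  have "x = \<zero> \<oplus> \<one> \<otimes> x" using assms by simp
  then show ?thesis using adjoinI[OF ideal_zero[OF assms(1)] one_closed] by metis
qed

lemma adjoin_subset:
  assumes "ideal L R" "K \<subseteq> L" "x \<in> L"
  shows "adjoin K x \<subseteq> L"
  using assms ideal_add ideal_mult by (auto elim!: adjoinE)

lemma adjoin_mono: "K \<subseteq> K' \<Longrightarrow> adjoin K x \<subseteq> adjoin K' x"
  by (auto simp: adjoin_def)

lemma Idl_adjoin: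
  assumes "ideal K R" "x \<in> carrier R" "X \<subseteq> carrier R"
  shows "Idl (adjoin K x \<union> X) = Idl (K \<union> insert x X)"
proof
  have KX: "K \<union> insert x X \<subseteq> carrier R" and AX: "adjoin K x \<union> X \<subseteq> carrier R"
    using assms ideal_subset adjoin_ideal by auto
  show "Idl (adjoin K x \<union> X) \<subseteq> Idl (K \<union> insert x X)"
    using genideal_self[OF KX] adjoin_subset[OF genideal_ideal[OF KX], of K x]
    by (intro genideal_minimal genideal_ideal KX) auto
  show "Idl (K \<union> insert x X) \<subseteq> Idl (adjoin K x \<union> X)"
    using genideal_self[OF AX] adjoin_superset[OF assms(1,2)] adjoin_self[OF assms(1,2)]
    by (intro genideal_minimal genideal_ideal AX) auto
qed

lemma mem_set_add: "x \<in> U <+> V \<longleftrightarrow> (\<exists>a\<in>U. \<exists>b\<in>V. x = a \<oplus> b)"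
  by (auto simp: set_add_def')

lemma set_add_subset:
  fixes L :: "'a set"
  assumes "ideal L R" "U \<subseteq> L" "V \<subseteq> L"
  shows "U <+> V \<subseteq> L"
proof
  fix x :: 'a assume "x \<in> U <+> V"
  then obtain a b where "a \<in> U" "b \<in> V" "x = a \<oplus> b"
    unfolding mem_set_add by blast
  then show "x \<in> L"
    using ideal_add[OF assms(1)] subsetD[OF assms(2)] subsetD[OF assms(3)] by simp
qed

lemma ideal_prod_subset:
  assumes "ideal L R" "\<And>j n. j \<in> J \<Longrightarrow> n \<in> N \<Longrightarrow> j \<otimes> n \<in> L"
  shows "J \<cdot> N \<subseteq> L"
proof
  fix x assume "x \<in> J \<cdot> N"
  then show "x \<in> L"
    by induct (use assms ideal_add in auto)
qed

lemma Idl_prod_subset: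
  assumes L: "ideal L R" and "A \<subseteq> carrier R" "B \<subseteq> carrier R"
    and AB: "\<And>a b. a \<in> A \<Longrightarrow> b \<in> B \<Longrightarrow> a \<otimes> b \<in> L"
  shows "(Idl A) \<cdot> (Idl B) \<subseteq> L"
proof -
  let ?I = "{i \<in> carrier R. \<forall>j\<in>Idl B. i \<otimes> j \<in> L}"
  have B: "ideal (Idl B) R" using assms(3) by (rule genideal_ideal)
  have "Idl B \<subseteq> colon L a" if a: "a \<in> A" for a
    using assms(2,3) a AB[OF a]
    by (intro genideal_minimal[OF colon_ideal[OF L]]) (auto simp: colon_def)
  then have "A \<subseteq> ?I" using assms(2) by (auto simp: colon_def)
  then have "Idl A \<subseteq> ?I"
    by (rule genideal_minimal[OF colon_set_ideal[OF L ideal_subset[OF B]]])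
  then show ?thesis by (intro ideal_prod_subset[OF L]) auto
qed

lemma ideal_prod_mono: "J \<subseteq> J' \<Longrightarrow> N \<subseteq> N' \<Longrightarrow> J \<cdot> N \<subseteq> J' \<cdot> N'"
proof
  fix x assume "J \<subseteq> J'" "N \<subseteq> N'" "x \<in> J \<cdot> N"
  show "x \<in> J' \<cdot> N'"
    using \<open>x \<in> J \<cdot> N\<close> by induct (use \<open>J \<subseteq> J'\<close> \<open>N \<subseteq> N'\<close> in \<open>auto intro: ideal_prod.intros\<close>)
qed

lemma one_ideals_set [simp]: "\<one>\<^bsub>ideals_set R\<^esub> = carrier R"
  and mult_ideals_set [simp]: "J \<otimes>\<^bsub>ideals_set R\<^esub> K = J \<cdot> K"
  by (simp_all add: ideals_set_def)

lemma ipow_0 [simp]: "ipow J 0 = carrier R"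
  by (simp add: nat_pow_def)

lemma ipow_Suc [simp]: "ipow J (Suc n) = ipow J n \<cdot> J"
  by (simp add: nat_pow_def)

lemma ipow_ideal: "ideal J R \<Longrightarrow> ideal (ipow J n) R"
  by (induct n) (auto intro: oneideal ideal_prod_is_ideal)

lemma ipow_add:
  assumes "ideal J R"
  shows "ipow J (m + n) = ipow J m \<cdot> ipow J n"
proof (induct n)
  case 0
  then show ?case using ideal_prod_one[OF ipow_ideal[OF assms]] by simp
next
  case (Suc n)
  then show ?case using ideal_prod_assoc[OF ipow_ideal ipow_ideal] assms by simp
qed

lemma ipow_antimono:
  assumes "ideal J R" "m \<le> n"
  shows "ipow J n \<subseteq> ipow J m"
proof -
  have "ipow J n = ipow J m \<cdot> ipow J (n - m)"
    using ipow_add[OF assms(1), of m "n - m"] assms(2) by simp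
  then show ?thesis
    using ideal_prod_inter[OF ipow_ideal ipow_ideal] assms(1) by auto
qed

lemma ipow_1: "ideal J R \<Longrightarrow> ipow J (Suc 0) = J"
  using ideal_prod_commute[OF oneideal] ideal_prod_one by simp

lemma pow_mem_ipow:
  assumes "ideal J R" "x \<in> ipow J m"
  shows "x [^] (q::nat) \<in> ipow J (m * q)"
proof (induct q)
  case 0
  then show ?case by simp
next
  case (Suc q)
  have "ipow J (m * Suc q) = ipow J (m * q) \<cdot> ipow J m"
    using ipow_add[OF assms(1), of "m * q" m] by (simp add: add.commute)
  then show ?case
    using Suc assms(2) by (auto intro: ideal_prod.prod)
qed

text \<open>The contraction to \<open>R\<close> of the extension of \<open>K\<close> to the localisation at \<open>P\<close>. Working with
  saturated ideals takes the place of passing to the local ring.\<close>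

definition sat :: "'a set \<Rightarrow> 'a set \<Rightarrow> 'a set" where
  "sat P K = {x \<in> carrier R. \<exists>s \<in> carrier R - P. s \<otimes> x \<in> K}"

lemma satI: "x \<in> carrier R \<Longrightarrow> s \<in> carrier R - P \<Longrightarrow> s \<otimes> x \<in> K \<Longrightarrow> x \<in> sat P K"
  by (auto simp: sat_def)

lemma satE:
  assumes "x \<in> sat P K"
  obtains s where "x \<in> carrier R" "s \<in> carrier R" "s \<notin> P" "s \<otimes> x \<in> K"
  using assms by (auto simp: sat_def)

lemma sat_mono: "K \<subseteq> L \<Longrightarrow> sat P K \<subseteq> sat P L"
  by (auto simp: sat_def)

lemma sat_superset:
  assumes "primeideal P R" "K \<subseteq> carrier R"
  shows "K \<subseteq> sat P K"
proof
  fix x assume "x \<in> K"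
  then show "x \<in> sat P K"
    using assms prime_one[OF assms(1)] by (intro satI[of _ "\<one>"]) auto
qed

lemma sat_ideal:
  assumes "primeideal P R" "ideal K R"
  shows "ideal (sat P K) R"
proof (rule idealI_mult)
  show "sat P K \<subseteq> carrier R" by (auto simp: sat_def)
  show "\<zero> \<in> sat P K"
    using sat_superset[OF assms(1) ideal_subset[OF assms(2)]] ideal_zero[OF assms(2)] by blast
next
  fix x y assume "x \<in> sat P K" "y \<in> sat P K"
  then obtain s t where *: "s \<in> carrier R - P" "t \<in> carrier R - P" "s \<otimes> x \<in> K" "t \<otimes> y \<in> K"
    "x \<in> carrier R" "y \<in> carrier R" by (auto simp: sat_def)
  have "(s \<otimes> t) \<otimes> (x \<oplus> y) = t \<otimes> (s \<otimes> x) \<oplus> s \<otimes> (t \<otimes> y)"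
    using * by (simp add: r_distr m_ac)
  also have "\<dots> \<in> K"
    using * ideal_add[OF assms(2)] ideal_mult[OF assms(2)] by blast
  finally show "x \<oplus> y \<in> sat P K"
    using * prime_mult[OF assms(1)] by (intro satI[of _ "s \<otimes> t"]) auto
next
  fix a x assume a: "a \<in> carrier R" and "x \<in> sat P K"
  then obtain s where *: "s \<in> carrier R - P" "s \<otimes> x \<in> K" "x \<in> carrier R" by (auto simp: sat_def)
  have "s \<otimes> (a \<otimes> x) = a \<otimes> (s \<otimes> x)"
    using * a by (simp add: m_ac)
  also have "\<dots> \<in> K"
    using * a ideal_mult[OF assms(2)] by auto
  finally show "a \<otimes> x \<in> sat P K"
    using * a by (intro satI[of _ s]) auto
qed

lemma sat_cancel:
  assumes "primeideal P R" "s \<in> carrier R - P" "x \<in> carrier R" "s \<otimes> x \<in> sat P K"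
  shows "x \<in> sat P K"
proof -
  obtain t where t: "t \<in> carrier R - P" "t \<otimes> (s \<otimes> x) \<in> K"
    using assms(4) by (auto simp: sat_def)
  then show ?thesis
    using assms prime_mult[OF assms(1) t(1) assms(2)]
    by (intro satI[of _ "t \<otimes> s"]) (auto simp: m_assoc)
qed

lemma sat_sat: "primeideal P R \<Longrightarrow> K \<subseteq> carrier R \<Longrightarrow> sat P (sat P K) = sat P K"
proof
  assume P: "primeideal P R" and K: "K \<subseteq> carrier R"
  show "sat P (sat P K) \<subseteq> sat P K"
  proof
    fix x assume "x \<in> sat P (sat P K)"
    then obtain s where "x \<in> carrier R" "s \<in> carrier R - P" "s \<otimes> x \<in> sat P K"
      by (auto simp: sat_def)
    then show "x \<in> sat P K" by (metis sat_cancel[OF P])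
  qed
  show "sat P K \<subseteq> sat P (sat P K)"
    by (rule sat_mono[OF sat_superset[OF P K]])
qed

lemma sat_subset: "primeideal P R \<Longrightarrow> K \<subseteq> carrier R \<Longrightarrow> L \<subseteq> sat P K \<Longrightarrow> sat P L \<subseteq> sat P K"
  using sat_mono[of L "sat P K" P] sat_sat by blast

lemma sat_prime:
  assumes "primeideal Q R" "Q \<subseteq> P" "primeideal P R"
  shows "sat P Q = Q"
  using sat_superset[OF assms(3) ideal_subset[OF prime_ideal[OF assms(1)]]]
    prime_cancel[OF assms(1)] assms(2) by (auto elim!: satE)

lemma sat_subset_prime:
  "primeideal Q R \<Longrightarrow> Q \<subseteq> P \<Longrightarrow> primeideal P R \<Longrightarrow> K \<subseteq> Q \<Longrightarrow> sat P K \<subseteq> Q"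
  using sat_mono[of K Q P] sat_prime by blast

end

context noetherian_cring
begin

lemma exists_maximal_ideal:
  assumes "\<A> \<subseteq> {I. ideal I R}" "\<A> \<noteq> {}"
  shows "\<exists>M\<in>\<A>. \<forall>N\<in>\<A>. M \<subseteq> N \<longrightarrow> N = M"
proof (rule subset_Zorn)
  fix C assume C: "subset.chain \<A> C"
  show "\<exists>U\<in>\<A>. \<forall>N\<in>C. N \<subseteq> U"
  proof (cases "C = {}")
    case True
    then show ?thesis using assms(2) by auto
  next
    case False
    have "subset.chain {I. ideal I R} C"
      using C assms(1) unfolding pred_on.chain_def by auto
    from ideal_chain_is_trivial[OF False this] show ?thesis
      using C by (meson Union_upper pred_on.chain_def subsetCE)
  qed
qed

lemma ideal_induct [consumes 1, case_names step]:
  assumes "ideal K R"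
    and step: "\<And>K. ideal K R \<Longrightarrow> (\<And>L. ideal L R \<Longrightarrow> K \<subset> L \<Longrightarrow> Q L) \<Longrightarrow> Q K"
  shows "Q K"
proof (rule ccontr)
  assume "\<not> Q K"
  then have "{I. ideal I R \<and> \<not> Q I} \<noteq> {}" using assms(1) by auto
  then obtain M where "ideal M R" "\<not> Q M"
    and "\<And>N. ideal N R \<Longrightarrow> \<not> Q N \<Longrightarrow> M \<subseteq> N \<Longrightarrow> N = M"
    using exists_maximal_ideal[of "{I. ideal I R \<and> \<not> Q I}"] by auto
  then show False using step[of M] by blast
qed

lemma ascending_chain_stabilises:
  assumes "\<And>n. ideal (C n) R" "\<And>n. C n \<subseteq> C (Suc n)"
  shows "\<exists>N. \<forall>n\<ge>N. C n = C N"
proof -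
  have "range C \<subseteq> {I. ideal I R}" using assms(1) by auto
  from exists_maximal_ideal[OF this] obtain N where "\<And>n. C N \<subseteq> C n \<Longrightarrow> C n = C N"
    by auto
  then show ?thesis using lift_Suc_mono_le[of C] assms(2) by metis
qed

lemma finite_generators:
  assumes "ideal K R"
  obtains X where "X \<subseteq> carrier R" "finite X" "K = Idl X" "X \<subseteq> K"
  using finetely_gen[OF assms] genideal_self by metis

text \<open>Finitely many generators of \<open>N\<close> have a common denominator.\<close>

lemma sat_uniform:
  assumes P: "primeideal P R" and K: "ideal K R" and N: "ideal N R" "N \<subseteq> sat P K"
  shows "\<exists>s\<in>carrier R - P. \<forall>x\<in>N. s \<otimes> x \<in> K"
proof -
  obtain X where X: "X \<subseteq> carrier R" "finite X" "N = Idl X" "X \<subseteq> N"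
    using finite_generators[OF N(1)] .
  have "\<exists>s\<in>carrier R - P. \<forall>x\<in>X. s \<otimes> x \<in> K"
    using X(2) \<open>X \<subseteq> N\<close>
  proof (induct X)
    case empty
    then show ?case using prime_one[OF P] by auto
  next
    case (insert x X)
    then obtain s where s: "s \<in> carrier R - P" "\<forall>x\<in>X. s \<otimes> x \<in> K" by auto
    obtain t where t: "t \<in> carrier R - P" "t \<otimes> x \<in> K" and x: "x \<in> carrier R"
      using insert(4) N by (auto simp: sat_def)
    have "\<forall>y\<in>insert x X. (s \<otimes> t) \<otimes> y \<in> K"
    proof
      fix y assume y: "y \<in> insert x X"
      then have "y \<in> carrier R" using insert(4) ideal_subset[OF N(1)] by auto
      then have "(s \<otimes> t) \<otimes> y = s \<otimes> (t \<otimes> y)" "(s \<otimes> t) \<otimes> y = t \<otimes> (s \<otimes> y)"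
        using s t by (auto simp: m_ac)
      then show "(s \<otimes> t) \<otimes> y \<in> K"
        using y s t ideal_mult[OF K] by (metis DiffD1 insertE)
    qed
    then show ?case using prime_mult[OF P s(1) t(1)] by blast
  qed
  then obtain s where s: "s \<in> carrier R - P" "X \<subseteq> colon K s"
    using X by (auto simp: colon_def)
  then have "Idl X \<subseteq> colon K s"
    using genideal_minimal colon_ideal[OF K] by auto
  then show ?thesis using s X by (auto simp: colon_def)
qed

text \<open>Nakayama's lemma at \<open>P\<close>. Enlarging \<open>L\<close> as far as the conclusion stays false makes \<open>N\<close>
  cyclic modulo \<open>L\<close> near \<open>P\<close>, generated by some \<open>y\<close>; the hypothesis then reads \<open>t y = j y\<close>
  with \<open>t \<notin> P\<close> and \<open>j \<in> P\<close>.\<close>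

lemma nakayama:
  assumes P: "primeideal P R" and L: "ideal L R" and J: "ideal J R" "J \<subseteq> P" and N: "ideal N R"
    and le: "N \<subseteq> sat P (L <+> J \<cdot> N)"
  shows "N \<subseteq> sat P L"
proof (rule ccontr)
  assume "\<not> N \<subseteq> sat P L"
  let ?A = "{M. ideal M R \<and> L \<subseteq> M \<and> \<not> N \<subseteq> sat P M}"
  have "?A \<subseteq> {M. ideal M R}" "L \<in> ?A" using L \<open>\<not> N \<subseteq> sat P L\<close> by auto
  then obtain M where "M \<in> ?A" and "\<forall>M'\<in>?A. M \<subseteq> M' \<longrightarrow> M' = M"
    using exists_maximal_ideal[of ?A] by (metis (no_types, lifting) empty_iff)
  then have M: "ideal M R" "L \<subseteq> M" "\<not> N \<subseteq> sat P M"
    and max: "\<And>M'. ideal M' R \<Longrightarrow> M \<subset> M' \<Longrightarrow> N \<subseteq> sat P M'"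
    by auto
  obtain y where y: "y \<in> N" "y \<notin> sat P M" using M(3) by blast
  have yc: "y \<in> carrier R" using y(1) ideal_carrier[OF N] by simp
  have "y \<notin> M" using y sat_superset[OF P ideal_subset[OF M(1)]] by blast
  then have N_cyclic: "N \<subseteq> sat P (adjoin M y)"
    using adjoin_ideal[OF M(1) yc] adjoin_superset[OF M(1) yc] adjoin_self[OF M(1) yc]
    by (intro max) auto
  \<comment> \<open>\<open>M + J y\<close>, which agrees with \<open>M + J N\<close> near \<open>P\<close>\<close>
  define W where "W = {k \<oplus> b \<otimes> y |k b. k \<in> M \<and> b \<in> J}"
  have W: "ideal W R"
    unfolding W_def by (rule multiples_ideal[OF M(1) J(1) yc])
  have MW: "M \<subseteq> W"
  proof
    fix k assume "k \<in> M"
    moreover from this have "k = k \<oplus> \<zero> \<otimes> y" using yc ideal_carrier[OF M(1)] by simp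
    ultimately show "k \<in> W" unfolding W_def using ideal_zero[OF J(1)] by blast
  qed
  have "J \<cdot> N \<subseteq> sat P W"
  proof (rule ideal_prod_subset[OF sat_ideal[OF P W]])
    fix j n assume j: "j \<in> J" and n: "n \<in> N"
    have jc: "j \<in> carrier R" using j ideal_carrier[OF J(1)] by simp
    obtain t where t: "n \<in> carrier R" "t \<in> carrier R" "t \<notin> P" "t \<otimes> n \<in> adjoin M y"
      using n N_cyclic by (auto elim!: satE)
    obtain k b where kb: "k \<in> M" "b \<in> carrier R" "t \<otimes> n = k \<oplus> b \<otimes> y"
      using t(4) by (rule adjoinE)
    have "t \<otimes> (j \<otimes> n) = j \<otimes> (t \<otimes> n)" using t jc by (simp add: m_ac)
    also have "\<dots> = (j \<otimes> k) \<oplus> (j \<otimes> b) \<otimes> y"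
      using kb jc yc ideal_carrier[OF M(1)] by (simp add: r_distr m_assoc)
    also have "\<dots> \<in> W"
      unfolding W_def using ideal_mult[OF M(1) kb(1) jc] ideal_mult'[OF J(1) j kb(2)] by blast
    finally show "j \<otimes> n \<in> sat P W" using t jc by (intro satI[of _ t]) auto
  qed
  moreover have "L \<subseteq> sat P W" using M(2) MW sat_superset[OF P ideal_subset[OF W]] by blast
  ultimately have "L <+> J \<cdot> N \<subseteq> sat P W"
    by (intro set_add_subset[OF sat_ideal[OF P W]])
  then have "y \<in> sat P W"
    using sat_subset[OF P ideal_subset[OF W]] le y(1) by blast
  then obtain t where t: "t \<in> carrier R" "t \<notin> P" "t \<otimes> y \<in> W" by (auto elim: satE)
  then obtain k j where kj: "k \<in> M" "j \<in> J" "t \<otimes> y = k \<oplus> j \<otimes> y" unfolding W_def by blast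
  have c: "k \<in> carrier R" "j \<in> carrier R"
    using kj ideal_carrier[OF M(1)] ideal_carrier[OF J(1)] by auto
  have "(t \<ominus> j) \<otimes> y = (t \<otimes> y) \<ominus> (j \<otimes> y)"
    using c t yc by (simp add: a_minus_def l_distr l_minus)
  also have "\<dots> = k"
    using kj(3) c yc by (simp add: a_minus_def a_assoc r_neg)
  finally have "(t \<ominus> j) \<otimes> y \<in> M" using kj by simp
  moreover have "t \<ominus> j \<notin> P"
  proof
    assume "t \<ominus> j \<in> P"
    then have "(t \<ominus> j) \<oplus> j \<in> P"
      using kj(2) J(2) ideal_add[OF prime_ideal[OF P]] by blast
    then show False using t c by (simp add: a_minus_def a_assoc l_neg)
  qed
  ultimately have "y \<in> sat P M" using t c yc by (intro satI[of _ "t \<ominus> j"]) auto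
  then show False using y(2) by simp
qed

text \<open>Noetherian induction: a prime over \<open>K\<close> contains \<open>a\<close> or \<open>b\<close> as soon as \<open>a b \<in> K\<close>, so the
  sets found for \<open>K + (a)\<close> and \<open>K + (b)\<close> together serve for \<open>K\<close>.\<close>

lemma finitely_many_minimal_primes:
  assumes "ideal K R"
  shows "\<exists>F. finite F \<and> (\<forall>Q\<in>F. primeideal Q R \<and> K \<subseteq> Q)
    \<and> (\<forall>Q. primeideal Q R \<longrightarrow> K \<subseteq> Q \<longrightarrow> (\<exists>Q'\<in>F. Q' \<subseteq> Q))"
  using assms
proof (induct K rule: ideal_induct)
  case (step K)
  consider "primeideal K R" | "carrier R = K"
    | a b where "a \<in> carrier R" "b \<in> carrier R" "a \<otimes> b \<in> K" "a \<notin> K" "b \<notin> K"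
    using ideal.primeidealCD[OF step(1) cring_axioms] by blast
  then show ?case
  proof cases
    case 1
    then show ?thesis by (intro exI[of _ "{K}"]) auto
  next
    case 2
    then show ?thesis
      using primeideal.I_notcarr ideal_subset prime_ideal by (intro exI[of _ "{}"]) fastforce
  next
    case 3
    have sub: "K \<subset> adjoin K a" "K \<subset> adjoin K b"
      and I: "ideal (adjoin K a) R" "ideal (adjoin K b) R"
      using 3 adjoin_superset[OF step(1)] adjoin_self[OF step(1)] adjoin_ideal[OF step(1)] by auto
    obtain F where
      F: "finite F" "\<forall>Q\<in>F. primeideal Q R \<and> adjoin K a \<subseteq> Q"
        "\<forall>Q. primeideal Q R \<longrightarrow> adjoin K a \<subseteq> Q \<longrightarrow> (\<exists>Q'\<in>F. Q' \<subseteq> Q)"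
      using step(2)[OF I(1) sub(1)] by auto
    obtain G where
      G: "finite G" "\<forall>Q\<in>G. primeideal Q R \<and> adjoin K b \<subseteq> Q"
        "\<forall>Q. primeideal Q R \<longrightarrow> adjoin K b \<subseteq> Q \<longrightarrow> (\<exists>Q'\<in>G. Q' \<subseteq> Q)"
      using step(2)[OF I(2) sub(2)] by auto
    have "\<exists>Q'\<in>F \<union> G. Q' \<subseteq> Q" if Q: "primeideal Q R" "K \<subseteq> Q" for Q
    proof -
      have "a \<in> Q \<or> b \<in> Q" using 3 Q primeideal.I_prime[OF Q(1)] by auto
      then have "adjoin K a \<subseteq> Q \<or> adjoin K b \<subseteq> Q"
        using adjoin_subset[OF prime_ideal[OF Q(1)] Q(2)] by auto
      then show ?thesis using F(3) G(3) Q(1) by blast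
    qed
    moreover have "\<forall>Q\<in>F \<union> G. primeideal Q R \<and> K \<subseteq> Q"
      using F(2) G(2) sub by blast
    ultimately show ?thesis using F(1) G(1) by (intro exI[of _ "F \<union> G"]) auto
  qed
qed

definition minimal_prime_over :: "'a set \<Rightarrow> 'a set \<Rightarrow> bool" where
  "minimal_prime_over K P \<longleftrightarrow> primeideal P R \<and> K \<subseteq> P
    \<and> (\<forall>Q. primeideal Q R \<longrightarrow> K \<subseteq> Q \<longrightarrow> Q \<subseteq> P \<longrightarrow> Q = P)"

lemma exists_maximalideal_over:
  assumes "ideal K R" "K \<noteq> carrier R"
  shows "\<exists>M. maximalideal M R \<and> K \<subseteq> M"
proof -
  let ?A = "{I. ideal I R \<and> K \<subseteq> I \<and> I \<noteq> carrier R}"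
  have "?A \<subseteq> {I. ideal I R}" "?A \<noteq> {}" using assms by auto
  then obtain M where M: "M \<in> ?A" "\<forall>N\<in>?A. M \<subseteq> N \<longrightarrow> N = M"
    by (rule exists_maximal_ideal[THEN bexE])
  have "maximalideal M R"
    using M by (intro maximalidealI) auto
  then show ?thesis using M by auto
qed

lemma exists_prime_over:
  assumes "ideal K R" "K \<noteq> carrier R"
  shows "\<exists>P. primeideal P R \<and> K \<subseteq> P"
  using exists_maximalideal_over[OF assms] maximalideal_prime by auto

lemma exists_minimal_prime_over:
  assumes "ideal K R" "K \<noteq> carrier R"
  shows "\<exists>P. minimal_prime_over K P"
proof -
  obtain F where F: "finite F" "\<forall>Q\<in>F. primeideal Q R \<and> K \<subseteq> Q"
    "\<forall>Q. primeideal Q R \<longrightarrow> K \<subseteq> Q \<longrightarrow> (\<exists>Q'\<in>F. Q' \<subseteq> Q)"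
    using finitely_many_minimal_primes[OF assms(1)] by blast
  have "F \<noteq> {}" using exists_prime_over[OF assms] F(3) by blast
  then obtain P where "P \<in> F" "\<forall>Q\<in>F. Q \<subseteq> P \<longrightarrow> P = Q"
    using finite_has_minimal[OF F(1)] by blast
  then have "minimal_prime_over K P"
    unfolding minimal_prime_over_def using F by (metis order_trans subset_antisym)
  then show ?thesis by blast
qed

text \<open>This says that \<open>R\<^sub>P / K R\<^sub>P\<close> has a nilpotent maximal ideal. If \<open>a b \<in> K\<close> with \<open>a\<close> outside \<open>P\<close>,
  then \<open>P\<close> is still minimal over the larger ideal \<open>(K : a)\<close>; if \<open>a\<close> and \<open>b\<close> both lie in \<open>P\<close>, it
  is minimal over \<open>K + (a)\<close> and \<open>K + (b)\<close>, whose product lies in \<open>K\<close>.\<close>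

lemma minimal_prime_power:
  assumes "ideal K R" "minimal_prime_over K P"
  shows "\<exists>s\<in>carrier R - P. \<exists>l. \<forall>x\<in>ipow P l. s \<otimes> x \<in> K"
  using assms
proof (induct K rule: ideal_induct)
  case (step K)
  have P: "primeideal P R" "K \<subseteq> P" using step(3) by (auto simp: minimal_prime_over_def)
  have IP: "ideal P R" using prime_ideal[OF P(1)] .
  have IH: "\<exists>s\<in>carrier R - P. \<exists>l. \<forall>x\<in>ipow P l. s \<otimes> x \<in> L"
    if "ideal L R" "K \<subset> L" "L \<subseteq> P" for L
    using step(2)[OF that(1,2)] that step(3) unfolding minimal_prime_over_def by blast
  consider "primeideal K R"
    | a b where "a \<in> carrier R" "b \<in> carrier R" "a \<otimes> b \<in> K" "a \<notin> K" "b \<notin> K"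
    using ideal.primeidealCD[OF step(1) cring_axioms] P prime_one[OF P(1)] one_closed by blast
  then show ?case
  proof cases
    case 1
    then have "K = P" using step(3) P by (auto simp: minimal_prime_over_def)
    then have "\<forall>x\<in>ipow P (Suc 0). \<one> \<otimes> x \<in> K"
      using ipow_1[OF IP] ideal_carrier[OF IP] by simp
    then show ?thesis using prime_one[OF P(1)] by blast
  next
    case 2
    have outside: ?thesis if ab: "a \<in> carrier R" "a \<notin> P" "b \<in> carrier R" "a \<otimes> b \<in> K" "b \<notin> K"
      for a b
    proof -
      have "K \<subseteq> colon K a"
        using ab ideal_mult[OF step(1)] ideal_carrier[OF step(1)] by (auto simp: colon_def)
      moreover have "b \<in> colon K a" using ab by (auto simp: colon_def)
      moreover have "colon K a \<subseteq> P"
        using ab P(2) prime_cancel[OF P(1)] by (auto simp: colon_def)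
      ultimately obtain s l where s: "s \<in> carrier R - P" "\<forall>x\<in>ipow P l. s \<otimes> x \<in> colon K a"
        using IH[OF colon_ideal[OF step(1) ab(1)]] ab(5) by blast
      have "\<forall>x\<in>ipow P l. (a \<otimes> s) \<otimes> x \<in> K"
        using s ab ideal_carrier[OF ipow_ideal[OF IP]] by (auto simp: colon_def m_assoc)
      then show ?thesis using prime_mult[OF P(1), of a s] ab s by blast
    qed
    show ?thesis
    proof (cases "a \<in> P \<and> b \<in> P")
      case False
      then show ?thesis using 2 outside[of a b] outside[of b a] m_comm by auto
    next
      case True
      have "K \<subset> adjoin K a" "K \<subset> adjoin K b" "ideal (adjoin K a) R" "ideal (adjoin K b) R"
        using 2 adjoin_superset[OF step(1)] adjoin_self[OF step(1)] adjoin_ideal[OF step(1)] by auto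
      moreover have "adjoin K a \<subseteq> P" "adjoin K b \<subseteq> P"
        using True P adjoin_subset[OF IP] by auto
      ultimately have "\<exists>s\<in>carrier R - P. \<exists>l. \<forall>x\<in>ipow P l. s \<otimes> x \<in> adjoin K a"
        "\<exists>s\<in>carrier R - P. \<exists>l. \<forall>x\<in>ipow P l. s \<otimes> x \<in> adjoin K b"
        by (intro IH; simp)+
      then obtain s l t m where
        s: "s \<in> carrier R - P" "\<forall>x\<in>ipow P l. s \<otimes> x \<in> adjoin K a" and
        t: "t \<in> carrier R - P" "\<forall>x\<in>ipow P m. t \<otimes> x \<in> adjoin K b"
        by blast
      have st: "s \<otimes> t \<in> carrier R - P" using s t prime_mult[OF P(1)] by blast
      have "ipow P l \<cdot> ipow P m \<subseteq> colon K (s \<otimes> t)"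
      proof (rule ideal_prod_subset)
        show "ideal (colon K (s \<otimes> t)) R" using st by (intro colon_ideal step) auto
        fix i j assume i: "i \<in> ipow P l" and j: "j \<in> ipow P m"
        obtain k u where ku: "k \<in> K" "u \<in> carrier R" "s \<otimes> i = k \<oplus> u \<otimes> a"
          using adjoinE[OF s(2)[rule_format, OF i]] by blast
        obtain k' v where kv: "k' \<in> K" "v \<in> carrier R" "t \<otimes> j = k' \<oplus> v \<otimes> b"
          using adjoinE[OF t(2)[rule_format, OF j]] by blast
        have c: "i \<in> carrier R" "j \<in> carrier R" "k \<in> carrier R" "k' \<in> carrier R"
          using i j ku kv ideal_carrier[OF step(1)] ideal_carrier[OF ipow_ideal[OF IP]] by auto
        have "(s \<otimes> t) \<otimes> (i \<otimes> j) = (s \<otimes> i) \<otimes> (t \<otimes> j)"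
          using s t c by (simp add: m_ac)
        also have "\<dots> = (k' \<oplus> v \<otimes> b) \<otimes> k \<oplus> ((u \<otimes> a) \<otimes> k' \<oplus> (u \<otimes> v) \<otimes> (a \<otimes> b))"
          unfolding ku(3) kv(3) using c 2 ku kv by (simp add: l_distr r_distr m_ac a_ac)
        also have "\<dots> \<in> K"
          using c 2 ku kv ideal_mult[OF step(1)]
          by (intro ideal_add[OF step(1)]) auto
        finally show "i \<otimes> j \<in> colon K (s \<otimes> t)" using c by (simp add: colon_def)
      qed
      then have "\<forall>x\<in>ipow P (l + m). (s \<otimes> t) \<otimes> x \<in> K"
        using ipow_add[OF IP] by (auto simp: colon_def)
      then show ?thesis using st by blast
    qed
  qed
qed

text \<open>Over the local ring at \<open>P\<close> the module \<open>M / P\<^sup>l M\<close> has finite length, so descending chains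
  between \<open>P\<^sup>l M\<close> and \<open>M\<close> stabilise. Instead of counting lengths, the lower bound \<open>B\<close> is
  decreased by one generator \<open>x\<close> with \<open>P x \<subseteq> B\<close> at a time: a chain above \<open>B\<close> either contains
  \<open>x\<close> throughout, or is determined by its sums with \<open>x\<close>.\<close>

definition dcc_above :: "'a set \<Rightarrow> 'a set \<Rightarrow> 'a set \<Rightarrow> bool" where
  "dcc_above P M B \<longleftrightarrow> (\<forall>L :: nat \<Rightarrow> 'a set.
     (\<forall>n. ideal (L n) R \<and> sat P (L n) = L n \<and> L (Suc n) \<subseteq> L n \<and> B \<subseteq> L n \<and> L n \<subseteq> sat P M)
     \<longrightarrow> (\<exists>N. \<forall>n\<ge>N. L n = L N))"

lemma dcc_aboveD:
  assumes "dcc_above P M B"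
    and "\<And>n. ideal (L n) R" "\<And>n. sat P (L n) = L n" "\<And>n. L (Suc n) \<subseteq> L n" "\<And>n. B \<subseteq> L n"
      "\<And>n. L n \<subseteq> sat P M"
  shows "\<exists>N. \<forall>n\<ge>N. L n = L N"
  using assms unfolding dcc_above_def by blast

lemma dcc_above_step:
  assumes P: "primeideal P R" and M: "ideal M R" and B: "ideal B R" and x: "x \<in> M"
    and Px: "\<And>j. j \<in> P \<Longrightarrow> j \<otimes> x \<in> B" and dcc: "dcc_above P M (adjoin B x)"
  shows "dcc_above P M B"
  unfolding dcc_above_def
proof (intro allI impI)
  fix L :: "nat \<Rightarrow> 'a set"
  assume *: "\<forall>n. ideal (L n) R \<and> sat P (L n) = L n \<and> L (Suc n) \<subseteq> L n \<and> B \<subseteq> L n \<and> L n \<subseteq> sat P M"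
  then have L: "\<And>n. ideal (L n) R" "\<And>n. sat P (L n) = L n" "\<And>n. L (Suc n) \<subseteq> L n" "\<And>n. B \<subseteq> L n"
    "\<And>n. L n \<subseteq> sat P M" by auto
  have xc: "x \<in> carrier R" using x ideal_carrier[OF M] by simp
  show "\<exists>N. \<forall>n\<ge>N. L n = L N"
  proof (cases "\<forall>n. x \<in> L n")
    case True
    then show ?thesis
      using L by (intro dcc_aboveD[OF dcc] adjoin_subset) auto
  next
    case False
    then obtain n0 where n0: "x \<notin> L n0" by blast
    have anti: "L n \<subseteq> L m" if "m \<le> n" for m n
      using lift_Suc_antimono_le[of L, OF L(3) that] .
    define L' where "L' n = sat P (adjoin (L n) x)" for n
    have "\<exists>N. \<forall>n\<ge>N. L' n = L' N"
    proof (rule dcc_aboveD[OF dcc])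
      fix n
      have I: "ideal (adjoin (L n) x) R" using adjoin_ideal[OF L(1) xc] .
      show "ideal (L' n) R" unfolding L'_def by (rule sat_ideal[OF P I])
      show "sat P (L' n) = L' n" unfolding L'_def by (rule sat_sat[OF P ideal_subset[OF I]])
      show "L' (Suc n) \<subseteq> L' n" unfolding L'_def by (intro sat_mono adjoin_mono L)
      have "adjoin B x \<subseteq> adjoin (L n) x" by (intro adjoin_mono L)
      then show "adjoin B x \<subseteq> L' n"
        unfolding L'_def by (rule subset_trans[OF _ sat_superset[OF P ideal_subset[OF I]]])
      have "adjoin (L n) x \<subseteq> sat P M"
        using L x sat_superset[OF P ideal_subset[OF M]] sat_ideal[OF P M]
        by (intro adjoin_subset) auto
      then show "L' n \<subseteq> sat P M"
        unfolding L'_def by (rule sat_subset[OF P ideal_subset[OF M]])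
    qed
    then obtain N where N: "\<And>n. n \<ge> N \<Longrightarrow> L' n = L' N" by blast
    have step: "L n \<subseteq> L (Suc n)" if n: "n \<ge> max N n0" for n
    proof
      fix y assume y: "y \<in> L n"
      have yc: "y \<in> carrier R" using y L(1) ideal_carrier by blast
      have In: "ideal (adjoin (L n) x) R" by (rule adjoin_ideal[OF L(1) xc])
      have "y \<in> adjoin (L n) x" using y adjoin_superset[OF L(1)[of n] xc] by (rule rev_subsetD)
      then have "y \<in> L' n"
        unfolding L'_def using sat_superset[OF P ideal_subset[OF In]] by (rule rev_subsetD)
      then have "y \<in> L' (Suc n)" using N[of n] N[of "Suc n"] n by simp
      then obtain s where s: "s \<in> carrier R" "s \<notin> P" "s \<otimes> y \<in> adjoin (L (Suc n)) x"
        unfolding L'_def by (auto elim: satE)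
      then obtain z c where z: "z \<in> L (Suc n)" "c \<in> carrier R" "s \<otimes> y = z \<oplus> c \<otimes> x"
        by (auto elim: adjoinE)
      have "z \<in> L n" using z L(3) by blast
      then have "c \<otimes> x \<in> L n"
        using ideal_cancel[OF L(1), of z n "c \<otimes> x"] z(2,3) xc ideal_mult[OF L(1) y s(1)] by simp
      \<comment> \<open>otherwise \<open>x\<close> itself would belong to \<open>L n\<close>\<close>
      have "c \<in> P"
      proof (rule ccontr)
        assume "c \<notin> P"
        then have "x \<in> sat P (L n)" using z xc \<open>c \<otimes> x \<in> L n\<close> by (intro satI[of _ c]) auto
        then show False using n0 L(2) anti[of n0 n] n by auto
      qed
      then have "c \<otimes> x \<in> L (Suc n)" using Px L(4) by blast
      then have "s \<otimes> y \<in> L (Suc n)" unfolding z(3) using z ideal_add[OF L(1)] by blast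
      then have "y \<in> sat P (L (Suc n))" using s yc by (intro satI[of _ s]) auto
      then show "y \<in> L (Suc n)" using L(2) by simp
    qed
    have "L n = L (max N n0)" if "n \<ge> max N n0" for n
      using that
    proof (induct n rule: dec_induct)
      case (step n)
      then show ?case using \<open>\<And>n. n \<ge> max N n0 \<Longrightarrow> L n \<subseteq> L (Suc n)\<close>[of n] L(3)[of n] by auto
    qed simp
    then show ?thesis by blast
  qed
qed

lemma dcc_above_finite:
  assumes P: "primeideal P R" and M: "ideal M R" and "finite X" "X \<subseteq> M" "ideal B R"
    and "\<And>x j. x \<in> X \<Longrightarrow> j \<in> P \<Longrightarrow> j \<otimes> x \<in> B" and "dcc_above P M (Idl (B \<union> X))"
  shows "dcc_above P M B"
  using assms(3-7)
proof (induct X arbitrary: B rule: finite_induct)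
  case empty
  have "Idl B = B"
    using empty genideal_minimal[of B B] genideal_self[OF ideal_subset[of B]] by blast
  then show ?case using empty by simp
next
  case (insert x X)
  have x: "x \<in> carrier R" "X \<subseteq> carrier R" using insert ideal_subset[OF M] by auto
  have "dcc_above P M (adjoin B x)"
  proof (rule insert(3))
    show "ideal (adjoin B x) R" using insert(5) x(1) by (rule adjoin_ideal)
    show "dcc_above P M (Idl (adjoin B x \<union> X))"
      using insert(7) Idl_adjoin[OF insert(5) x] by simp
    show "j \<otimes> y \<in> adjoin B x" if "y \<in> X" "j \<in> P" for y j
      using that insert(6) adjoin_superset[OF insert(5) x(1)] by blast
  qed (use insert in auto)
  then show ?case
    by (rule dcc_above_step[OF P M insert(5), rotated 2]) (use insert in auto)
qed

lemma dcc_above_power: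
  assumes P: "primeideal P R" and M: "ideal M R"
  shows "dcc_above P M (ipow P l \<cdot> M)"
proof (induct l)
  case 0
  have "\<exists>N. \<forall>n\<ge>N. L n = L N" if *: "\<forall>n. ideal (L n) R \<and> sat P (L n) = L n \<and> L (Suc n) \<subseteq> L n
      \<and> M \<subseteq> L n \<and> L n \<subseteq> sat P M" for L :: "nat \<Rightarrow> 'a set"
  proof -
    have "L n = sat P M" for n
      using * sat_mono[of M "L n" P] by blast
    then show ?thesis by simp
  qed
  moreover have "carrier R \<cdot> M = M"
    using ideal_prod_commute[OF oneideal M] ideal_prod_one[OF M] by simp
  ultimately show ?case by (simp add: dcc_above_def)
next
  case (Suc l)
  have IP: "ideal P R" using prime_ideal[OF P] .
  let ?B = "ipow P (Suc l) \<cdot> M" and ?B' = "ipow P l \<cdot> M"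
  have I: "ideal ?B R" "ideal ?B' R"
    by (intro ideal_prod_is_ideal ipow_ideal IP M)+
  obtain X where X: "X \<subseteq> carrier R" "finite X" "?B' = Idl X" "X \<subseteq> ?B'"
    using finite_generators[OF I(2)] .
  show ?case
  proof (rule dcc_above_finite[OF P M X(2)])
    show "X \<subseteq> M" using X(4) ideal_prod_inter[OF ipow_ideal[OF IP] M] by blast
    show "ideal ?B R" using I by simp
    show "j \<otimes> x \<in> ?B" if "x \<in> X" "j \<in> P" for x j
    proof -
      have "j \<otimes> x \<in> P \<cdot> ?B'" using that X(4) by (intro ideal_prod.prod) auto
      also have "P \<cdot> ?B' = (P \<cdot> ipow P l) \<cdot> M"
        using ideal_prod_assoc[OF IP ipow_ideal[OF IP] M] by simp
      also have "P \<cdot> ipow P l = ipow P (Suc l)"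
        using ideal_prod_commute[OF IP ipow_ideal[OF IP]] by simp
      finally show ?thesis .
    qed
    have BX: "?B \<union> X \<subseteq> carrier R" using X ideal_subset[OF I(1)] by auto
    have "?B' \<subseteq> Idl (?B \<union> X)"
      unfolding X(3) using genideal_self[OF BX] by (intro genideal_minimal genideal_ideal BX) auto
    then show "dcc_above P M (Idl (?B \<union> X))"
      using Suc unfolding dcc_above_def by (meson subset_trans)
  qed
qed

lemma descending_chain_stabilises:
  assumes "primeideal P R" "ideal M R"
    and "\<And>n::nat. ideal (L n) R" "\<And>n. sat P (L n) = L n" "\<And>n. L (Suc n) \<subseteq> L n"
      "\<And>n. ipow P l \<cdot> M \<subseteq> L n" "\<And>n. L n \<subseteq> sat P M"
  shows "\<exists>N. \<forall>n\<ge>N. L n = L N"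
  by (rule dcc_aboveD[OF dcc_above_power[OF assms(1,2), of l], of L]) (rule assms)+

end

section \<open>Krull's principal ideal theorem and chains of primes\<close>

context cring
begin

lemma Idl_insert:
  assumes "x \<in> carrier R" "X \<subseteq> carrier R"
  shows "Idl (insert x X) = adjoin (Idl X) x"
proof
  have I: "ideal (Idl X) R" using assms(2) by (rule genideal_ideal)
  have xX: "insert x X \<subseteq> carrier R" using assms by simp
  have A: "ideal (adjoin (Idl X) x) R" using I assms(1) by (rule adjoin_ideal)
  show "Idl (insert x X) \<subseteq> adjoin (Idl X) x"
    using A adjoin_self[OF I assms(1)] adjoin_superset[OF I assms(1)] genideal_self[OF assms(2)]
    by (intro genideal_minimal) auto
  show "adjoin (Idl X) x \<subseteq> Idl (insert x X)"
    using genideal_self[OF xX] subset_Idl_subset[OF xX, of X]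
    by (intro adjoin_subset[OF genideal_ideal[OF xX]]) auto
qed

lemma Idl_empty: "Idl {} = {\<zero>}"
  using genideal_minimal[OF zeroideal, of "{}"] ideal_zero[OF genideal_ideal, of "{}"] by auto

lemma Idl_of_ideal: "ideal K R \<Longrightarrow> Idl K = K"
  using genideal_minimal[of K K] genideal_self[OF ideal_subset[of K]] by auto

lemma sat_proper: "primeideal P R \<Longrightarrow> K \<subseteq> P \<Longrightarrow> sat P K \<subseteq> P"
  by (rule sat_subset_prime) auto

lemma prime_pow:
  assumes "primeideal Q R" "x \<in> carrier R" "x [^] (n::nat) \<in> Q"
  shows "x \<in> Q"
  using assms(3)
proof (induct n)
  case 0
  then show ?case using prime_one[OF assms(1)] by simp
next
  case (Suc n)
  then show ?case
    using assms(2) primeideal.I_prime[OF assms(1), of "x [^] n" x] by auto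
qed

lemma adjoin_satE:
  assumes "y \<in> sat P (adjoin K x)" 
  obtains s k b where "s \<in> carrier R" "s \<notin> P" "k \<in> K" "b \<in> carrier R" "s \<otimes> y = k \<oplus> b \<otimes> x"
proof -
  obtain s where s: "s \<in> carrier R" "s \<notin> P" "s \<otimes> y \<in> adjoin K x"
    using satE[OF assms] by blast
  show ?thesis using adjoinE[OF s(3)] that s by metis
qed

inductive prime_chain :: "nat \<Rightarrow> 'a set \<Rightarrow> 'a set \<Rightarrow> bool" where
  base: "primeideal P R \<Longrightarrow> prime_chain 0 P P"
| step: "prime_chain n B Q \<Longrightarrow> primeideal P R \<Longrightarrow> Q \<subset> P \<Longrightarrow> prime_chain (Suc n) B P"

lemma prime_chain_0: "prime_chain 0 B P \<Longrightarrow> B = P"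
  by (erule prime_chain.cases) auto

lemma prime_chain_SucE:
  assumes "prime_chain (Suc n) B P"
  obtains Q where "prime_chain n B Q" "primeideal P R" "Q \<subset> P"
  using assms by (rule prime_chain.cases) auto

lemma prime_chain_prime:
  "prime_chain n B P \<Longrightarrow> primeideal P R" "prime_chain n B P \<Longrightarrow> primeideal B R"
  by (induct rule: prime_chain.induct) auto

lemma prime_chain_subset: "prime_chain n B P \<Longrightarrow> B \<subseteq> P"
  by (induct rule: prime_chain.induct) auto

lemma prime_chain_trivial: "prime_chain n P P \<Longrightarrow> n = 0"
  by (erule prime_chain.cases) (use prime_chain_subset in auto)

end

context noetherian_cring
begin

text \<open>Krull's principal ideal theorem modulo \<open>Q0\<close>. If \<open>P\<close> were minimal over \<open>Q0 + (x)\<close>, then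
  the symbolic powers \<open>S n\<close> of \<open>Q1\<close> would stabilise modulo \<open>x\<close>, since \<open>R / (x)\<close> has
  finite length at \<open>P\<close>. Nakayama's lemma at \<open>P\<close> removes \<open>x\<close>, and Nakayama's lemma at \<open>Q1\<close>
  then gives \<open>Q1 \<subseteq> Q0\<close>.\<close>

lemma principal_ideal_theorem:
  assumes Q0: "primeideal Q0 R" and Q1: "primeideal Q1 R" and P: "primeideal P R"
    and lt: "Q0 \<subset> Q1" "Q1 \<subset> P" and x: "x \<in> P"
  shows "\<exists>Q. primeideal Q R \<and> Q0 \<subseteq> Q \<and> x \<in> Q \<and> Q \<subset> P"
proof (rule ccontr)
  assume no: "\<not> ?thesis"
  have I0: "ideal Q0 R" and I1: "ideal Q1 R" and IP: "ideal P R"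
    using Q0 Q1 P by (auto intro: prime_ideal)
  have xc: "x \<in> carrier R" using x ideal_carrier[OF IP] by simp
  have x1: "x \<notin> Q1" using no Q1 lt by auto
  have Ix: "ideal (adjoin Q0 x) R" using I0 xc by (rule adjoin_ideal)
  have "minimal_prime_over (adjoin Q0 x) P"
    unfolding minimal_prime_over_def
  proof (intro conjI allI impI P)
    show "adjoin Q0 x \<subseteq> P" using adjoin_subset[OF IP _ x, of Q0] lt by auto
    fix Q assume Q: "primeideal Q R" "adjoin Q0 x \<subseteq> Q" "Q \<subseteq> P"
    have "Q0 \<subseteq> Q" "x \<in> Q"
      using Q(2) adjoin_superset[OF I0 xc] adjoin_self[OF I0 xc] by (meson subset_trans, meson subsetD)
    then show "Q = P" using no Q(1,3) by (metis psubsetI)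
  qed
  then obtain s l where s: "s \<in> carrier R - P" "\<forall>y\<in>ipow P l. s \<otimes> y \<in> adjoin Q0 x"
    using minimal_prime_power[OF Ix] by blast
  define S where "S n = sat Q1 (Q0 <+> ipow Q1 n)" for n
  have Isum: "ideal (Q0 <+> ipow Q1 n) R" for n
    by (intro add_ideals I0 ipow_ideal I1)
  have IS: "ideal (S n) R" for n
    unfolding S_def by (rule sat_ideal[OF Q1 Isum])
  have sum_le: "Q0 \<subseteq> Q0 <+> ipow Q1 n" "ipow Q1 n \<subseteq> Q0 <+> ipow Q1 n" for n
  proof -
    have z: "\<zero> \<in> ipow Q1 n" "\<zero> \<in> Q0" using ideal_zero ipow_ideal[OF I1] I0 by auto
    show "Q0 \<subseteq> Q0 <+> ipow Q1 n"
    proof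
      fix y assume "y \<in> Q0"
      then show "y \<in> Q0 <+> ipow Q1 n"
        using z ideal_carrier[OF I0] unfolding mem_set_add by (intro bexI[of _ y] bexI[of _ \<zero>]) auto
    qed
    show "ipow Q1 n \<subseteq> Q0 <+> ipow Q1 n"
    proof
      fix y assume "y \<in> ipow Q1 n"
      then show "y \<in> Q0 <+> ipow Q1 n"
        using z ideal_carrier[OF ipow_ideal[OF I1]] unfolding mem_set_add
        by (intro bexI[of _ \<zero>] bexI[of _ y]) auto
    qed
  qed
  have sum_S: "Q0 <+> ipow Q1 n \<subseteq> S n" for n
    unfolding S_def by (rule sat_superset[OF Q1 ideal_subset[OF Isum]])
  have S_anti: "S (Suc n) \<subseteq> S n" for n
  proof -
    have "ipow Q1 (Suc n) \<subseteq> ipow Q1 n" using ipow_antimono[OF I1, of n "Suc n"] by simp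
    then have "Q0 <+> ipow Q1 (Suc n) \<subseteq> (Q0 <+> ipow Q1 n :: 'a set)"
      using sum_le[of n] by (intro set_add_subset[OF Isum]) auto
    then show ?thesis unfolding S_def by (rule sat_mono)
  qed
  define L where "L n = sat P (adjoin (S n) x)" for n
  have IA: "ideal (adjoin (S n) x) R" for n using IS xc by (rule adjoin_ideal)
  have "\<exists>N. \<forall>n\<ge>N. L n = L N"
  proof (rule descending_chain_stabilises[OF P oneideal, where l = l])
    fix n
    show "ideal (L n) R" unfolding L_def by (rule sat_ideal[OF P IA])
    show "sat P (L n) = L n" unfolding L_def by (rule sat_sat[OF P ideal_subset[OF IA]])
    show "L (Suc n) \<subseteq> L n" unfolding L_def by (intro sat_mono adjoin_mono S_anti)
    show "L n \<subseteq> sat P (carrier R)"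
      unfolding L_def by (intro sat_mono ideal_subset[OF IA])
    have "Q0 \<subseteq> S n" using sum_le(1) sum_S by (rule subset_trans)
    then have le: "adjoin Q0 x \<subseteq> adjoin (S n) x" by (rule adjoin_mono)
    have "ipow P l \<subseteq> L n"
    proof
      fix y assume y: "y \<in> ipow P l"
      then have "s \<otimes> y \<in> adjoin (S n) x" using s(2) le by auto
      then show "y \<in> L n"
        unfolding L_def using s(1) y ideal_carrier[OF ipow_ideal[OF IP]] by (intro satI[of _ s]) auto
    qed
    then show "ipow P l \<cdot> carrier R \<subseteq> L n"
      using ideal_prod_one[OF ipow_ideal[OF IP]] by simp
  qed
  then obtain N where "\<forall>n\<ge>N. L n = L N" by blast
  then have N: "L N = L (Suc N)" by (metis le_Suc_eq order_refl)
  have "S N \<subseteq> sat P (S (Suc N) <+> P \<cdot> S N)"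
  proof
    fix y assume y: "y \<in> S N"
    have yc: "y \<in> carrier R" using y ideal_carrier[OF IS] by simp
    have "y \<in> adjoin (S N) x" using y adjoin_superset[OF IS xc] by (rule rev_subsetD)
    then have "y \<in> L N" unfolding L_def
      using sat_superset[OF P ideal_subset[OF IA]] by (rule rev_subsetD)
    then have "y \<in> sat P (adjoin (S (Suc N)) x)" using N unfolding L_def by simp
    then obtain t z b where t: "t \<in> carrier R" "t \<notin> P" "z \<in> S (Suc N)" "b \<in> carrier R"
      "t \<otimes> y = z \<oplus> b \<otimes> x" by (rule adjoin_satE)
    have zN: "z \<in> S N" using t(3) S_anti by (rule rev_subsetD)
    have "b \<otimes> x \<in> S N"
      using ideal_cancel[OF IS zN, of "b \<otimes> x"] t(4,5) xc ideal_mult[OF IS y t(1)] by simp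
    then have "x \<otimes> b \<in> S N" using m_comm[OF t(4) xc] by simp
    then have "b \<in> S N"
      using sat_cancel[OF Q1, of x b] xc x1 t(4) unfolding S_def by simp
    then have "x \<otimes> b \<in> P \<cdot> S N" using x by (intro ideal_prod.prod)
    then have "b \<otimes> x \<in> P \<cdot> S N" using m_comm[OF t(4) xc] by simp
    then have "t \<otimes> y \<in> S (Suc N) <+> P \<cdot> S N"
      unfolding mem_set_add using t(3,5) by auto
    then show "y \<in> sat P (S (Suc N) <+> P \<cdot> S N)"
      using t yc by (intro satI[of _ t]) auto
  qed
  then have "S N \<subseteq> sat P (S (Suc N))"
    by (intro nakayama[OF P IS IP _ IS]) auto
  also have "sat P (S (Suc N)) \<subseteq> sat Q1 (S (Suc N))"
    using lt unfolding sat_def by auto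
  also have "sat Q1 (S (Suc N)) = S (Suc N)"
    unfolding S_def by (rule sat_sat[OF Q1 ideal_subset[OF Isum]])
  finally have "S N \<subseteq> S (Suc N)" .
  then have "ipow Q1 N \<subseteq> S (Suc N)" using sum_le(2)[of N] sum_S[of N] by (meson subset_trans)
  moreover have "ipow Q1 (Suc N) = Q1 \<cdot> ipow Q1 N"
    using ideal_prod_commute[OF I1 ipow_ideal[OF I1]] by simp
  ultimately have "ipow Q1 N \<subseteq> sat Q1 (Q0 <+> Q1 \<cdot> ipow Q1 N)" unfolding S_def by metis
  then have "ipow Q1 N \<subseteq> sat Q1 Q0"
    by (intro nakayama[OF Q1 I0 I1 _ ipow_ideal[OF I1]]) auto
  also have "sat Q1 Q0 = Q0" using lt by (intro sat_prime[OF Q0 _ Q1]) auto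
  finally have sub: "ipow Q1 N \<subseteq> Q0" .
  have "Q1 \<subseteq> Q0"
  proof
    fix y assume y: "y \<in> Q1"
    have "y [^] N \<in> ipow Q1 (1 * N)"
      using y ipow_1[OF I1] by (intro pow_mem_ipow[OF I1]) simp
    then have "y [^] N \<in> Q0" using sub by auto
    then show "y \<in> Q0" using prime_pow[OF Q0] y ideal_carrier[OF I1] by blast
  qed
  then show False using lt by auto
qed

text \<open>Passing to the quotient by one element of \<open>P\<close> shortens a chain below \<open>P\<close> by at most one:
  the principal ideal theorem pushes \<open>x\<close> down the chain, prime by prime.\<close>

lemma prime_chain_through:
  "prime_chain (Suc n) B P \<Longrightarrow> x \<in> P \<Longrightarrow> \<exists>B'. prime_chain n B' P \<and> B \<subseteq> B' \<and> x \<in> B'"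
proof (induct n arbitrary: P)
  case 0
  then show ?case
    using prime_chain_prime(1)[OF 0(1)] prime_chain_subset[OF 0(1)] prime_chain.base by auto
next
  case (Suc n)
  obtain Q where Q: "prime_chain (Suc n) B Q" "primeideal P R" "Q \<subset> P"
    using prime_chain_SucE[OF Suc(2)] .
  show ?case
  proof (cases "x \<in> Q")
    case True
    then show ?thesis using Suc(1)[OF Q(1)] prime_chain.step Q by blast
  next
    case False
    obtain Q' where Q': "prime_chain n B Q'" "primeideal Q R" "Q' \<subset> Q"
      using prime_chain_SucE[OF Q(1)] .
    obtain Q'' where Q'': "primeideal Q'' R" "Q' \<subseteq> Q''" "x \<in> Q''" "Q'' \<subset> P"
      using principal_ideal_theorem[OF prime_chain_prime(1)[OF Q'(1)] Q'(2) Q(2) Q'(3) Q(3) Suc(3)]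
      by auto
    have "Q' \<subset> Q''" using Q'' Q' False by auto
    then have "prime_chain (Suc n) B Q''" using Q' Q'' prime_chain.step by auto
    then show ?thesis using Suc(1)[of Q''] prime_chain.step Q Q'' by blast
  qed
qed

text \<open>The dimension of a local ring, here \<open>R\<^sub>P / K R\<^sub>P\<close>, is at most the number of generators of its
  maximal ideal: each generator shortens a chain by at most one.\<close>

lemma prime_chain_length_le:
  assumes "finite U" "ideal K R" "U \<subseteq> P" "P \<subseteq> sat P (Idl (K \<union> U))" "K \<subseteq> B" "prime_chain n B P"
  shows "n \<le> card U"
  using assms
proof (induct U arbitrary: K B n rule: finite_induct)
  case empty
  have P: "primeideal P R" "primeideal B R" "B \<subseteq> P"
    using prime_chain_prime[OF empty(5)] prime_chain_subset[OF empty(5)] by auto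
  have "P \<subseteq> sat P K" using empty(3) Idl_of_ideal[OF empty(1)] by simp
  then have "P \<subseteq> B" using sat_subset_prime[OF P(2,3,1) empty(4)] by auto
  then show ?case using prime_chain_trivial empty(5) P(3) by auto
next
  case (insert x U)
  show ?case
  proof (cases n)
    case (Suc m)
    have P: "primeideal P R" using prime_chain_prime(1)[OF insert(8)] .
    have xU: "x \<in> carrier R" "U \<subseteq> carrier R" "x \<in> P"
      using insert(5) ideal_subset[OF prime_ideal[OF P]] by auto
    obtain B' where B': "prime_chain m B' P" "B \<subseteq> B'" "x \<in> B'"
      using prime_chain_through[OF _ xU(3)] insert(8) Suc by blast
    have "m \<le> card U"
    proof (rule insert(3)[OF _ _ _ _ B'(1)])
      show "ideal (adjoin K x) R" using insert(4) xU(1) by (rule adjoin_ideal)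
      show "U \<subseteq> P" using insert(5) by auto
      show "P \<subseteq> sat P (Idl (adjoin K x \<union> U))"
        using insert(6) Idl_adjoin[OF insert(4) xU(1,2)] by simp
      show "adjoin K x \<subseteq> B'"
        using insert(7) B' by (intro adjoin_subset[OF prime_ideal[OF prime_chain_prime(2)[OF B'(1)]]]) auto
    qed
    then show ?thesis using Suc insert(1,2) by simp
  qed simp
qed

text \<open>A regular local ring is a domain, relative to \<open>K\<close>: the bottom prime \<open>B\<close> of a chain of
  maximal length agrees with \<open>K\<close> modulo \<open>x B\<close>, where \<open>x\<close> is one of the generators of the
  maximal ideal, and Nakayama's lemma applies.\<close>

lemma sat_eq_bottom_prime:
  assumes "finite U" "ideal K R" "U \<subseteq> P" "P \<subseteq> sat P (Idl (K \<union> U))" "K \<subseteq> B"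
    "prime_chain (card U) B P"
  shows "sat P K = B"
  using assms
proof (induct U arbitrary: K B rule: finite_induct)
  case empty
  have P: "primeideal P R" using prime_chain_prime(1)[OF empty(5)] .
  have "B = P" using empty(5) prime_chain_0 by simp
  then show ?case
    using empty(3,4) Idl_of_ideal[OF empty(1)] sat_proper[OF P, of K] by auto
next
  case (insert x U)
  have chain: "prime_chain (Suc (card U)) B P" using insert(1,2,8) by simp
  have P: "primeideal P R" "primeideal B R" "B \<subseteq> P"
    using prime_chain_prime[OF chain] prime_chain_subset[OF chain] by auto
  have IP: "ideal P R" "ideal B R" using P prime_ideal by auto
  have xU: "x \<in> carrier R" "U \<subseteq> carrier R" "x \<in> P" "U \<subseteq> P"
    using insert(5) ideal_subset[OF IP(1)] by auto
  have "x \<notin> B"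
  proof
    assume "x \<in> B"
    have BU: "B \<union> U \<subseteq> carrier R" using xU ideal_subset[OF IP(2)] by auto
    have "Idl (K \<union> insert x U) \<subseteq> Idl (B \<union> U)"
      using genideal_self[OF BU] insert(7) \<open>x \<in> B\<close>
      by (intro genideal_minimal genideal_ideal[OF BU]) auto
    then have "P \<subseteq> sat P (Idl (B \<union> U))"
      using insert(6) sat_mono[of "Idl (K \<union> insert x U)" "Idl (B \<union> U)" P] by auto
    then have "Suc (card U) \<le> card U"
      by (intro prime_chain_length_le[OF insert(1) IP(2) xU(4) _ _ chain]) auto
    then show False by simp
  qed
  obtain B' where B': "prime_chain (card U) B' P" "B \<subseteq> B'" "x \<in> B'"
    using prime_chain_through[OF chain xU(3)] by auto
  have IK: "ideal (adjoin K x) R" using insert(4) xU(1) by (rule adjoin_ideal)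
  \<comment> \<open>\<open>B'\<close> is the bottom prime for \<open>K + (x)\<close> although it was obtained from \<open>B\<close>\<close>
  have eq: "sat P (adjoin K x) = B'"
  proof (rule insert(3)[OF IK xU(4) _ _ B'(1)])
    show "P \<subseteq> sat P (Idl (adjoin K x \<union> U))"
      using insert(6) Idl_adjoin[OF insert(4) xU(1,2)] by simp
    show "adjoin K x \<subseteq> B'"
      using insert(7) B' by (intro adjoin_subset[OF prime_ideal[OF prime_chain_prime(2)[OF B'(1)]]]) auto
  qed
  have "B \<subseteq> sat P (K <+> P \<cdot> B)"
  proof
    fix y assume y: "y \<in> B"
    then have "y \<in> sat P (adjoin K x)" using B'(2) eq by auto
    then obtain s k b where s: "s \<in> carrier R" "s \<notin> P" "k \<in> K" "b \<in> carrier R"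
      "s \<otimes> y = k \<oplus> b \<otimes> x" by (rule adjoin_satE)
    have kB: "k \<in> B" using s(3) insert(7) by auto
    have "b \<otimes> x \<in> B"
      using ideal_cancel[OF IP(2) kB, of "b \<otimes> x"] s(4,5) xU ideal_mult[OF IP(2) y s(1)] by simp
    then have "b \<in> B" using \<open>x \<notin> B\<close> primeideal.I_prime[OF P(2) s(4) xU(1)] by auto
    then have "x \<otimes> b \<in> P \<cdot> B" using xU(3) by (intro ideal_prod.prod)
    then have "b \<otimes> x \<in> P \<cdot> B" using m_comm[OF s(4) xU(1)] by simp
    then have "s \<otimes> y \<in> K <+> P \<cdot> B" unfolding mem_set_add using s(3,5) by auto
    then show "y \<in> sat P (K <+> P \<cdot> B)"
      using s y ideal_carrier[OF IP(2)] by (intro satI[of _ s]) auto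
  qed
  then have "B \<subseteq> sat P K" by (intro nakayama[OF P(1) insert(4) IP(1) _ IP(2)]) auto
  moreover have "sat P K \<subseteq> B" by (rule sat_subset_prime[OF P(2,3,1) insert(7)])
  ultimately show ?case by auto
qed

section \<open>Regular systems of parameters\<close>

text \<open>\<open>U\<close> generates the maximal ideal of \<open>R\<^sub>P\<close> and has at most \<open>dim R\<^sub>P\<close> elements; the dimension
  enters only through the existence of a long enough chain of primes.\<close>

definition regular_parameters :: "'a set \<Rightarrow> 'a set \<Rightarrow> bool" where
  "regular_parameters P U \<longleftrightarrow> primeideal P R \<and> finite U \<and> U \<subseteq> P \<and> P \<subseteq> sat P (Idl U)
     \<and> (\<exists>B. prime_chain (card U) B P)"

text \<open>Adding the elements of \<open>V\<close> to the bottom of the chain one at a time shows that the remaining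
  elements are parameters of \<open>R\<^sub>P / (V)\<close>, which is therefore a domain. An \<open>x\<close> in \<open>(V)\<close> could be left
  out, and the chain would be too long.\<close>

lemma regular_parameters_subset:
  assumes reg: "regular_parameters P U" and V: "V \<subseteq> U"
  shows "primeideal (sat P (Idl V)) R \<and> (\<forall>x\<in>U - V. x \<notin> sat P (Idl V))"
proof -
  have P: "primeideal P R" and U: "finite U" "U \<subseteq> P" "P \<subseteq> sat P (Idl U)"
    using reg by (auto simp: regular_parameters_def)
  obtain B where B: "prime_chain (card U) B P" using reg by (auto simp: regular_parameters_def)
  have Uc: "U \<subseteq> carrier R" using U(2) ideal_subset[OF prime_ideal[OF P]] by auto
  have Vc: "V \<subseteq> carrier R" using V Uc by auto
  have "finite V" using V U(1) finite_subset by blast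
  then have "\<exists>B. prime_chain (card (U - V)) B P \<and> V \<subseteq> B"
    using V
  proof (induct V rule: finite_induct)
    case empty
    then show ?case using B by auto
  next
    case (insert x V)
    obtain B where B: "prime_chain (card (U - V)) B P" "V \<subseteq> B" using insert by auto
    have "card (U - V) = Suc (card (U - insert x V))"
      using insert U(1) by (metis Diff_iff Diff_insert card.remove finite_Diff insert_subset)
    then have "prime_chain (Suc (card (U - insert x V))) B P" using B by simp
    moreover have "x \<in> P" using insert(4) U(2) by blast
    ultimately obtain B' where "prime_chain (card (U - insert x V)) B' P" "B \<subseteq> B'" "x \<in> B'"
      using prime_chain_through by blast
    then show ?case using B by auto
  qed
  then obtain B where B: "prime_chain (card (U - V)) B P" "V \<subseteq> B" by auto
  have IB: "ideal B R" using prime_chain_prime(2)[OF B(1)] prime_ideal by auto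
  have IV: "ideal (Idl V) R" using Vc by (rule genideal_ideal)
  have VB: "Idl V \<subseteq> B" using IB B(2) by (rule genideal_minimal)
  have generate: "P \<subseteq> sat P (Idl (K \<union> W))"
    if "ideal K R" "W \<subseteq> carrier R" "U \<subseteq> K \<union> W" for K W
  proof -
    have KW: "K \<union> W \<subseteq> carrier R" using that ideal_subset by auto
    have "Idl U \<subseteq> Idl (K \<union> W)" using KW that(3) by (rule subset_Idl_subset)
    then show ?thesis using U(3) sat_mono by blast
  qed
  have "P \<subseteq> sat P (Idl (Idl V \<union> (U - V)))"
    by (rule generate[OF IV]) (use Uc genideal_self[OF Vc] in auto)
  then have eq: "sat P (Idl V) = B"
    by (rule sat_eq_bottom_prime[OF _ IV _ _ VB B(1), rotated 2]) (use U in auto)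
  have "x \<notin> B" if x: "x \<in> U - V" for x
  proof
    assume "x \<in> B"
    have "P \<subseteq> sat P (Idl (B \<union> (U - V - {x})))"
      by (rule generate[OF IB]) (use Uc B(2) \<open>x \<in> B\<close> in auto)
    then have "card (U - V) \<le> card (U - V - {x})"
      by (rule prime_chain_length_le[OF _ IB _ _ _ B(1), rotated 2]) (use U in auto)
    then show False using x U(1) by (metis card_Diff1_less finite_Diff not_less)
  qed
  then show ?thesis using eq prime_chain_prime(2)[OF B(1)] by simp
qed

text \<open>The ideal generated by powers of part of a regular system of parameters is primary. The
  exponents are lowered one at a time; this uses that the remaining parameters stay regular in
  any order, which is why \<open>regular_parameters_subset\<close> speaks of all subsets \<open>V\<close>.\<close>

lemma parameter_powers_primary:
  assumes reg: "regular_parameters P U"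
  shows "V \<subseteq> U \<Longrightarrow> (\<And>v. v \<in> V \<Longrightarrow> n v \<ge> (1::nat)) \<Longrightarrow> y \<in> carrier R \<Longrightarrow> y \<notin> sat P (Idl V)
    \<Longrightarrow> z \<in> carrier R \<Longrightarrow> y \<otimes> z \<in> sat P (Idl ((\<lambda>v. v [^] n v) ` V))
    \<Longrightarrow> z \<in> sat P (Idl ((\<lambda>v. v [^] n v) ` V))"
proof (induct "sum n V" arbitrary: V n y z rule: less_induct)
  case less
  let ?pw = "\<lambda>n V. Idl ((\<lambda>v. v [^] (n v::nat)) ` V)"
  have P: "primeideal P R" "finite U" "U \<subseteq> P" using reg by (auto simp: regular_parameters_def)
  have Uc: "U \<subseteq> carrier R" using P ideal_subset[OF prime_ideal] by blast
  have Vc: "V \<subseteq> carrier R" "finite V" using less(2) Uc P(2) finite_subset by auto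
  show ?case
  proof (cases "\<forall>v\<in>V. n v = 1")
    case True
    then have "(\<lambda>v. v [^] n v) ` V = V" using Vc by (force simp: image_iff)
    then show ?thesis
      using less(4-7) prime_cancel[of "sat P (Idl V)" y z] regular_parameters_subset[OF reg less(2)]
      by simp
  next
    case False
    then obtain i where i: "i \<in> V" "n i \<noteq> 1" by auto
    define m where "m = n i - 1"
    have m: "n i = Suc m" "m \<ge> 1" using i less(3)[of i] unfolding m_def by auto
    have ic: "i \<in> carrier R" using i Vc by auto
    define J where "J = ?pw n (V - {i})"
    have Jc: "(\<lambda>v. v [^] n v) ` (V - {i}) \<subseteq> carrier R" using Vc by auto
    have IJ: "ideal J R" unfolding J_def using Jc by (rule genideal_ideal)
    have pw: "?pw (n(i := k)) V = adjoin J (i [^] k)" for k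
    proof -
      have "(\<lambda>v. v [^] (n(i := k)) v) ` V = insert (i [^] k) ((\<lambda>v. v [^] n v) ` (V - {i}))"
        using i by auto
      then show ?thesis using Idl_insert[OF _ Jc] ic unfolding J_def by simp
    qed
    have pwn: "?pw n V = adjoin J (i [^] Suc m)"
      using pw[of "n i"] m(1) by (simp add: fun_upd_idem)
    have sum_upd: "sum (n(i := k)) V < sum n V" if "k < n i" for k
      using that i Vc by (intro sum_strict_mono_ex1) auto
    have sum_del: "sum n (V - {i}) < sum n V"
      using sum.remove[OF Vc(2) i(1), of n] m by simp
    have IA: "ideal (adjoin J (i [^] (k::nat))) R" for k using IJ ic by (intro adjoin_ideal) auto
    have "i [^] m \<in> adjoin J (i [^] m)" using ic by (intro adjoin_self[OF IJ]) simp
    then have "i [^] Suc m \<in> adjoin J (i [^] m)"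
      using ideal_mult'[OF IA _ ic] by simp
    then have "adjoin J (i [^] Suc m) \<subseteq> adjoin J (i [^] m)"
      using adjoin_superset[OF IJ] ic by (intro adjoin_subset[OF IA]) auto
    then have "y \<otimes> z \<in> sat P (adjoin J (i [^] m))"
      using less(7) pwn sat_mono by (metis (no_types, lifting) subsetD)
    then have "z \<in> sat P (?pw (n(i := m)) V)"
      using less(1)[OF sum_upd[of m] less(2) _ less(4-6)] less(3) m unfolding pw by auto
    then have "z \<in> sat P (adjoin J (i [^] m))" unfolding pw .
    then obtain s o1 w where s: "s \<in> carrier R" "s \<notin> P" "o1 \<in> J" "w \<in> carrier R"
      "s \<otimes> z = o1 \<oplus> w \<otimes> i [^] m" by (rule adjoin_satE)
    obtain t o2 c where t: "t \<in> carrier R" "t \<notin> P" "o2 \<in> J" "c \<in> carrier R"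
      "t \<otimes> (y \<otimes> z) = o2 \<oplus> c \<otimes> i [^] Suc m"
      using less(7) unfolding pwn by (rule adjoin_satE)
    have oc: "o1 \<in> carrier R" "o2 \<in> carrier R" using s(3) t(3) ideal_carrier[OF IJ] by auto
    have im: "i [^] m \<in> carrier R" using ic by simp
    \<comment> \<open>comparing two expressions for \<open>s t y z\<close>; \<open>d\<close> is annihilated by \<open>i\<^sup>m\<close> modulo \<open>J\<close>\<close>
    define d where "d = t \<otimes> y \<otimes> w \<ominus> s \<otimes> c \<otimes> i"
    have dc: "d \<in> carrier R" unfolding d_def using s t ic less(4) by simp
    have "i [^] m \<otimes> d = t \<otimes> y \<otimes> (w \<otimes> i [^] m) \<ominus> s \<otimes> (c \<otimes> i [^] Suc m)"
      unfolding d_def using s t ic im less(4)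
      by (simp add: a_minus_def r_distr r_minus m_ac)
    also have "w \<otimes> i [^] m = s \<otimes> z \<ominus> o1"
      using s oc im less(6) by (simp add: a_minus_def a_ac r_neg1 r_neg2)
    also have "c \<otimes> i [^] Suc m = t \<otimes> (y \<otimes> z) \<ominus> o2"
      unfolding t(5) using t(4) oc im ic by (simp add: a_minus_def a_ac r_neg1 r_neg2)
    also have "t \<otimes> y \<otimes> (s \<otimes> z \<ominus> o1) \<ominus> s \<otimes> (t \<otimes> (y \<otimes> z) \<ominus> o2)
      = s \<otimes> o2 \<ominus> t \<otimes> y \<otimes> o1"
      using s(1) t(1) oc less(4,6) by algebra
    also have "\<dots> \<in> J"
      using s t oc less(4) by (intro ideal_diff[OF IJ] ideal_mult[OF IJ s(3)] ideal_mult[OF IJ t(3)]) auto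
    finally have d_J: "i [^] m \<otimes> d \<in> J" .
    have sat_pr: "primeideal (sat P (Idl (V - {i}))) R" "i \<notin> sat P (Idl (V - {i}))"
      using regular_parameters_subset[OF reg, of "V - {i}"] less(2) i(1) by auto
    have "d \<in> sat P (?pw n (V - {i}))"
    proof (rule less(1)[OF sum_del])
      show "V - {i} \<subseteq> U" using less(2) by auto
      show "n v \<ge> 1" if "v \<in> V - {i}" for v using that less(3) by auto
      show "i [^] m \<notin> sat P (Idl (V - {i}))" using prime_pow[OF sat_pr(1) ic] sat_pr(2) by blast
      show "i [^] m \<otimes> d \<in> sat P (?pw n (V - {i}))"
        using d_J sat_superset[OF P(1) ideal_subset[OF IJ]] unfolding J_def[symmetric] by (rule rev_subsetD)
    qed (use im dc in auto)
    then have dJ: "d \<in> sat P J" unfolding J_def .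
    have IA1: "ideal (sat P (adjoin J i)) R" using IA[of 1] ic sat_ideal[OF P(1)] by simp
    have "t \<otimes> (y \<otimes> w) = d \<oplus> (s \<otimes> c) \<otimes> i"
      unfolding d_def using s t ic less(4) by (simp add: a_minus_def a_assoc l_neg m_assoc)
    moreover have "d \<in> sat P (adjoin J i)"
      using dJ sat_mono[OF adjoin_superset[OF IJ ic]] by blast
    moreover have "i \<in> sat P (adjoin J i)"
      using adjoin_self[OF IJ ic] sat_superset[OF P(1) ideal_subset[OF adjoin_ideal[OF IJ ic]]]
      by (rule rev_subsetD)
    ultimately have "t \<otimes> (y \<otimes> w) \<in> sat P (adjoin J i)"
      using s t by (simp add: ideal_add[OF IA1] ideal_mult[OF IA1])
    then have yw: "y \<otimes> w \<in> sat P (adjoin J i)"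
      using sat_cancel[OF P(1), of t "y \<otimes> w"] s t less(4) by simp
    have pw1: "?pw (n(i := 1)) V = adjoin J i" using pw[of 1] ic by simp
    have "w \<in> sat P (?pw (n(i := 1)) V)"
    proof (rule less(1)[OF sum_upd[of 1] less(2)])
      show "1 < n i" using m by simp
      show "(n(i := 1)) v \<ge> 1" if "v \<in> V" for v using that less(3) by auto
      show "y \<otimes> w \<in> sat P (?pw (n(i := 1)) V)" unfolding pw1 by (rule yw)
    qed (use less(4,5) s in auto)
    then have "w \<in> sat P (adjoin J i)" unfolding pw1 .
    then obtain u o3 b where u: "u \<in> carrier R" "u \<notin> P" "o3 \<in> J" "b \<in> carrier R"
      "u \<otimes> w = o3 \<oplus> b \<otimes> i" by (rule adjoin_satE)
    have o3c: "o3 \<in> carrier R" using u(3) ideal_carrier[OF IJ] by auto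
    have "(u \<otimes> s) \<otimes> z = u \<otimes> (s \<otimes> z)" using s u less(6) by (simp add: m_assoc)
    also have "\<dots> = u \<otimes> o1 \<oplus> (u \<otimes> w) \<otimes> i [^] m"
      unfolding s(5) using s(1,4) u(1) oc im by (simp add: r_distr m_assoc)
    also have "\<dots> = (u \<otimes> o1 \<oplus> i [^] m \<otimes> o3) \<oplus> b \<otimes> i [^] Suc m"
      unfolding u(5) using s(1,4) u(1,4) oc o3c im ic by (simp add: l_distr r_distr m_ac a_ac)
    also have "\<dots> \<in> adjoin J (i [^] Suc m)"
      using u im by (intro adjoinI ideal_add[OF IJ] ideal_mult[OF IJ s(3)] ideal_mult[OF IJ u(3)]) auto
    finally show ?thesis
      unfolding pwn using prime_mult[OF P(1), of u s] u s less(6) by (intro satI[of _ "u \<otimes> s"]) auto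
  qed
qed

end

section \<open>From regular local rings to regular systems of parameters\<close>

context noetherian_cring
begin

text \<open>Numerators of generators of the maximal ideal of \<open>R\<^sub>P\<close> form a system of parameters, and a
  longest chain of primes of \<open>R\<^sub>P\<close> contracts to a chain of primes of \<open>R\<close>.\<close>

lemma regular_local_imp_parameters:
  assumes P: "primeideal P R" and reg: "regular_local_ring (localization R (carrier R - P))"
  shows "\<exists>U. regular_parameters P U"
proof -
  define M where "M = carrier R - P"
  define T where "T = localization R M"
  have IP: "ideal P R" using P by (rule prime_ideal)
  have "submonoid M R"
    unfolding M_def using prime_mult[OF P] prime_one[OF P] by (intro submonoid.intro) auto
  then interpret L: loc_setup R M
    by (intro loc_setup.intro cring_axioms)
  have "cring T" unfolding T_def by (rule L.cring_localization)
  moreover have "noetherian_ring T"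
    using reg unfolding regular_local_ring_def T_def M_def by blast
  ultimately interpret T: noetherian_cring T
    by (intro noetherian_cring.intro)
  let ?f = "loc_frac R M"
  have mult: "?f a s \<otimes>\<^bsub>T\<^esub> ?f b t = ?f (a \<otimes> b) (s \<otimes> t)"
    and add: "?f a s \<oplus>\<^bsub>T\<^esub> ?f b t = ?f ((a \<otimes> t) \<oplus> (b \<otimes> s)) (s \<otimes> t)"
    and eq_iff: "?f a s = ?f b t \<longleftrightarrow> (\<exists>u\<in>M. u \<otimes> (a \<otimes> t) = u \<otimes> (b \<otimes> s))"
    if "a \<in> carrier R" "b \<in> carrier R" "s \<in> M" "t \<in> M" for a b s t
    unfolding T_def using L.loc_mult_frac L.loc_add_frac L.loc_frac_eq_iff that by auto
  have carr: "?f a s \<in> carrier T" if "a \<in> carrier R" "s \<in> M" for a s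
    unfolding T_def using that by (rule L.loc_frac_in_carrier)
  have one: "\<one>\<^bsub>T\<^esub> = ?f \<one> \<one>" and zero: "\<zero>\<^bsub>T\<^esub> = ?f \<zero> \<one>"
    unfolding T_def by (rule L.loc_one L.loc_zero)+
  have carrE: "\<exists>a s. x = ?f a s \<and> a \<in> carrier R \<and> s \<in> M" if "x \<in> carrier T" for x
    using that unfolding T_def L.loc_carrier by auto
  have Mc: "s \<in> carrier R" if "s \<in> M" for s using that M_def by auto
  have M1: "\<one> \<in> M" using prime_one[OF P] M_def by auto
  have unit: "?f s a \<otimes>\<^bsub>T\<^esub> ?f a s = \<one>\<^bsub>T\<^esub>" if "a \<in> M" "s \<in> M" for a s
  proof -
    have c: "a \<in> carrier R" "s \<in> carrier R" using that Mc by simp_all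
    have as: "a \<otimes> s \<in> M" using that prime_mult[OF P] unfolding M_def by blast
    have "?f s a \<otimes>\<^bsub>T\<^esub> ?f a s = ?f (s \<otimes> a) (a \<otimes> s)" using that c by (intro mult)
    also have "\<dots> = ?f \<one> \<one>"
    proof -
      have "\<one> \<otimes> ((s \<otimes> a) \<otimes> \<one>) = \<one> \<otimes> (\<one> \<otimes> (a \<otimes> s))"
        using c by (simp add: m_comm)
      then show ?thesis
        using eq_iff[of "s \<otimes> a" \<one> "a \<otimes> s" \<one>] as c M1 by blast
    qed
    finally show ?thesis using one by simp
  qed
  have frac_mem: "?f a s \<in> \<aa> \<longleftrightarrow> ?f a \<one> \<in> \<aa>"
    if "ideal \<aa> T" "a \<in> carrier R" "s \<in> M" for \<aa> a s
  proof
    have sc: "s \<in> carrier R" using Mc[OF that(3)] .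
    have "\<one> \<otimes> (a \<otimes> s) = \<one> \<otimes> ((s \<otimes> a) \<otimes> \<one>)"
      using that(2) sc by (simp add: m_comm)
    then have "?f a \<one> = ?f (s \<otimes> a) s"
      using eq_iff[of a "s \<otimes> a" \<one> s] that(2,3) sc M1 by blast
    also have "\<dots> = ?f s \<one> \<otimes>\<^bsub>T\<^esub> ?f a s" using that(2,3) Mc M1 by (subst mult) auto
    finally have *: "?f a \<one> = ?f s \<one> \<otimes>\<^bsub>T\<^esub> ?f a s" .
    assume "?f a s \<in> \<aa>"
    then show "?f a \<one> \<in> \<aa>"
      unfolding * by (rule T.ideal_mult[OF that(1)]) (use that carr Mc M1 in auto)
  next
    have *: "?f a s = ?f \<one> s \<otimes>\<^bsub>T\<^esub> ?f a \<one>"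
      using that(2,3) Mc M1 by (subst mult) auto
    assume "?f a \<one> \<in> \<aa>"
    then show "?f a s \<in> \<aa>"
      unfolding * by (rule T.ideal_mult[OF that(1)]) (use that carr Mc M1 in auto)
  qed
  define contr where "contr \<aa> = {a \<in> carrier R. ?f a \<one> \<in> \<aa>}" for \<aa>
  have contr_prime: "primeideal (contr \<aa>) R" "contr \<aa> \<subseteq> P" if \<aa>: "primeideal \<aa> T" for \<aa>
  proof -
    have I: "ideal \<aa> T" using \<aa> by (rule T.prime_ideal)
    have I': "ideal (contr \<aa>) R"
    proof (rule idealI_mult)
      show "contr \<aa> \<subseteq> carrier R" by (auto simp: contr_def)
      show "\<zero> \<in> contr \<aa>" using T.ideal_zero[OF I] zero by (simp add: contr_def)
      fix x y assume xy: "x \<in> contr \<aa>" "y \<in> contr \<aa>"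
      then have "?f (x \<oplus> y) \<one> = ?f x \<one> \<oplus>\<^bsub>T\<^esub> ?f y \<one>"
        using M1 by (subst add) (auto simp: contr_def)
      then show "x \<oplus> y \<in> contr \<aa>" using xy T.ideal_add[OF I] by (simp add: contr_def)
    next
      fix a x assume ax: "a \<in> carrier R" "x \<in> contr \<aa>"
      then have "?f (a \<otimes> x) \<one> = ?f a \<one> \<otimes>\<^bsub>T\<^esub> ?f x \<one>"
        using M1 by (subst mult) (auto simp: contr_def)
      then show "a \<otimes> x \<in> contr \<aa>" using ax T.ideal_mult[OF I] carr M1 by (simp add: contr_def)
    qed
    show "primeideal (contr \<aa>) R"
    proof (rule primeidealI[OF I' cring_axioms])
      show "carrier R \<noteq> contr \<aa>"
        using T.prime_one[OF \<aa>] one one_closed unfolding contr_def by auto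
      fix a b assume ab: "a \<in> carrier R" "b \<in> carrier R" "a \<otimes> b \<in> contr \<aa>"
      then have "?f a \<one> \<otimes>\<^bsub>T\<^esub> ?f b \<one> \<in> \<aa>"
        using M1 by (subst mult) (auto simp: contr_def)
      then show "a \<in> contr \<aa> \<or> b \<in> contr \<aa>"
        using primeideal.I_prime[OF \<aa> carr carr] ab M1 by (auto simp: contr_def)
    qed
    show "contr \<aa> \<subseteq> P"
    proof
      fix a assume a: "a \<in> contr \<aa>"
      show "a \<in> P"
      proof (rule ccontr)
        assume "a \<notin> P"
        then have "a \<in> M" using a by (auto simp: contr_def M_def)
        then have "\<one>\<^bsub>T\<^esub> \<in> \<aa>"
          using unit[of a \<one>] a M1 T.ideal_mult[OF I, of "?f a \<one>" "?f \<one> a"] carr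
          by (auto simp: contr_def)
        then show False using T.prime_one[OF \<aa>] by simp
      qed
    qed
  qed
  have contr_strict: "contr \<aa> \<subset> contr \<bb>" if h: "ideal \<aa> T" "ideal \<bb> T" "\<aa> \<subset> \<bb>" for \<aa> \<bb>
  proof -
    obtain x where x: "x \<in> \<bb>" "x \<notin> \<aa>" using h(3) by auto
    then obtain a s where as: "x = ?f a s" "a \<in> carrier R" "s \<in> M"
      using carrE[OF T.ideal_carrier[OF h(2) x(1)]] by blast
    then have "a \<in> contr \<bb>" "a \<notin> contr \<aa>"
      using x frac_mem[OF h(1) as(2,3)] frac_mem[OF h(2) as(2,3)] unfolding contr_def by simp_all
    moreover have "contr \<aa> \<subseteq> contr \<bb>" using h(3) by (auto simp: contr_def)
    ultimately show ?thesis by auto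
  qed
  obtain m U where m: "{n. maximalideal n T} = {m}"
    and U: "U \<subseteq> carrier T" "finite U" "m = Idl\<^bsub>T\<^esub> U" "enat (card U) = krull_dim T"
    using reg unfolding regular_local_ring_def T_def M_def by blast
  define X where "X = {enat n |n. \<exists>C :: nat \<Rightarrow> ('a \<times> 'a) set set.
     (\<forall>i\<le>n. primeideal (C i) T) \<and> (\<forall>i<n. C i \<subset> C (Suc i))}"
  have X: "Sup X = enat (card U)" using U(4) by (simp add: krull_dim_def X_def)
  have "\<exists>B. prime_chain (card U) B P"
  proof (cases "card U")
    case 0
    then show ?thesis using prime_chain.base[OF P] by auto
  next
    case (Suc k)
    \<comment> \<open>a finite supremum of chain lengths is attained\<close>
    then have "enat k < Sup X" using X by simp
    then obtain x where x: "x \<in> X" "enat k < x" unfolding less_Sup_iff by blast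
    moreover have "x \<le> enat (card U)" using X Sup_upper[OF x(1)] by simp
    ultimately have "x = enat (Suc k)" using Suc by (cases x) auto
    then obtain C where C: "\<And>i. i \<le> Suc k \<Longrightarrow> primeideal (C i) T"
      "\<And>i. i < Suc k \<Longrightarrow> C i \<subset> C (Suc i)"
      using x(1) unfolding X_def by auto
    have strict: "contr (C i) \<subset> contr (C (Suc i))" if "i < Suc k" for i
      using that C by (intro contr_strict T.prime_ideal) auto
    have "prime_chain i (contr (C 0)) (contr (C i))" if "i \<le> k" for i
      using that
    proof (induct i)
      case 0
      then show ?case using contr_prime(1)[OF C(1)] by (intro prime_chain.base) auto
    next
      case (Suc i)
      show ?case
        by (rule prime_chain.step[OF Suc(1)]) (use Suc(2) contr_prime(1)[OF C(1)] strict in auto)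
    qed
    then have "prime_chain (Suc k) (contr (C 0)) P"
      using strict[of k] contr_prime(2)[OF C(1), of "Suc k"] P by (intro prime_chain.step) auto
    then show ?thesis using Suc by auto
  qed
  then obtain B where B: "prime_chain (card U) B P" by blast
  have "\<forall>x\<in>U. \<exists>a s. x = ?f a s \<and> a \<in> carrier R \<and> s \<in> M" using U(1) carrE by blast
  then obtain num den where nd: "\<And>x. x \<in> U \<Longrightarrow> x = ?f (num x) (den x)"
    "\<And>x. x \<in> U \<Longrightarrow> num x \<in> carrier R" "\<And>x. x \<in> U \<Longrightarrow> den x \<in> M"
    by metis
  define V where "V = num ` U"
  have V: "finite V" "card V \<le> card U" "V \<subseteq> carrier R"
    unfolding V_def using U(2) nd(2) by (auto intro: card_image_le)
  have max: "maximalideal m T" using m by auto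
  have Im: "ideal m T" using max by (rule maximalideal.axioms(1))
  have m1: "\<one>\<^bsub>T\<^esub> \<notin> m"
    using ideal.one_imp_carrier[OF Im] maximalideal.I_notcarr[OF max] by auto
  have VP: "V \<subseteq> P"
  proof
    fix a assume "a \<in> V"
    then obtain x where x: "x \<in> U" "a = num x" by (auto simp: V_def)
    show "a \<in> P"
    proof (rule ccontr)
      assume "a \<notin> P"
      then have aM: "a \<in> M" using nd(2) x by (auto simp: M_def)
      have "x \<in> m" using x(1) T.genideal_self[OF U(1)] U(3) by auto
      then have "?f (den x) a \<otimes>\<^bsub>T\<^esub> x \<in> m"
        using T.ideal_mult[OF Im] carr nd(3)[OF x(1)] aM Mc by auto
      moreover have "?f (den x) a \<otimes>\<^bsub>T\<^esub> x = \<one>\<^bsub>T\<^esub>"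
        using unit[OF aM nd(3)[OF x(1)]] nd(1)[OF x(1)] x(2) by simp
      ultimately show False using m1 by simp
    qed
  qed
  have IV: "ideal (Idl V) R" using V(3) by (rule genideal_ideal)
  have IS: "ideal (sat P (Idl V)) R" using P IV by (rule sat_ideal)
  define W where "W = {?f a s |a s. a \<in> sat P (Idl V) \<and> s \<in> M}"
  have sc: "a \<in> carrier R" if "a \<in> sat P (Idl V)" for a using that ideal_carrier[OF IS] by simp
  have MM: "s \<otimes> t \<in> M" if "s \<in> M" "t \<in> M" for s t
    using that prime_mult[OF P] unfolding M_def by blast
  have IW: "ideal W T"
  proof (rule T.idealI_mult)
    show "W \<subseteq> carrier T" unfolding W_def using carr sc by auto
    show "\<zero>\<^bsub>T\<^esub> \<in> W" unfolding W_def zero using ideal_zero[OF IS] M1 by blast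
    fix x y assume "x \<in> W" "y \<in> W"
    then obtain a s b t where *: "x = ?f a s" "a \<in> sat P (Idl V)" "s \<in> M"
      "y = ?f b t" "b \<in> sat P (Idl V)" "t \<in> M" unfolding W_def by blast
    have "a \<otimes> t \<oplus> b \<otimes> s \<in> sat P (Idl V)"
      using * Mc by (intro ideal_add[OF IS] ideal_mult'[OF IS]) auto
    moreover have "x \<oplus>\<^bsub>T\<^esub> y = ?f (a \<otimes> t \<oplus> b \<otimes> s) (s \<otimes> t)"
      unfolding *(1,4) by (rule add[OF sc[OF *(2)] sc[OF *(5)] *(3,6)])
    ultimately show "x \<oplus>\<^bsub>T\<^esub> y \<in> W" unfolding W_def using * MM by blast
  next
    fix x y assume y: "y \<in> carrier T" and "x \<in> W"
    then obtain a s where *: "x = ?f a s" "a \<in> sat P (Idl V)" "s \<in> M" unfolding W_def by blast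
    obtain b t where b: "y = ?f b t" "b \<in> carrier R" "t \<in> M" using carrE[OF y] by blast
    have "b \<otimes> a \<in> sat P (Idl V)" using * b by (intro ideal_mult[OF IS])
    moreover have "y \<otimes>\<^bsub>T\<^esub> x = ?f (b \<otimes> a) (t \<otimes> s)"
      unfolding *(1) b(1) by (rule mult[OF b(2) sc[OF *(2)] b(3) *(3)])
    ultimately show "y \<otimes>\<^bsub>T\<^esub> x \<in> W" unfolding W_def using * b MM by blast
  qed
  have "U \<subseteq> W"
  proof
    fix x assume x: "x \<in> U"
    then have "num x \<in> sat P (Idl V)"
      using genideal_self[OF V(3)] sat_superset[OF P ideal_subset[OF IV]] by (auto simp: V_def)
    then show "x \<in> W" unfolding W_def using nd(1,3)[OF x] by blast
  qed
  then have mW: "m \<subseteq> W" unfolding U(3) by (rule T.genideal_minimal[OF IW])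
  have "P \<subseteq> sat P (Idl V)"
  proof
    fix y assume y: "y \<in> P"
    then have yc: "y \<in> carrier R" using ideal_carrier[OF IP] by simp
    let ?K = "PIdl\<^bsub>T\<^esub> (?f y \<one>)"
    have yT: "?f y \<one> \<in> carrier T" using carr yc M1 by auto
    \<comment> \<open>\<open>y / 1\<close> is not a unit, so it lies in the only maximal ideal\<close>
    have "?K \<noteq> carrier T"
    proof
      assume "?K = carrier T"
      then have "\<one>\<^bsub>T\<^esub> \<in> ?K" by simp
      then obtain x where x: "x \<in> carrier T" "\<one>\<^bsub>T\<^esub> = x \<otimes>\<^bsub>T\<^esub> ?f y \<one>"
        unfolding cgenideal_def by blast
      obtain a s where as: "x = ?f a s" "a \<in> carrier R" "s \<in> M" using carrE[OF x(1)] by blast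
      have "?f (a \<otimes> y) (s \<otimes> \<one>) = ?f \<one> \<one>"
        using x(2) one as yc M1 by (simp add: mult)
      moreover have "s \<otimes> \<one> \<in> M" "a \<otimes> y \<in> carrier R"
        using MM[OF as(3) M1] as(2) yc by auto
      ultimately obtain u where u: "u \<in> M" "u \<otimes> (a \<otimes> y \<otimes> \<one>) = u \<otimes> (\<one> \<otimes> (s \<otimes> \<one>))"
        using eq_iff[of "a \<otimes> y" \<one> "s \<otimes> \<one>" \<one>] M1 by blast
      have "u \<otimes> (a \<otimes> y \<otimes> \<one>) \<in> P"
        using ideal_mult[OF IP ideal_mult[OF IP y as(2)] Mc[OF u(1)]] as yc by simp
      moreover have "u \<otimes> (\<one> \<otimes> (s \<otimes> \<one>)) \<in> M" using u as MM Mc by simp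
      ultimately show False unfolding u(2) M_def by blast
    qed
    then obtain n where n: "maximalideal n T" "?K \<subseteq> n"
      using T.exists_maximalideal_over[OF T.cgenideal_ideal[OF yT]] by blast
    then have "n = m" using m by auto
    then have "?f y \<one> \<in> W" using n(2) mW T.cgenideal_self[OF yT] by auto
    then obtain a s where as: "?f y \<one> = ?f a s" "a \<in> sat P (Idl V)" "s \<in> M"
      unfolding W_def by blast
    then obtain u where u: "u \<in> M" "u \<otimes> (y \<otimes> s) = u \<otimes> (a \<otimes> \<one>)"
      using eq_iff[of y a \<one> s] sc[OF as(2)] yc M1 by blast
    have "(u \<otimes> s) \<otimes> y = u \<otimes> (a \<otimes> \<one>)"
      using u as yc Mc by (simp add: m_ac)
    also have "\<dots> \<in> sat P (Idl V)"
      using ideal_mult[OF IS as(2) Mc[OF u(1)]] sc[OF as(2)] by simp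
    finally show "y \<in> sat P (Idl V)"
      using sat_cancel[OF P, of "u \<otimes> s" y] MM[OF u(1) as(3)] yc unfolding M_def by blast
  qed
  moreover have "card V = card U"
  proof (rule antisym)
    have "Idl ({\<zero>} \<union> V) = Idl V"
    proof
      have z: "{\<zero>} \<union> V \<subseteq> carrier R" using V(3) by auto
      show "Idl ({\<zero>} \<union> V) \<subseteq> Idl V"
        using ideal_zero[OF IV] genideal_self[OF V(3)] by (intro genideal_minimal[OF IV]) auto
      show "Idl V \<subseteq> Idl ({\<zero>} \<union> V)" using z by (rule subset_Idl_subset) auto
    qed
    then have "P \<subseteq> sat P (Idl ({\<zero>} \<union> V))" using \<open>P \<subseteq> sat P (Idl V)\<close> by simp
    moreover have "{\<zero>} \<subseteq> B" using ideal_zero[OF prime_ideal[OF prime_chain_prime(2)[OF B]]] by simp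
    ultimately show "card U \<le> card V"
      by (intro prime_chain_length_le[OF V(1) zeroideal VP _ _ B])
  qed (rule V(2))
  ultimately have "regular_parameters P V"
    unfolding regular_parameters_def using P V VP B by auto
  then show ?thesis by blast
qed

end

section \<open>The Frobenius endomorphism\<close>

context cring
begin

lemma binomial_expansion:
  assumes a: "a \<in> carrier R" and b: "b \<in> carrier R"
  shows "(a \<oplus> b) [^] (n::nat) = (\<Oplus>k\<in>{..n}. add_pow R (n choose k) (a [^] k \<otimes> b [^] (n - k)))"
proof (induct n)
  case 0
  then show ?case using assms by simp
next
  case (Suc n)
  let ?F = "\<lambda>k. add_pow R (n choose k) (a [^] k \<otimes> b [^] (n - k))"
  define g where "g k = add_pow R (n choose k) (a [^] k \<otimes> b [^] (Suc n - k))" for k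
  define h where "h k = add_pow R (n choose k) (a [^] Suc k \<otimes> b [^] (n - k))" for k
  have gc: "g k \<in> carrier R" and hc: "h k \<in> carrier R" and Fc: "?F k \<in> carrier R" for k
    unfolding g_def h_def using assms by auto
  have "(a \<oplus> b) [^] Suc n = a \<otimes> (\<Oplus>k\<in>{..n}. ?F k) \<oplus> b \<otimes> (\<Oplus>k\<in>{..n}. ?F k)"
    using assms Suc by (simp add: r_distr m_comm[of _ a] m_comm[of _ b])
  also have "a \<otimes> (\<Oplus>k\<in>{..n}. ?F k) = (\<Oplus>k\<in>{..n}. h k)"
  proof -
    have "a \<otimes> (\<Oplus>k\<in>{..n}. ?F k) = (\<Oplus>k\<in>{..n}. a \<otimes> ?F k)"
      using a Fc by (intro finsum_rdistr) auto
    also have "\<dots> = (\<Oplus>k\<in>{..n}. h k)"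
      using assms hc by (intro finsum_cong') (auto simp: h_def add_pow_rdistr m_ac)
    finally show ?thesis .
  qed
  also have "b \<otimes> (\<Oplus>k\<in>{..n}. ?F k) = (\<Oplus>k\<in>{..n}. g k)"
  proof -
    have "b \<otimes> (\<Oplus>k\<in>{..n}. ?F k) = (\<Oplus>k\<in>{..n}. b \<otimes> ?F k)"
      using b Fc by (intro finsum_rdistr) auto
    also have "\<dots> = (\<Oplus>k\<in>{..n}. g k)"
      using assms gc by (intro finsum_cong') (auto simp: g_def add_pow_rdistr m_ac Suc_diff_le)
    finally show ?thesis .
  qed
  also have "(\<Oplus>k\<in>{..n}. g k) = (\<Oplus>k\<in>{..Suc n}. g k)"
  proof -
    have "g (Suc n) = \<zero>" unfolding g_def using assms by (simp add: binomial_eq_0)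
    then show ?thesis using gc by (simp add: finsum_Suc)
  qed
  also have "\<dots> = (\<Oplus>k\<in>{..n}. g (Suc k)) \<oplus> g 0"
    using gc by (intro finsum_Suc2) auto
  finally have "(a \<oplus> b) [^] Suc n = ((\<Oplus>k\<in>{..n}. h k) \<oplus> (\<Oplus>k\<in>{..n}. g (Suc k))) \<oplus> g 0"
    using gc hc by (simp add: a_assoc)
  also have "(\<Oplus>k\<in>{..n}. h k) \<oplus> (\<Oplus>k\<in>{..n}. g (Suc k)) = (\<Oplus>k\<in>{..n}. h k \<oplus> g (Suc k))"
    using gc hc by (subst finsum_addf) auto
  also have "\<dots> = (\<Oplus>k\<in>{..n}. add_pow R (Suc n choose Suc k) (a [^] Suc k \<otimes> b [^] (Suc n - Suc k)))"
  proof (intro finsum_cong')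
    fix k
    have "h k \<oplus> g (Suc k) = add_pow R ((n choose k) + (n choose Suc k)) (a [^] Suc k \<otimes> b [^] (n - k))"
      unfolding h_def g_def
      using add.nat_pow_mult[of "a [^] Suc k \<otimes> b [^] (n - k)" "n choose k" "n choose Suc k"] assms
      by simp
    then show "h k \<oplus> g (Suc k) = add_pow R (Suc n choose Suc k) (a [^] Suc k \<otimes> b [^] (Suc n - Suc k))"
      by simp
  qed (use assms in auto)
  also have "\<dots> \<oplus> g 0 = (\<Oplus>k\<in>{..Suc n}. add_pow R (Suc n choose k) (a [^] k \<otimes> b [^] (Suc n - k)))"
    using assms unfolding g_def by (subst finsum_Suc2) auto
  finally show ?case .
qed

end

locale char_p_cring = noetherian_cring +
  fixes p :: nat
  assumes prime_p: "Factorial_Ring.prime p" and char_p: "add_pow R p \<one> = \<zero>"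
begin

lemma p_pos: "p > 0" and p_gt_1: "p > 1"
  using prime_p prime_gt_0_nat prime_gt_1_nat by auto

lemma char_dvd:
  assumes "p dvd m" "x \<in> carrier R"
  shows "add_pow R m x = \<zero>"
proof -
  obtain k where k: "m = p * k" using assms(1) by blast
  have "add_pow R m x = add_pow R k (add_pow R p x)"
    using assms(2) unfolding k by (simp add: add.nat_pow_pow)
  also have "add_pow R p x = (add_pow R p \<one>) \<otimes> x"
    using add_pow_ldistr[of \<one> x p] assms(2) by simp
  finally show ?thesis using assms(2) char_p by simp
qed

lemma pow_p_add:
  assumes a: "a \<in> carrier R" and b: "b \<in> carrier R"
  shows "(a \<oplus> b) [^] p = a [^] p \<oplus> b [^] p"
proof -
  obtain m where m: "p = Suc (Suc m)" using p_gt_1 by (cases p, simp, cases "p - 1") auto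
  let ?f = "\<lambda>k. add_pow R (p choose k) (a [^] k \<otimes> b [^] (p - k))"
  have c: "?f k \<in> carrier R" for k using assms by auto
  have "(a \<oplus> b) [^] p = (\<Oplus>k\<in>{..Suc (Suc m)}. ?f k)"
    using binomial_expansion[OF assms, of p] m by simp
  also have "\<dots> = ?f (Suc (Suc m)) \<oplus> (\<Oplus>k\<in>{..Suc m}. ?f k)"
    using c by (intro finsum_Suc) auto
  also have "(\<Oplus>k\<in>{..Suc m}. ?f k) = (\<Oplus>k\<in>{..m}. ?f (Suc k)) \<oplus> ?f 0"
    using c by (intro finsum_Suc2) auto
  also have "(\<Oplus>k\<in>{..m}. ?f (Suc k)) = \<zero>"
    using assms m prime_p by (intro add.finprod_one_eqI char_dvd dvd_choose_prime) auto
  finally show ?thesis using assms m by simp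
qed

lemma frob_add:
  assumes "a \<in> carrier R" "b \<in> carrier R"
  shows "(a \<oplus> b) [^] (p ^ e) = a [^] (p ^ e) \<oplus> b [^] (p ^ e)"
proof (induct e)
  case 0
  then show ?case using assms by simp
next
  case (Suc e)
  have pw: "x [^] (p ^ Suc e) = (x [^] (p ^ e)) [^] p" if "x \<in> carrier R" for x
    using that by (simp add: nat_pow_pow mult.commute)
  show ?case
    unfolding pw[OF assms(1)] pw[OF assms(2)] pw[OF a_closed[OF assms]] Suc
    by (rule pow_p_add) (use assms in auto)
qed

lemma frob_zero: "\<zero> [^] (p ^ e) = \<zero>"
  using p_pos nat_pow_zero by simp

lemma frob_minus:
  assumes "a \<in> carrier R"
  shows "(\<ominus> a) [^] (p ^ e) = \<ominus> (a [^] (p ^ e))"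
proof -
  have "a [^] (p ^ e) \<oplus> (\<ominus> a) [^] (p ^ e) = (a \<oplus> \<ominus> a) [^] (p ^ e)"
    using assms by (simp only: frob_add a_inv_closed)
  also have "\<dots> = \<zero>" using assms frob_zero by (simp add: r_neg)
  finally show ?thesis
    using assms by (intro minus_equality[symmetric]) (simp_all add: a_comm)
qed

lemma pow_p_minus: "a \<in> carrier R \<Longrightarrow> (\<ominus> a) [^] p = \<ominus> (a [^] p)"
  using frob_minus[of a 1] by simp

text \<open>Whether \<open>K\<close> contains the \<open>p\<^sup>e\<close>-th powers of all elements of an ideal can therefore be tested on
  generators.\<close>

lemma frob_vimage_ideal:
  assumes "ideal K R"
  shows "ideal {c \<in> carrier R. c [^] (p ^ e) \<in> K} R"
proof (rule idealI_mult)
  show "\<zero> \<in> {c \<in> carrier R. c [^] (p ^ e) \<in> K}" using frob_zero ideal_zero[OF assms] by simp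
  show "x \<oplus> y \<in> {c \<in> carrier R. c [^] (p ^ e) \<in> K}"
    if "x \<in> {c \<in> carrier R. c [^] (p ^ e) \<in> K}" "y \<in> {c \<in> carrier R. c [^] (p ^ e) \<in> K}" for x y
    using that ideal_add[OF assms] by (simp add: frob_add)
  show "a \<otimes> x \<in> {c \<in> carrier R. c [^] (p ^ e) \<in> K}"
    if "a \<in> carrier R" "x \<in> {c \<in> carrier R. c [^] (p ^ e) \<in> K}" for a x
    using that ideal_mult[OF assms] by (simp add: nat_pow_distrib)
qed auto

text \<open>Scalars act on \<open>F\<^sub>*R\<close> through their \<open>p\<close>-th powers.\<close>

definition lc :: "('a \<Rightarrow> 'a) \<Rightarrow> 'a set \<Rightarrow> 'a" where
  "lc c X = (\<Oplus>x\<in>X. c x [^] p \<otimes> x)"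

lemma lc_Pi: "X \<subseteq> carrier R \<Longrightarrow> c \<in> X \<rightarrow> carrier R \<Longrightarrow> (\<lambda>x. c x [^] p \<otimes> x) \<in> X \<rightarrow> carrier R"
  by (auto simp: Pi_iff subset_iff)

lemma lc_closed [simp]:
  "X \<subseteq> carrier R \<Longrightarrow> c \<in> X \<rightarrow> carrier R \<Longrightarrow> lc c X \<in> carrier R"
  unfolding lc_def by (rule finsum_closed) (rule lc_Pi)

lemma lc_insert:
  assumes "finite X" "x \<notin> X" "insert x X \<subseteq> carrier R" "c \<in> insert x X \<rightarrow> carrier R"
  shows "lc c (insert x X) = c x [^] p \<otimes> x \<oplus> lc c X"
  unfolding lc_def using assms lc_Pi[of X c] by (intro finsum_insert) auto

lemma lc_cong:
  assumes "X \<subseteq> carrier R" "d \<in> X \<rightarrow> carrier R" "\<And>x. x \<in> X \<Longrightarrow> c x = d x"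
  shows "lc c X = lc d X"
  unfolding lc_def using assms lc_Pi[of X d] by (intro finsum_cong') auto

lemma lc_add:
  assumes "X \<subseteq> carrier R" "c \<in> X \<rightarrow> carrier R" "d \<in> X \<rightarrow> carrier R"
  shows "lc (\<lambda>x. c x \<oplus> d x) X = lc c X \<oplus> lc d X"
proof -
  have "lc (\<lambda>x. c x \<oplus> d x) X = (\<Oplus>x\<in>X. c x [^] p \<otimes> x \<oplus> d x [^] p \<otimes> x)"
    unfolding lc_def using assms by (intro finsum_cong') (auto simp: pow_p_add l_distr Pi_iff subset_iff)
  also have "\<dots> = lc c X \<oplus> lc d X"
    unfolding lc_def using assms by (intro finsum_addf lc_Pi)
  finally show ?thesis .
qed

lemma lc_mult:
  assumes "finite X" "X \<subseteq> carrier R" "c \<in> X \<rightarrow> carrier R" "r \<in> carrier R"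
  shows "lc (\<lambda>x. r \<otimes> c x) X = r [^] p \<otimes> lc c X"
proof -
  have "lc (\<lambda>x. r \<otimes> c x) X = (\<Oplus>x\<in>X. r [^] p \<otimes> (c x [^] p \<otimes> x))"
    unfolding lc_def using assms
    by (intro finsum_cong') (auto simp: nat_pow_distrib m_assoc Pi_iff subset_iff)
  also have "\<dots> = r [^] p \<otimes> lc c X"
    unfolding lc_def using assms by (intro finsum_rdistr[symmetric] lc_Pi) auto
  finally show ?thesis .
qed

lemma lc_mem_ideal:
  assumes "ideal K R" "finite X" "X \<subseteq> carrier R" "c \<in> X \<rightarrow> carrier R"
    and "\<And>x. x \<in> X \<Longrightarrow> c x [^] p \<in> K"
  shows "lc c X \<in> K"
  using assms(2-5)
proof (induct X rule: finite_induct)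
  case empty
  then show ?case using ideal_zero[OF assms(1)] by (simp add: lc_def)
next
  case (insert x X)
  then show ?case
    using ideal_add[OF assms(1)] ideal_mult'[OF assms(1)] by (subst lc_insert) auto
qed

lemma lc_zero: "X \<subseteq> carrier R \<Longrightarrow> lc (\<lambda>x. \<zero>) X = \<zero>"
  unfolding lc_def using p_pos by (intro add.finprod_one_eqI) (auto simp: nat_pow_zero)

section \<open>Frobenius is flat at regular points\<close>

text \<open>\<open>X\<close> generates the localisation of \<open>F\<^sub>*R\<close> at \<open>P\<close>; inverting \<open>s\<close> or \<open>s\<^sup>p\<close> is the same.\<close>

definition generates_at :: "'a set \<Rightarrow> 'a set \<Rightarrow> bool" where
  "generates_at P X \<longleftrightarrow> finite X \<and> X \<subseteq> carrier R
     \<and> (\<forall>y\<in>carrier R. \<exists>s\<in>carrier R - P. \<exists>c\<in>X \<rightarrow> carrier R. s [^] p \<otimes> y = lc c X)"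

lemma drop_unit_coefficient:
  assumes P: "primeideal P R" and gen: "generates_at P X"
    and x: "x \<in> X" "g \<in> X \<rightarrow> carrier R" "lc g X = \<zero>" "g x \<notin> P"
  shows "generates_at P (X - {x})"
proof -
  have X: "finite X" "X \<subseteq> carrier R" using gen by (auto simp: generates_at_def)
  have xc: "x \<in> carrier R" "g x \<in> carrier R" using x X by auto
  have Xx: "X = insert x (X - {x})" "finite (X - {x})" "X - {x} \<subseteq> carrier R" using x X by auto
  have split: "lc c X = c x [^] p \<otimes> x \<oplus> lc c (X - {x})" if "c \<in> X \<rightarrow> carrier R" for c
    using lc_insert[of "X - {x}" x c] Xx(2,3) X that by (simp add: insert_absorb[OF x(1)])
  have gX: "g \<in> X - {x} \<rightarrow> carrier R" using x by auto
  have gx: "g x [^] p \<otimes> x = \<ominus> lc g (X - {x})"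
    using split[OF x(2)] x(3) xc gX Xx by (simp add: minus_equality)
  have "\<exists>s\<in>carrier R - P. \<exists>c\<in>X - {x} \<rightarrow> carrier R. s [^] p \<otimes> y = lc c (X - {x})"
    if y: "y \<in> carrier R" for y
  proof -
    obtain s c where s: "s \<in> carrier R - P" "c \<in> X \<rightarrow> carrier R" "s [^] p \<otimes> y = lc c X"
      using gen y unfolding generates_at_def by blast
    have cc: "c \<in> X - {x} \<rightarrow> carrier R" "c x \<in> carrier R" "s \<in> carrier R" using s x by auto
    have mc: "\<ominus> c x \<in> carrier R" using cc by simp
    have "(g x \<otimes> s) [^] p \<otimes> y = g x [^] p \<otimes> (s [^] p \<otimes> y)"
      using xc cc y by (simp add: nat_pow_distrib m_assoc)
    also have "\<dots> = g x [^] p \<otimes> (c x [^] p \<otimes> x) \<oplus> g x [^] p \<otimes> lc c (X - {x})"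
      unfolding s(3) split[OF s(2)] using xc cc Xx by (simp add: r_distr)
    also have "g x [^] p \<otimes> (c x [^] p \<otimes> x) = c x [^] p \<otimes> (g x [^] p \<otimes> x)"
      using xc cc by (simp add: m_ac)
    also have "\<dots> = (\<ominus> c x) [^] p \<otimes> lc g (X - {x})"
      unfolding gx using cc gX Xx by (simp add: pow_p_minus l_minus r_minus)
    also have "\<dots> = lc (\<lambda>z. \<ominus> c x \<otimes> g z) (X - {x})"
      using lc_mult[OF Xx(2,3) gX mc] by simp
    also have "g x [^] p \<otimes> lc c (X - {x}) = lc (\<lambda>z. g x \<otimes> c z) (X - {x})"
      using lc_mult[OF Xx(2,3) cc(1) xc(2)] by simp
    also have "lc (\<lambda>z. \<ominus> c x \<otimes> g z) (X - {x}) \<oplus> lc (\<lambda>z. g x \<otimes> c z) (X - {x})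
      = lc (\<lambda>z. \<ominus> c x \<otimes> g z \<oplus> g x \<otimes> c z) (X - {x})"
      using gX cc xc Xx by (intro lc_add[symmetric]) auto
    finally have "(g x \<otimes> s) [^] p \<otimes> y = lc (\<lambda>z. \<ominus> c x \<otimes> g z \<oplus> g x \<otimes> c z) (X - {x})" .
    moreover have "(\<lambda>z. \<ominus> c x \<otimes> g z \<oplus> g x \<otimes> c z) \<in> X - {x} \<rightarrow> carrier R"
      using x(2) s(2) cc xc by (auto simp: Pi_iff)
    moreover have "g x \<otimes> s \<in> carrier R - P"
      using prime_mult[OF P, of "g x" s] xc x(4) s(1) by auto
    ultimately show ?thesis by blast
  qed
  then show ?thesis unfolding generates_at_def using Xx by auto
qed

text \<open>A linear combination of \<open>X\<close> in \<open>U\<^sup>[\<^sup>p\<^sup>] \<subseteq> P \<cdot> F\<^sub>*R\<close> equals one with coefficients in \<open>P\<close>; in the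
  difference of the two, a coefficient outside \<open>P\<close> would make its generator redundant.\<close>

lemma minimal_generators_mod_prime:
  assumes P: "primeideal P R" and gen: "generates_at P X"
    and min: "\<And>x. x \<in> X \<Longrightarrow> \<not> generates_at P (X - {x})"
    and U: "U \<subseteq> P" and c: "c \<in> X \<rightarrow> carrier R"
    and mem: "lc c X \<in> sat P (Idl ((\<lambda>u. u [^] p) ` U))" and x: "x \<in> X"
  shows "c x \<in> P"
proof -
  have IP: "ideal P R" using P by (rule prime_ideal)
  have X: "finite X" "X \<subseteq> carrier R" using gen by (auto simp: generates_at_def)
  have Uc: "U \<subseteq> carrier R" using U ideal_subset[OF IP] by auto
  define N where "N = {y \<in> carrier R. \<exists>s\<in>carrier R - P. \<exists>d\<in>X \<rightarrow> P. s [^] p \<otimes> y = lc d X}"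
  have PX: "d \<in> X \<rightarrow> carrier R" if "d \<in> X \<rightarrow> P" for d using that ideal_subset[OF IP] by auto
  have N_add: "y \<oplus> z \<in> N" if yz: "y \<in> N" "z \<in> N" for y z
  proof -
    obtain s d t d' where *: "y \<in> carrier R" "s \<in> carrier R - P" "d \<in> X \<rightarrow> P" "s [^] p \<otimes> y = lc d X"
      "z \<in> carrier R" "t \<in> carrier R - P" "d' \<in> X \<rightarrow> P" "t [^] p \<otimes> z = lc d' X"
      using yz unfolding N_def by blast
    have sc: "s \<in> carrier R" "t \<in> carrier R" using * by auto
    have "(s \<otimes> t) [^] p \<otimes> (y \<oplus> z) = t [^] p \<otimes> (s [^] p \<otimes> y) \<oplus> s [^] p \<otimes> (t [^] p \<otimes> z)"
      using sc *(1,5) by (simp add: nat_pow_distrib r_distr m_ac)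
    also have "\<dots> = lc (\<lambda>x. t \<otimes> d x) X \<oplus> lc (\<lambda>x. s \<otimes> d' x) X"
      unfolding *(4,8) using lc_mult[OF X PX] *(3,7) sc by simp
    also have "\<dots> = lc (\<lambda>x. t \<otimes> d x \<oplus> s \<otimes> d' x) X"
      using PX[OF *(3)] PX[OF *(7)] sc X by (intro lc_add[symmetric]) auto
    finally have "(s \<otimes> t) [^] p \<otimes> (y \<oplus> z) = lc (\<lambda>x. t \<otimes> d x \<oplus> s \<otimes> d' x) X" .
    moreover have "(\<lambda>x. t \<otimes> d x \<oplus> s \<otimes> d' x) \<in> X \<rightarrow> P"
      using *(3,7) sc ideal_add[OF IP] ideal_mult[OF IP] by (auto simp: Pi_iff)
    ultimately show ?thesis
      unfolding N_def using prime_mult[OF P *(2,6)] *(1,5) by blast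
  qed
  have N_cancel: "y \<in> N" if h: "t \<in> carrier R - P" "y \<in> carrier R" "t [^] p \<otimes> y \<in> N" for t y
  proof -
    obtain s d where "s \<in> carrier R - P" "d \<in> X \<rightarrow> P" "s [^] p \<otimes> (t [^] p \<otimes> y) = lc d X"
      using h(3) unfolding N_def by blast
    moreover have "(s \<otimes> t) [^] p \<otimes> y = s [^] p \<otimes> (t [^] p \<otimes> y)"
      using \<open>s \<in> carrier R - P\<close> h by (simp add: nat_pow_distrib m_assoc)
    ultimately show ?thesis
      unfolding N_def using prime_mult[OF P _ h(1), of s] h(2) by auto
  qed
  \<comment> \<open>\<open>N\<close> is \<open>P \<cdot> F\<^sub>*R\<close> near \<open>P\<close>; being an ideal is evident only for its largest \<open>R\<close>-stable part\<close>
  define N' where "N' = {y \<in> carrier R. \<forall>r\<in>carrier R. r \<otimes> y \<in> N}"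
  have "ideal N' R"
  proof (rule idealI_mult)
    show "N' \<subseteq> carrier R" by (auto simp: N'_def)
    have "\<zero> \<in> N"
    proof -
      have "\<one> [^] p \<otimes> \<zero> = lc (\<lambda>x. \<zero>) X" using lc_zero[OF X(2)] by simp
      moreover have "\<one> \<in> carrier R - P" "(\<lambda>x. \<zero>) \<in> X \<rightarrow> P"
        using prime_one[OF P] ideal_zero[OF IP] by auto
      ultimately show ?thesis unfolding N_def by blast
    qed
    then show "\<zero> \<in> N'" by (simp add: N'_def)
    show "x \<oplus> y \<in> N'" if "x \<in> N'" "y \<in> N'" for x y
      using that N_add by (simp add: N'_def r_distr)
    show "a \<otimes> x \<in> N'" if "a \<in> carrier R" "x \<in> N'" for a x
      using that by (simp add: N'_def m_assoc[symmetric])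
  qed
  moreover have "(\<lambda>u. u [^] p) ` U \<subseteq> N'"
  proof (safe)
    fix u assume u: "u \<in> U"
    then have uc: "u \<in> carrier R" using Uc by auto
    have "r \<otimes> u [^] p \<in> N" if r: "r \<in> carrier R" for r
    proof -
      obtain s b where s: "s \<in> carrier R - P" "b \<in> X \<rightarrow> carrier R" "s [^] p \<otimes> r = lc b X"
        using gen r unfolding generates_at_def by blast
      have "s [^] p \<otimes> (r \<otimes> u [^] p) = u [^] p \<otimes> (s [^] p \<otimes> r)"
        using s(1) r uc by (simp add: m_ac)
      also have "\<dots> = lc (\<lambda>x. u \<otimes> b x) X" unfolding s(3) using lc_mult[OF X s(2) uc] by simp
      finally have "s [^] p \<otimes> (r \<otimes> u [^] p) = lc (\<lambda>x. u \<otimes> b x) X" .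
      moreover have "(\<lambda>x. u \<otimes> b x) \<in> X \<rightarrow> P"
        using s(2) u U ideal_mult'[OF IP] by (auto simp: Pi_iff subset_iff)
      ultimately show ?thesis unfolding N_def using s(1) r uc by blast
    qed
    then show "u [^] p \<in> N'" using uc by (simp add: N'_def)
  qed
  ultimately have "Idl ((\<lambda>u. u [^] p) ` U) \<subseteq> N'" by (rule genideal_minimal)
  then obtain s where s: "s \<in> carrier R - P" "s \<otimes> lc c X \<in> N'"
    using mem by (auto simp: sat_def)
  have lcc: "lc c X \<in> carrier R" using X c by simp
  obtain k where k: "p = Suc k" using p_pos by (cases p) auto
  have "s [^] k \<otimes> (s \<otimes> lc c X) \<in> N" using s by (auto simp: N'_def)
  then have "s [^] p \<otimes> lc c X \<in> N" using s(1) lcc unfolding k by (simp add: m_assoc)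
  then have "lc c X \<in> N" using N_cancel s(1) lcc by blast
  then obtain t d where t: "t \<in> carrier R - P" "d \<in> X \<rightarrow> P" "t [^] p \<otimes> lc c X = lc d X"
    unfolding N_def by blast
  have tc: "t \<in> carrier R" "\<ominus> \<one> \<in> carrier R" using t by auto
  have dc: "d \<in> X \<rightarrow> carrier R" using PX[OF t(2)] .
  have "lc (\<lambda>x. t \<otimes> c x \<oplus> \<ominus> \<one> \<otimes> d x) X = t [^] p \<otimes> lc c X \<oplus> (\<ominus> \<one>) [^] p \<otimes> lc d X"
    using lc_mult[OF X c tc(1)] lc_mult[OF X dc tc(2)] c dc tc X
    by (subst lc_add) auto
  also have "\<dots> = \<zero>"
    unfolding t(3) using X dc by (simp add: pow_p_minus l_minus r_neg)
  finally have rel: "lc (\<lambda>x. t \<otimes> c x \<oplus> \<ominus> \<one> \<otimes> d x) X = \<zero>" .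
  have "t \<otimes> c x \<oplus> \<ominus> \<one> \<otimes> d x \<in> P"
  proof (rule ccontr)
    assume "t \<otimes> c x \<oplus> \<ominus> \<one> \<otimes> d x \<notin> P"
    then have "generates_at P (X - {x})"
      using c dc tc by (intro drop_unit_coefficient[OF P gen x _ rel]) auto
    then show False using min[OF x] by simp
  qed
  moreover have "\<ominus> \<one> \<otimes> d x \<in> P" using t(2) x ideal_mult[OF IP _ tc(2)] by auto
  moreover have cx: "c x \<in> carrier R" "d x \<in> carrier R" using c dc x by auto
  ultimately have "t \<otimes> c x \<in> P"
    using ideal_cancel[OF IP, of "\<ominus> \<one> \<otimes> d x" "t \<otimes> c x"] tc by (simp add: a_comm)
  then show ?thesis using prime_cancel[OF P] t(1) cx(1) by blast
qed

text \<open>Relations modulo the \<open>p\<close>-th powers of some parameters \<open>V\<close> have coefficients in \<open>(V)\<close>: by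
  descending induction on \<open>V\<close>, starting with all parameters, where this is minimality. In the
  step, \<open>u\<^sup>p\<close> is cancelled modulo \<open>V\<^sup>[\<^sup>p\<^sup>]\<close>, so that the ideal \<open>N\<close> of possible coefficients
  satisfies \<open>N \<subseteq> (V) + u N\<close> near \<open>P\<close>.\<close>

lemma relation_mod_parameters:
  assumes reg: "regular_parameters P U" and gen: "generates_at P X"
    and min: "\<And>x. x \<in> X \<Longrightarrow> \<not> generates_at P (X - {x})"
  shows "V \<subseteq> U \<Longrightarrow> a \<in> X \<rightarrow> carrier R \<Longrightarrow> lc a X \<in> sat P (Idl ((\<lambda>u. u [^] p) ` V)) \<Longrightarrow> x \<in> X
    \<Longrightarrow> a x \<in> sat P (Idl V)"
proof (induct "card (U - V)" arbitrary: V a x)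
  case 0
  have U: "finite U" "U \<subseteq> P" "P \<subseteq> sat P (Idl U)" "primeideal P R"
    using reg by (auto simp: regular_parameters_def)
  then have "V = U" using 0 by auto
  then show ?case using minimal_generators_mod_prime[OF U(4) gen min U(2) 0(3) _ 0(5)] 0(4) U(3) by auto
next
  case (Suc n)
  have U: "finite U" "U \<subseteq> P" and P: "primeideal P R"
    using reg by (auto simp: regular_parameters_def)
  have IP: "ideal P R" using P by (rule prime_ideal)
  have X: "finite X" "X \<subseteq> carrier R" using gen by (auto simp: generates_at_def)
  have Uc: "U \<subseteq> carrier R" "V \<subseteq> carrier R" using U ideal_subset[OF IP] Suc(3) by auto
  have IV: "ideal (Idl V) R" using Uc(2) by (rule genideal_ideal)
  have "U - V \<noteq> {}" using Suc(2) by (metis card.empty nat.distinct(1))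
  then obtain u where u: "u \<in> U" "u \<notin> V" by auto
  have uc: "u \<in> carrier R" using u Uc by auto
  have card: "n = card (U - insert u V)"
    using Suc(2) u U(1) by (metis Diff_insert card_Diff_singleton diff_Suc_1 Diff_iff)
  let ?V = "Idl ((\<lambda>u. u [^] p) ` V)"
  have Vp: "(\<lambda>u. u [^] p) ` V \<subseteq> carrier R" using Uc by auto
  have IVp: "ideal ?V R" using Vp by (rule genideal_ideal)
  have IS: "ideal (sat P ?V) R" using P IVp by (rule sat_ideal)
  have frob_V: "k [^] p \<in> ?V" if "k \<in> Idl V" for k
  proof -
    have "Idl V \<subseteq> {c \<in> carrier R. c [^] (p ^ 1) \<in> ?V}"
      using genideal_self[OF Vp] Uc by (intro genideal_minimal frob_vimage_ideal IVp) auto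
    then show ?thesis using that by auto
  qed
  define N where "N = {b x |b. b \<in> X \<rightarrow> carrier R \<and> lc b X \<in> sat P ?V}"
  have IN: "ideal N R"
  proof (rule idealI_mult)
    show "N \<subseteq> carrier R" using Suc(6) by (auto simp: N_def)
    have "lc (\<lambda>x. \<zero>) X \<in> sat P ?V" using lc_zero[OF X(2)] ideal_zero[OF IS] by simp
    then show "\<zero> \<in> N" unfolding N_def by force
    fix y z assume "y \<in> N" "z \<in> N"
    then obtain b b' where *: "y = b x" "b \<in> X \<rightarrow> carrier R" "lc b X \<in> sat P ?V"
      "z = b' x" "b' \<in> X \<rightarrow> carrier R" "lc b' X \<in> sat P ?V" unfolding N_def by blast
    have "lc (\<lambda>x. b x \<oplus> b' x) X \<in> sat P ?V"
      unfolding lc_add[OF X(2) *(2,5)] using ideal_add[OF IS *(3,6)] .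
    moreover have "(\<lambda>x. b x \<oplus> b' x) \<in> X \<rightarrow> carrier R" using *(2,5) by auto
    ultimately show "y \<oplus> z \<in> N"
      unfolding N_def *(1,4) by (intro CollectI exI[of _ "\<lambda>x. b x \<oplus> b' x"]) simp
  next
    fix r y assume r: "r \<in> carrier R" and "y \<in> N"
    then obtain b where *: "y = b x" "b \<in> X \<rightarrow> carrier R" "lc b X \<in> sat P ?V" unfolding N_def by blast
    have "lc (\<lambda>x. r \<otimes> b x) X \<in> sat P ?V"
      unfolding lc_mult[OF X *(2) r] using r by (intro ideal_mult[OF IS *(3)]) simp
    moreover have "(\<lambda>x. r \<otimes> b x) \<in> X \<rightarrow> carrier R" using *(2) r by auto
    ultimately show "r \<otimes> y \<in> N"
      unfolding N_def *(1) by (intro CollectI exI[of _ "\<lambda>x. r \<otimes> b x"]) simp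
  qed
  have IA: "ideal (adjoin (Idl V) u) R" using IV uc by (rule adjoin_ideal)
  have ISA: "ideal (sat P (adjoin (Idl V) u)) R" using P IA by (rule sat_ideal)
  obtain s where s: "s \<in> carrier R - P" "\<forall>y\<in>sat P (adjoin (Idl V) u). s \<otimes> y \<in> adjoin (Idl V) u"
    using sat_uniform[OF P IA ISA] by auto
  have sc: "s \<in> carrier R" using s by simp
  have "N \<subseteq> sat P (Idl V <+> P \<cdot> N)"
  proof
    fix y assume "y \<in> N"
    then obtain b where b: "y = b x" "b \<in> X \<rightarrow> carrier R" "lc b X \<in> sat P ?V" unfolding N_def by blast
    have "?V \<subseteq> Idl ((\<lambda>u. u [^] p) ` insert u V)"
      using Uc uc by (intro subset_Idl_subset) auto
    then have "lc b X \<in> sat P (Idl ((\<lambda>u. u [^] p) ` insert u V))" using b(3) sat_mono by blast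
    then have "b z \<in> sat P (Idl (insert u V))" if "z \<in> X" for z
      using Suc(1)[OF card _ b(2) _ that] u(1) Suc(3) by blast
    then have "b z \<in> sat P (adjoin (Idl V) u)" if "z \<in> X" for z
      using that Idl_insert[OF uc Uc(2)] by simp
    then have "s \<otimes> b z \<in> adjoin (Idl V) u" if "z \<in> X" for z using s(2) that by blast
    then have "\<forall>z\<in>X. \<exists>k d. k \<in> Idl V \<and> d \<in> carrier R \<and> s \<otimes> b z = k \<oplus> d \<otimes> u"
      unfolding adjoin_def by blast
    then obtain k d where kd: "\<And>z. z \<in> X \<Longrightarrow> k z \<in> Idl V" "\<And>z. z \<in> X \<Longrightarrow> d z \<in> carrier R"
      "\<And>z. z \<in> X \<Longrightarrow> s \<otimes> b z = k z \<oplus> d z \<otimes> u" by metis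
    have kc: "k \<in> X \<rightarrow> carrier R" and dc: "d \<in> X \<rightarrow> carrier R"
      using kd(1,2) ideal_carrier[OF IV] by auto
    have k_mem: "lc k X \<in> sat P ?V"
      using lc_mem_ideal[OF IVp X kc] frob_V kd(1) sat_superset[OF P ideal_subset[OF IVp]] by blast
    have udc: "(\<lambda>z. u \<otimes> d z) \<in> X \<rightarrow> carrier R" using dc uc by auto
    have "s [^] p \<otimes> lc b X = lc (\<lambda>z. s \<otimes> b z) X" using lc_mult[OF X b(2) sc] by simp
    also have "\<dots> = lc (\<lambda>z. k z \<oplus> u \<otimes> d z) X"
      using kd kc udc X(2) uc by (intro lc_cong) (auto simp: m_comm)
    also have "\<dots> = lc k X \<oplus> u [^] p \<otimes> lc d X"
      using lc_add[OF X(2) kc udc] lc_mult[OF X dc uc] by simp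
    finally have eq: "s [^] p \<otimes> lc b X = lc k X \<oplus> u [^] p \<otimes> lc d X" .
    have "lc k X \<oplus> u [^] p \<otimes> lc d X \<in> sat P ?V"
      unfolding eq[symmetric] using sc by (intro ideal_mult[OF IS b(3)]) simp
    then have ud: "u [^] p \<otimes> lc d X \<in> sat P ?V"
      using ideal_cancel[OF IS k_mem, of "u [^] p \<otimes> lc d X"] X dc uc by simp
    have "u \<notin> sat P (Idl V)" and pr: "primeideal (sat P (Idl V)) R"
      using regular_parameters_subset[OF reg Suc(3)] u by auto
    then have "u [^] p \<notin> sat P (Idl V)" using prime_pow[OF pr uc] by blast
    then have "lc d X \<in> sat P ?V"
      using parameter_powers_primary[OF reg Suc(3), of "\<lambda>_. p" "u [^] p" "lc d X"] ud uc X dc p_pos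
      by simp
    then have "d x \<in> N" unfolding N_def using dc by blast
    then have "u \<otimes> d x \<in> P \<cdot> N" using u(1) U(2) by (intro ideal_prod.prod) auto
    then have "d x \<otimes> u \<in> P \<cdot> N" using m_comm[OF _ uc, of "d x"] kd(2)[OF Suc(6)] by simp
    then have "s \<otimes> y \<in> Idl V <+> P \<cdot> N"
      unfolding mem_set_add b(1) using kd(1,3)[OF Suc(6)] by blast
    moreover have "y \<in> carrier R" using b Suc(6) by auto
    ultimately show "y \<in> sat P (Idl V <+> P \<cdot> N)" using s(1) by (intro satI[of _ s])
  qed
  then have "N \<subseteq> sat P (Idl V)" by (intro nakayama[OF P IV IP _ IN]) auto
  moreover have "a x \<in> N" unfolding N_def using Suc(4,5) by blast
  ultimately show ?case by blast
qed

end

section \<open>Cartier maps on a regular ring\<close>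

context char_p_cring
begin

abbreviation C_maps :: "nat \<Rightarrow> ('a \<Rightarrow> 'a) set" where "C_maps e \<equiv> cartier_maps p e R"
abbreviation C_ideal :: "nat \<Rightarrow> 'a set \<Rightarrow> 'a set" where "C_ideal e J \<equiv> cartier_ideal p e R J"

lemma cartier_closed: "\<phi> \<in> C_maps e \<Longrightarrow> x \<in> carrier R \<Longrightarrow> \<phi> x \<in> carrier R"
  and cartier_plus: "\<phi> \<in> C_maps e \<Longrightarrow> x \<in> carrier R \<Longrightarrow> y \<in> carrier R \<Longrightarrow> \<phi> (x \<oplus> y) = \<phi> x \<oplus> \<phi> y"
  and cartier_frob: "\<phi> \<in> C_maps e \<Longrightarrow> r \<in> carrier R \<Longrightarrow> x \<in> carrier R \<Longrightarrow>
    \<phi> (r [^] (p ^ e) \<otimes> x) = r \<otimes> \<phi> x"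
  by (auto simp: cartier_maps_def)

lemma cartier_mapsI:
  assumes "\<And>x. x \<in> carrier R \<Longrightarrow> \<phi> x \<in> carrier R"
    and "\<And>x y. x \<in> carrier R \<Longrightarrow> y \<in> carrier R \<Longrightarrow> \<phi> (x \<oplus> y) = \<phi> x \<oplus> \<phi> y"
    and "\<And>r x. r \<in> carrier R \<Longrightarrow> x \<in> carrier R \<Longrightarrow> \<phi> (r [^] (p ^ e) \<otimes> x) = r \<otimes> \<phi> x"
  shows "\<phi> \<in> C_maps e"
  using assms by (auto simp: cartier_maps_def)

lemma cartier_map_zero: "\<phi> \<in> C_maps e \<Longrightarrow> \<phi> \<zero> = \<zero>"
  using cartier_frob[of \<phi> e \<zero> \<zero>] cartier_closed[of \<phi> e \<zero>] by simp

lemma cartier_premult: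
  assumes "\<phi> \<in> C_maps e" "a \<in> carrier R"
  shows "(\<lambda>x. \<phi> (a \<otimes> x)) \<in> C_maps e"
proof (rule cartier_mapsI)
  fix r x assume rx: "r \<in> carrier R" "x \<in> carrier R"
  have "a \<otimes> (r [^] (p ^ e) \<otimes> x) = r [^] (p ^ e) \<otimes> (a \<otimes> x)"
    using assms rx by (simp add: m_ac)
  then show "\<phi> (a \<otimes> (r [^] (p ^ e) \<otimes> x)) = r \<otimes> \<phi> (a \<otimes> x)"
    using assms rx cartier_frob[OF assms(1)] by simp
qed (use assms cartier_closed[OF assms(1)] cartier_plus[OF assms(1)] in \<open>auto simp: r_distr\<close>)

lemma cartier_comp:
  assumes \<phi>: "\<phi> \<in> C_maps a" and \<psi>: "\<psi> \<in> C_maps b"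
  shows "(\<lambda>x. \<phi> (\<psi> x)) \<in> C_maps (a + b)"
proof (rule cartier_mapsI)
  fix r x assume rx: "r \<in> carrier R" "x \<in> carrier R"
  have "r [^] (p ^ (a + b)) = (r [^] (p ^ a)) [^] (p ^ b)"
    using rx by (simp add: nat_pow_pow power_add)
  then show "\<phi> (\<psi> (r [^] (p ^ (a + b)) \<otimes> x)) = r \<otimes> \<phi> (\<psi> x)"
    using rx cartier_frob[OF \<psi>] cartier_frob[OF \<phi>] cartier_closed[OF \<psi>] by simp
qed (use cartier_closed[OF \<phi>] cartier_closed[OF \<psi>] cartier_plus[OF \<phi>] cartier_plus[OF \<psi>] in auto)

lemma C_gens_carrier: "J \<subseteq> carrier R \<Longrightarrow> {\<phi> g |\<phi> g. \<phi> \<in> C_maps e \<and> g \<in> J} \<subseteq> carrier R"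
  using cartier_closed by blast

lemma C_ideal_ideal: "J \<subseteq> carrier R \<Longrightarrow> ideal (C_ideal e J) R"
  unfolding cartier_ideal_def by (rule genideal_ideal[OF C_gens_carrier])

lemma C_ideal_gen:
  assumes "J \<subseteq> carrier R" "\<phi> \<in> C_maps e" "g \<in> J"
  shows "\<phi> g \<in> C_ideal e J"
  using genideal_self[OF C_gens_carrier[OF assms(1), of e]] assms(2,3)
  unfolding cartier_ideal_def by blast

lemma C_ideal_subset:
  assumes "ideal L R" "\<And>\<phi> g. \<phi> \<in> C_maps e \<Longrightarrow> g \<in> J \<Longrightarrow> \<phi> g \<in> L"
  shows "C_ideal e J \<subseteq> L"
  unfolding cartier_ideal_def by (rule genideal_minimal[OF assms(1)]) (use assms(2) in auto)

lemma C_ideal_mono: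
  assumes "J \<subseteq> J'" "J' \<subseteq> carrier R"
  shows "C_ideal e J \<subseteq> C_ideal e J'"
  by (rule C_ideal_subset[OF C_ideal_ideal[OF assms(2)]]) (use assms C_ideal_gen[OF assms(2)] in auto)

text \<open>The largest ideal whose elements, after multiplication by any scalar, are mapped by
  \<open>\<phi>\<close> into \<open>L\<close>; it reduces statements about \<open>\<phi>\<close> on an ideal to generators.\<close>

lemma cartier_vimage_ideal:
  assumes L: "ideal L R" and \<phi>: "\<phi> \<in> C_maps e"
  shows "ideal {x \<in> carrier R. \<forall>r\<in>carrier R. \<phi> (r \<otimes> x) \<in> L} R"
proof (rule idealI_mult)
  show "\<zero> \<in> {x \<in> carrier R. \<forall>r\<in>carrier R. \<phi> (r \<otimes> x) \<in> L}"
    using cartier_map_zero[OF \<phi>] ideal_zero[OF L] by simp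
  show "x \<oplus> y \<in> {x \<in> carrier R. \<forall>r\<in>carrier R. \<phi> (r \<otimes> x) \<in> L}"
    if "x \<in> {x \<in> carrier R. \<forall>r\<in>carrier R. \<phi> (r \<otimes> x) \<in> L}"
      "y \<in> {x \<in> carrier R. \<forall>r\<in>carrier R. \<phi> (r \<otimes> x) \<in> L}" for x y
    using that cartier_plus[OF \<phi>] ideal_add[OF L] by (simp add: r_distr)
  show "a \<otimes> x \<in> {x \<in> carrier R. \<forall>r\<in>carrier R. \<phi> (r \<otimes> x) \<in> L}"
    if "a \<in> carrier R" "x \<in> {x \<in> carrier R. \<forall>r\<in>carrier R. \<phi> (r \<otimes> x) \<in> L}" for a x
    using that by (simp add: m_assoc[symmetric])
qed auto

lemma cartier_map_Idl:
  assumes L: "ideal L R" and \<phi>: "\<phi> \<in> C_maps e" and G: "G \<subseteq> carrier R"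
    and "\<And>r g. r \<in> carrier R \<Longrightarrow> g \<in> G \<Longrightarrow> \<phi> (r \<otimes> g) \<in> L" and x: "x \<in> Idl G"
  shows "\<phi> x \<in> L"
proof -
  have "Idl G \<subseteq> {x \<in> carrier R. \<forall>r\<in>carrier R. \<phi> (r \<otimes> x) \<in> L}"
    using assms(4) G by (intro genideal_minimal cartier_vimage_ideal[OF L \<phi>]) auto
  then have "\<phi> (\<one> \<otimes> x) \<in> L" using x by blast
  then show ?thesis using x ideal_carrier[OF genideal_ideal[OF G]] by simp
qed

text \<open>Compositions of Cartier maps are Cartier maps, the levels being added; \<open>r \<psi>(g) = \<psi>(r\<^sup>q g)\<close> with
  \<open>q = p\<^sup>b\<close> moves scalars into \<open>J\<close>.\<close>

lemma C_ideal_comp_subset: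
  assumes J: "ideal J R"
  shows "C_ideal a (C_ideal b J) \<subseteq> C_ideal (a + b) J"
proof (rule C_ideal_subset)
  have Jc: "J \<subseteq> carrier R" using ideal_subset[OF J] .
  show I: "ideal (C_ideal (a + b) J) R" using Jc by (rule C_ideal_ideal)
  fix \<phi> x assume \<phi>: "\<phi> \<in> C_maps a" and x: "x \<in> C_ideal b J"
  show "\<phi> x \<in> C_ideal (a + b) J"
  proof (rule cartier_map_Idl[OF I \<phi> C_gens_carrier[OF Jc]])
    show "x \<in> Idl {\<psi> g |\<psi> g. \<psi> \<in> C_maps b \<and> g \<in> J}" using x unfolding cartier_ideal_def .
    fix r y assume r: "r \<in> carrier R" and "y \<in> {\<psi> g |\<psi> g. \<psi> \<in> C_maps b \<and> g \<in> J}"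
    then obtain \<psi> g where \<psi>: "\<psi> \<in> C_maps b" "g \<in> J" "y = \<psi> g" by blast
    have "r [^] (p ^ b) \<otimes> g \<in> J" using r by (intro ideal_mult[OF J \<psi>(2)]) simp
    from C_ideal_gen[OF Jc cartier_comp[OF \<phi> \<psi>(1)] this]
    show "\<phi> (r \<otimes> y) \<in> C_ideal (a + b) J"
      using \<psi> r cartier_frob[OF \<psi>(1) r] ideal_carrier[OF J] by simp
  qed
qed

definition frobenius_power :: "nat \<Rightarrow> 'a set \<Rightarrow> 'a set" where
  "frobenius_power e K = Idl ((\<lambda>c. c [^] (p ^ e)) ` K)"

lemma frobenius_power_gens: "K \<subseteq> carrier R \<Longrightarrow> (\<lambda>c. c [^] (p ^ e)) ` K \<subseteq> carrier R"
  by auto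

lemma frobenius_power_ideal: "K \<subseteq> carrier R \<Longrightarrow> ideal (frobenius_power e K) R"
  unfolding frobenius_power_def by (rule genideal_ideal[OF frobenius_power_gens])

lemma frobenius_power_gen: "K \<subseteq> carrier R \<Longrightarrow> c \<in> K \<Longrightarrow> c [^] (p ^ e) \<in> frobenius_power e K"
  unfolding frobenius_power_def using genideal_self[OF frobenius_power_gens] by blast

lemma frobenius_power_subset:
  assumes "ideal L R" "\<And>c. c \<in> K \<Longrightarrow> c [^] (p ^ e) \<in> L"
  shows "frobenius_power e K \<subseteq> L"
  unfolding frobenius_power_def by (rule genideal_minimal[OF assms(1)]) (use assms(2) in auto)

lemma frobenius_power_mono: "K \<subseteq> L \<Longrightarrow> L \<subseteq> carrier R \<Longrightarrow> frobenius_power e K \<subseteq> frobenius_power e L"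
  using frobenius_power_gen by (intro frobenius_power_subset frobenius_power_ideal) auto

lemma generates_uniformly:
  assumes P: "primeideal P R" and gen: "generates_at P X" and Y: "finite Y" "Y \<subseteq> carrier R"
  shows "\<exists>s\<in>carrier R - P. \<forall>c\<in>Y \<rightarrow> carrier R. \<exists>d\<in>X \<rightarrow> carrier R. s [^] p \<otimes> lc c Y = lc d X"
  using Y
proof (induct Y rule: finite_induct)
  case empty
  have X: "X \<subseteq> carrier R" using gen by (auto simp: generates_at_def)
  have "\<one> [^] p \<otimes> lc c {} = lc (\<lambda>x. \<zero>) X" for c
    using lc_zero[OF X] by (simp add: lc_def)
  moreover have "(\<lambda>x. \<zero>) \<in> X \<rightarrow> carrier R" "\<one> \<in> carrier R - P"
    using prime_one[OF P] by auto
  ultimately show ?case by blast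
next
  case (insert y Y)
  have X: "finite X" "X \<subseteq> carrier R" using gen by (auto simp: generates_at_def)
  have yc: "y \<in> carrier R" "Y \<subseteq> carrier R" using insert by auto
  obtain s where s: "s \<in> carrier R - P"
    "\<forall>c\<in>Y \<rightarrow> carrier R. \<exists>d\<in>X \<rightarrow> carrier R. s [^] p \<otimes> lc c Y = lc d X"
    using insert(3)[OF yc(2)] by blast
  obtain t b where t: "t \<in> carrier R - P" "b \<in> X \<rightarrow> carrier R" "t [^] p \<otimes> y = lc b X"
    using gen yc(1) unfolding generates_at_def by blast
  have st: "s \<in> carrier R" "t \<in> carrier R" using s t by auto
  have "\<exists>d\<in>X \<rightarrow> carrier R. (s \<otimes> t) [^] p \<otimes> lc c (insert y Y) = lc d X"
    if c: "c \<in> insert y Y \<rightarrow> carrier R" for c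
  proof -
    obtain d where d: "d \<in> X \<rightarrow> carrier R" "s [^] p \<otimes> lc c Y = lc d X" using s(2) c by auto
    have cy: "c y \<in> carrier R" "s \<otimes> c y \<in> carrier R" using c st by auto
    have lY: "lc c Y \<in> carrier R" using c yc by auto
    have "(s \<otimes> t) [^] p \<otimes> lc c (insert y Y)
      = (s \<otimes> c y) [^] p \<otimes> (t [^] p \<otimes> y) \<oplus> t [^] p \<otimes> (s [^] p \<otimes> lc c Y)"
      using lc_insert[OF insert(1,2,4) c] st cy yc lY by (simp add: nat_pow_distrib r_distr m_ac)
    also have "\<dots> = lc (\<lambda>x. (s \<otimes> c y) \<otimes> b x) X \<oplus> lc (\<lambda>x. t \<otimes> d x) X"
      unfolding t(3) d(2) using lc_mult[OF X t(2) cy(2)] lc_mult[OF X d(1) st(2)] by simp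
    also have "\<dots> = lc (\<lambda>x. (s \<otimes> c y) \<otimes> b x \<oplus> t \<otimes> d x) X"
      using t(2) d(1) cy st X by (intro lc_add[symmetric]) auto
    finally show ?thesis
      using t(2) d(1) cy st by (intro bexI[of _ "\<lambda>x. (s \<otimes> c y) \<otimes> b x \<oplus> t \<otimes> d x"]) auto
  qed
  then show ?case using prime_mult[OF P s(1) t(1)] by blast
qed

text \<open>Generators of the \<open>e\<close>-th pushforward also generate the first one: \<open>p\<^sup>e\<close>-th powers are \<open>p\<close>-th
  powers.\<close>

lemma F_finite_generators:
  assumes "F_finite p R"
  obtains Y where "finite Y" "Y \<subseteq> carrier R" "\<And>y. y \<in> carrier R \<Longrightarrow> \<exists>c\<in>Y \<rightarrow> carrier R. y = lc c Y"
proof -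
  obtain e where e: "e > 0" "fin_gen_module R (frob_pushforward p e R)"
    using assms unfolding F_finite_def by blast
  let ?N = "frob_pushforward p e R"
  have N: "carrier ?N = carrier R" "\<And>f A. finsum ?N f A = finsum R f A"
    "\<And>r x. r \<odot>\<^bsub>?N\<^esub> x = r [^] (p ^ e) \<otimes> x"
    by (simp_all add: frob_pushforward_def finsum_def finprod_def)
  obtain Y where Y: "Y \<subseteq> carrier R" "finite Y"
    "\<And>y. y \<in> carrier R \<Longrightarrow> \<exists>c\<in>Y \<rightarrow> carrier R. y = (\<Oplus>x\<in>Y. c x [^] (p ^ e) \<otimes> x)"
    using e(2) unfolding fin_gen_module_def N by blast
  obtain k where k: "e = Suc k" using e(1) by (cases e) auto
  show thesis
  proof (rule that[OF Y(2,1)])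
    fix y assume "y \<in> carrier R"
    then obtain c where c: "c \<in> Y \<rightarrow> carrier R" "y = (\<Oplus>x\<in>Y. c x [^] (p ^ e) \<otimes> x)" using Y(3) by blast
    let ?d = "\<lambda>x. c x [^] (p ^ k)"
    have d: "?d \<in> Y \<rightarrow> carrier R" using c(1) by auto
    have "lc ?d Y = y"
      unfolding lc_def c(2)
    proof (rule finsum_cong')
      show "(\<lambda>x. c x [^] (p ^ e) \<otimes> x) \<in> Y \<rightarrow> carrier R" using c(1) Y(1) by (auto simp: Pi_iff subset_iff)
      fix x assume "x \<in> Y"
      then have "c x \<in> carrier R" using c(1) by auto
      then show "(c x [^] (p ^ k)) [^] p \<otimes> x = c x [^] (p ^ e) \<otimes> x"
        unfolding k by (simp add: nat_pow_pow mult.commute)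
    qed simp
    then show "\<exists>c\<in>Y \<rightarrow> carrier R. y = lc c Y" using d by blast
  qed
qed

text \<open>Near a regular point \<open>F\<^sub>*R\<close> is free, and the coordinates with respect to a basis,
  multiplied by a common denominator \<open>s\<close>, are Cartier maps.\<close>

lemma cartier_coordinates:
  assumes dom: "domain R" and reg: "regular_parameters P U" and fin: "F_finite p R"
  shows "\<exists>s\<in>carrier R - P. \<exists>X \<phi>. finite X \<and> X \<subseteq> carrier R \<and> (\<forall>x\<in>X. \<phi> x \<in> C_maps 1)
    \<and> (\<forall>y\<in>carrier R. s [^] p \<otimes> y = lc (\<lambda>x. \<phi> x y) X)"
proof -
  have P: "primeideal P R" using reg by (auto simp: regular_parameters_def)
  obtain Y where Y: "finite Y" "Y \<subseteq> carrier R"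
    "\<And>y. y \<in> carrier R \<Longrightarrow> \<exists>c\<in>Y \<rightarrow> carrier R. y = lc c Y"
    using F_finite_generators[OF fin] by blast
  have "generates_at P Y"
    unfolding generates_at_def
  proof (intro conjI ballI Y(1,2))
    fix y assume y: "y \<in> carrier R"
    obtain c where "c \<in> Y \<rightarrow> carrier R" "y = lc c Y" using Y(3)[OF y] by blast
    moreover from this have "\<one> [^] p \<otimes> y = lc c Y" using y by simp
    ultimately show "\<exists>s\<in>carrier R - P. \<exists>c\<in>Y \<rightarrow> carrier R. s [^] p \<otimes> y = lc c Y"
      using prime_one[OF P] by blast
  qed
  then obtain X where gen: "generates_at P X" and least: "\<And>Z. generates_at P Z \<Longrightarrow> card X \<le> card Z"
    using ex_has_least_nat[of "generates_at P" Y card] by blast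
  have X: "finite X" "X \<subseteq> carrier R" using gen by (auto simp: generates_at_def)
  have min: "\<not> generates_at P (X - {x})" if "x \<in> X" for x
    using least[of "X - {x}"] card_Diff1_less[OF X(1) that] by auto
  \<comment> \<open>for the empty set of parameters, \<open>relation_mod_parameters\<close> says that \<open>X\<close> is linearly independent\<close>
  have unique: "c x = d x" if h: "c \<in> X \<rightarrow> carrier R" "d \<in> X \<rightarrow> carrier R" "lc c X = lc d X" "x \<in> X"
    for c d x
  proof -
    have m1: "\<ominus> \<one> \<in> carrier R" by simp
    have cx: "c x \<in> carrier R" "d x \<in> carrier R" using h by auto
    have dc: "(\<lambda>z. \<ominus> \<one> \<otimes> d z) \<in> X \<rightarrow> carrier R" using h(2) by auto
    have "lc (\<lambda>z. c z \<oplus> \<ominus> \<one> \<otimes> d z) X = lc d X \<oplus> (\<ominus> \<one>) [^] p \<otimes> lc d X"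
      using lc_add[OF X(2) h(1) dc] lc_mult[OF X h(2) m1] h(3) by simp
    also have "\<dots> = \<zero>" using X h(2) by (simp add: pow_p_minus l_minus r_neg)
    finally have "lc (\<lambda>z. c z \<oplus> \<ominus> \<one> \<otimes> d z) X \<in> sat P (Idl ((\<lambda>u. u [^] p) ` {}))"
      using ideal_zero[OF sat_ideal[OF P genideal_ideal[of "{}"]]] by simp
    then have "c x \<oplus> \<ominus> \<one> \<otimes> d x \<in> sat P (Idl {})"
      using relation_mod_parameters[OF reg gen min _ _ _ h(4), of "{}" "\<lambda>z. c z \<oplus> \<ominus> \<one> \<otimes> d z"]
        h(1) dc by auto
    moreover have "sat P {\<zero>} = {\<zero>}"
      using domain.zeroprimeideal[OF dom] ideal_zero[OF prime_ideal[OF P]]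
      by (intro sat_prime[OF _ _ P]) auto
    ultimately have "c x \<oplus> \<ominus> \<one> \<otimes> d x = \<zero>" unfolding Idl_empty by simp
    then have "c x \<oplus> \<ominus> d x = \<zero>" using cx by (simp add: l_minus)
    then have "c x = \<ominus> (\<ominus> d x)" using cx by (intro minus_equality[symmetric]) (simp_all add: a_comm)
    then show ?thesis using cx by simp
  qed
  obtain s where s: "s \<in> carrier R - P"
    "\<And>c. c \<in> Y \<rightarrow> carrier R \<Longrightarrow> \<exists>d\<in>X \<rightarrow> carrier R. s [^] p \<otimes> lc c Y = lc d X"
    using generates_uniformly[OF P gen Y(1,2)] by blast
  have sc: "s [^] p \<in> carrier R" using s(1) by simp
  have "\<exists>d. d \<in> X \<rightarrow> carrier R \<and> s [^] p \<otimes> y = lc d X" if "y \<in> carrier R" for y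
    using Y(3)[OF that] s(2) by blast
  then obtain D where D: "\<And>y. y \<in> carrier R \<Longrightarrow> D y \<in> X \<rightarrow> carrier R"
    "\<And>y. y \<in> carrier R \<Longrightarrow> s [^] p \<otimes> y = lc (D y) X" by metis
  have "(\<lambda>y. D y x) \<in> C_maps 1" if x: "x \<in> X" for x
  proof (rule cartier_mapsI)
    show "D y x \<in> carrier R" if "y \<in> carrier R" for y using D(1)[OF that] x by auto
    show "D (y \<oplus> z) x = D y x \<oplus> D z x" if yz: "y \<in> carrier R" "z \<in> carrier R" for y z
    proof (rule unique[OF _ _ _ x])
      show "(\<lambda>x. D y x \<oplus> D z x) \<in> X \<rightarrow> carrier R" using D(1) yz by (auto simp: Pi_iff)
      show "lc (D (y \<oplus> z)) X = lc (\<lambda>x. D y x \<oplus> D z x) X"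
        using D(2)[of "y \<oplus> z"] lc_add[OF X(2) D(1)[OF yz(1)] D(1)[OF yz(2)]] D(2) yz sc
        by (simp add: r_distr)
    qed (use D(1) yz in auto)
    show "D (r [^] (p ^ 1) \<otimes> y) x = r \<otimes> D y x" if ry: "r \<in> carrier R" "y \<in> carrier R" for r y
    proof (rule unique[OF _ _ _ x])
      show "(\<lambda>x. r \<otimes> D y x) \<in> X \<rightarrow> carrier R" using D(1) ry by (auto simp: Pi_iff)
      have "s [^] p \<otimes> (r [^] p \<otimes> y) = r [^] p \<otimes> (s [^] p \<otimes> y)" using ry sc by (simp add: m_ac)
      then show "lc (D (r [^] (p ^ 1) \<otimes> y)) X = lc (\<lambda>x. r \<otimes> D y x) X"
        using D(2)[of "r [^] p \<otimes> y"] lc_mult[OF X D(1)[OF ry(2)] ry(1)] D(2) ry by simp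
    qed (use D(1) ry in auto)
  qed
  then show ?thesis
    using s(1) X D(2)
    by (intro bexI[of _ s] exI[of _ X] exI[of _ "\<lambda>x y. D y x"] conjI ballI) simp_all
qed

text \<open>The coordinates of \<open>y \<in> J\<close> with respect to a local basis of \<open>F\<^sub>*R\<close> lie in \<open>C 1 J\<close>. So the
  ideal of all \<open>s\<close> for which \<open>s y\<close> belongs to the Frobenius power is contained in no prime.\<close>

lemma regular_subset_frobenius_power:
  assumes dom: "domain R" and reg: "regular_ring R" and fin: "F_finite p R" and J: "ideal J R"
  shows "J \<subseteq> frobenius_power 1 (C_ideal 1 J)"
proof
  fix y assume y: "y \<in> J"
  have yc: "y \<in> carrier R" using y ideal_carrier[OF J] by simp
  have Jc: "J \<subseteq> carrier R" using ideal_subset[OF J] .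
  have CJ: "C_ideal 1 J \<subseteq> carrier R" using ideal_subset[OF C_ideal_ideal[OF Jc]] .
  let ?K = "frobenius_power 1 (C_ideal 1 J)"
  have K: "ideal ?K R" using CJ by (rule frobenius_power_ideal)
  let ?A = "{s \<in> carrier R. \<forall>x\<in>{y}. s \<otimes> x \<in> ?K}"
  have A: "ideal ?A R" by (rule colon_set_ideal[OF K]) (use yc in simp)
  have "?A = carrier R"
  proof (rule ccontr)
    assume "?A \<noteq> carrier R"
    then obtain P where P: "primeideal P R" "?A \<subseteq> P" using exists_prime_over[OF A] by blast
    obtain U where U: "regular_parameters P U"
      using regular_local_imp_parameters[OF P(1)] reg P(1) unfolding regular_ring_def by blast
    obtain s X \<phi> where s: "s \<in> carrier R - P"
      and X\<phi>: "finite X \<and> X \<subseteq> carrier R \<and> (\<forall>x\<in>X. \<phi> x \<in> C_maps 1)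
        \<and> (\<forall>y\<in>carrier R. s [^] p \<otimes> y = lc (\<lambda>x. \<phi> x y) X)"
      using cartier_coordinates[OF dom U fin] by (elim bexE exE)
    have X: "finite X" "X \<subseteq> carrier R" and \<phi>: "\<And>x. x \<in> X \<Longrightarrow> \<phi> x \<in> C_maps 1"
      and eq: "\<And>y. y \<in> carrier R \<Longrightarrow> s [^] p \<otimes> y = lc (\<lambda>x. \<phi> x y) X"
      using X\<phi> by simp_all
    have "lc (\<lambda>x. \<phi> x y) X \<in> ?K"
    proof (rule lc_mem_ideal[OF K X])
      show "(\<lambda>x. \<phi> x y) \<in> X \<rightarrow> carrier R" using cartier_closed[OF \<phi> yc] by auto
      show "\<phi> x y [^] p \<in> ?K" if "x \<in> X" for x
        using frobenius_power_gen[OF CJ C_ideal_gen[OF Jc \<phi>[OF that] y], of 1] by simp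
    qed
    then have "s [^] p \<in> ?A" using eq[OF yc] s by simp
    then show False using P prime_pow[OF P(1), of s p] s by auto
  qed
  then have "\<one> \<in> ?A" by simp
  then show "y \<in> ?K" using yc by simp
qed

lemma C_ideal_ipow_mono:
  assumes I: "ideal I R" and "m \<le> n"
  shows "C_ideal e (ipow I n) \<subseteq> C_ideal e (ipow I m)"
  by (rule C_ideal_mono[OF ipow_antimono[OF assms] ideal_subset[OF ipow_ideal[OF I]]])

abbreviation test_term :: "'a set \<Rightarrow> nat \<Rightarrow> real \<Rightarrow> 'a set" where
  "test_term I e c \<equiv> C_ideal e (ipow I (nat \<lceil>real (p ^ e) * c\<rceil>))"

lemma test_exponent_lift: "nat \<lceil>real (p ^ Suc e) * c\<rceil> \<le> nat \<lceil>real (p ^ e) * c\<rceil> * p"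
proof -
  have "real (p ^ Suc e) * c = real p * (real (p ^ e) * c)" by simp
  also have "\<dots> \<le> real p * real_of_int \<lceil>real (p ^ e) * c\<rceil>" by (intro mult_left_mono) auto
  finally have "\<lceil>real (p ^ Suc e) * c\<rceil> \<le> \<lceil>real (p ^ e) * c\<rceil> * int p"
    by (simp add: ceiling_le_iff mult.commute)
  also have "\<dots> \<le> int (nat \<lceil>real (p ^ e) * c\<rceil>) * int p" by (intro mult_right_mono) auto
  finally show ?thesis
    by (simp only: nat_le_iff of_nat_mult)
qed

lemma test_ideal_antimono:
  assumes I: "ideal I R" and "c \<le> d"
  shows "test_ideal p R I d \<subseteq> test_ideal p R I c"
proof -
  have "test_term I e d \<subseteq> test_term I e c" for e
    using assms(2) by (intro C_ideal_ipow_mono[OF I] nat_mono ceiling_mono mult_left_mono) auto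
  then show ?thesis unfolding test_ideal_def by blast
qed

end

section \<open>Cartier ideals when Frobenius is flat\<close>

text \<open>For F-finite \<open>R\<close> the assumption holds when \<open>F\<^sub>*R\<close> is projective; this form is what the theory
  of test ideals uses.\<close>

locale flat_frobenius = char_p_cring +
  assumes subset_frobenius_power_1: "ideal J R \<Longrightarrow> J \<subseteq> frobenius_power 1 (C_ideal 1 J)"
begin

lemma frobenius_power_comp:
  assumes K: "K \<subseteq> carrier R"
  shows "frobenius_power a (frobenius_power b K) \<subseteq> frobenius_power (a + b) K"
proof (rule frobenius_power_subset)
  show I: "ideal (frobenius_power (a + b) K) R" using K by (rule frobenius_power_ideal)
  have "frobenius_power b K \<subseteq> {c \<in> carrier R. c [^] (p ^ a) \<in> frobenius_power (a + b) K}"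
  proof (rule frobenius_power_subset[OF frob_vimage_ideal[OF I]])
    fix c assume c: "c \<in> K"
    then have cc: "c \<in> carrier R" using K by auto
    have "(c [^] (p ^ b)) [^] (p ^ a) = c [^] (p ^ (a + b))"
      using cc by (simp add: nat_pow_pow power_add mult.commute)
    then show "c [^] (p ^ b) \<in> {c \<in> carrier R. c [^] (p ^ a) \<in> frobenius_power (a + b) K}"
      using frobenius_power_gen[OF K c] cc by simp
  qed
  then show "c [^] (p ^ a) \<in> frobenius_power (a + b) K" if "c \<in> frobenius_power b K" for c
    using that by blast
qed

lemma subset_frobenius_power:
  assumes J: "ideal J R"
  shows "J \<subseteq> frobenius_power e (C_ideal e J)"
proof (induct e)
  case 0
  have Jc: "J \<subseteq> carrier R" using ideal_subset[OF J] .
  have CJ: "C_ideal 0 J \<subseteq> carrier R" using ideal_subset[OF C_ideal_ideal[OF Jc]] .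
  have id: "(\<lambda>x. x) \<in> C_maps 0" by (rule cartier_mapsI) auto
  show ?case
  proof
    fix x assume x: "x \<in> J"
    then have "x [^] (p ^ 0) \<in> frobenius_power 0 (C_ideal 0 J)"
      using C_ideal_gen[OF Jc id x] by (intro frobenius_power_gen[OF CJ])
    then show "x \<in> frobenius_power 0 (C_ideal 0 J)" using x ideal_carrier[OF J] by simp
  qed
next
  case (Suc e)
  have Jc: "J \<subseteq> carrier R" using ideal_subset[OF J] .
  let ?K = "C_ideal e J"
  have K: "ideal ?K R" using C_ideal_ideal[OF Jc] .
  have Kc: "?K \<subseteq> carrier R" using ideal_subset[OF K] .
  have CK: "C_ideal 1 ?K \<subseteq> carrier R" using ideal_subset[OF C_ideal_ideal[OF Kc]] .
  have "frobenius_power e ?K \<subseteq> frobenius_power e (frobenius_power 1 (C_ideal 1 ?K))"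
    using subset_frobenius_power_1[OF K] ideal_subset[OF frobenius_power_ideal[OF CK]]
    by (rule frobenius_power_mono)
  also have "\<dots> \<subseteq> frobenius_power (e + 1) (C_ideal 1 ?K)"
    by (rule frobenius_power_comp[OF CK])
  also have "\<dots> \<subseteq> frobenius_power (e + 1) (C_ideal (1 + e) J)"
    using C_ideal_comp_subset[OF J] ideal_subset[OF C_ideal_ideal[OF Jc]]
    by (rule frobenius_power_mono)
  finally show ?case using Suc by simp
qed

text \<open>For \<open>\<theta>\<close> of level \<open>a + b\<close> and \<open>g = \<Sum> r\<^sub>i c\<^sub>i\<^sup>q\<close> with \<open>q = p\<^sup>b\<close>, the maps
  \<open>z \<mapsto> \<theta> (r\<^sub>i z\<^sup>q)\<close> are Cartier maps of level \<open>a\<close>.\<close>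

lemma C_ideal_comp:
  assumes J: "ideal J R"
  shows "C_ideal a (C_ideal b J) = C_ideal (a + b) J"
proof
  show "C_ideal a (C_ideal b J) \<subseteq> C_ideal (a + b) J" using J by (rule C_ideal_comp_subset)
  have Jc: "J \<subseteq> carrier R" using ideal_subset[OF J] .
  have Kc: "C_ideal b J \<subseteq> carrier R" using ideal_subset[OF C_ideal_ideal[OF Jc]] .
  show "C_ideal (a + b) J \<subseteq> C_ideal a (C_ideal b J)"
  proof (rule C_ideal_subset)
    show I: "ideal (C_ideal a (C_ideal b J)) R" using Kc by (rule C_ideal_ideal)
    fix \<theta> g assume \<theta>: "\<theta> \<in> C_maps (a + b)" and g: "g \<in> J"
    show "\<theta> g \<in> C_ideal a (C_ideal b J)"
    proof (rule cartier_map_Idl[OF I \<theta> frobenius_power_gens[OF Kc]])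
      show "g \<in> Idl ((\<lambda>c. c [^] (p ^ b)) ` C_ideal b J)"
        using subset_frobenius_power[OF J, of b] g unfolding frobenius_power_def by blast
      fix r y assume r: "r \<in> carrier R" and "y \<in> (\<lambda>c. c [^] (p ^ b)) ` C_ideal b J"
      then obtain c where c: "c \<in> C_ideal b J" "y = c [^] (p ^ b)" by blast
      have "(\<lambda>z. \<theta> (r \<otimes> z [^] (p ^ b))) \<in> C_maps a"
      proof (rule cartier_mapsI)
        show "\<theta> (r \<otimes> z [^] (p ^ b)) \<in> carrier R" if "z \<in> carrier R" for z
          using that r cartier_closed[OF \<theta>] by simp
        show "\<theta> (r \<otimes> (x \<oplus> y) [^] (p ^ b)) = \<theta> (r \<otimes> x [^] (p ^ b)) \<oplus> \<theta> (r \<otimes> y [^] (p ^ b))"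
          if "x \<in> carrier R" "y \<in> carrier R" for x y
          using that r cartier_plus[OF \<theta>] by (simp add: frob_add r_distr)
        show "\<theta> (r \<otimes> (t [^] (p ^ a) \<otimes> z) [^] (p ^ b)) = t \<otimes> \<theta> (r \<otimes> z [^] (p ^ b))"
          if tz: "t \<in> carrier R" "z \<in> carrier R" for t z
        proof -
          have "r \<otimes> (t [^] (p ^ a) \<otimes> z) [^] (p ^ b) = t [^] (p ^ (a + b)) \<otimes> (r \<otimes> z [^] (p ^ b))"
            using tz r by (simp add: nat_pow_distrib nat_pow_pow power_add m_ac)
          then show ?thesis using cartier_frob[OF \<theta> tz(1)] tz r by simp
        qed
      qed
      from C_ideal_gen[OF Kc this c(1)]
      show "\<theta> (r \<otimes> y) \<in> C_ideal a (C_ideal b J)" unfolding c(2) .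
    qed
  qed
qed

text \<open>A form of F-purity: if \<open>C e R\<close> were proper, its Frobenius power would be proper, too.\<close>

lemma C_ideal_carrier: "C_ideal e (carrier R) = carrier R"
proof -
  have I: "ideal (C_ideal e (carrier R)) R" by (rule C_ideal_ideal) simp
  have "p ^ e = Suc (p ^ e - 1)" using p_pos by simp
  then have "frobenius_power e (C_ideal e (carrier R)) \<subseteq> C_ideal e (carrier R)"
    using ideal_mult[OF I] ideal_carrier[OF I]
    by (intro frobenius_power_subset[OF I]) (metis nat_pow_Suc nat_pow_closed)
  then show ?thesis using subset_frobenius_power[OF oneideal, of e] ideal_subset[OF I] by blast
qed

lemma C_ideal_mult_mem:
  assumes L: "ideal L R" and J: "J \<subseteq> carrier R" and k: "k \<in> carrier R"
    and "\<And>g. g \<in> J \<Longrightarrow> k [^] (p ^ e) \<otimes> g \<in> L" and y: "y \<in> C_ideal e J"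
  shows "k \<otimes> y \<in> C_ideal e L"
proof -
  have Lc: "L \<subseteq> carrier R" using ideal_subset[OF L] .
  have "C_ideal e J \<subseteq> colon (C_ideal e L) k"
  proof (rule C_ideal_subset[OF colon_ideal[OF C_ideal_ideal[OF Lc] k]])
    fix \<phi> g assume \<phi>: "\<phi> \<in> C_maps e" and g: "g \<in> J"
    have gc: "g \<in> carrier R" using g J by auto
    have "k \<otimes> \<phi> g = \<phi> (k [^] (p ^ e) \<otimes> g)" using cartier_frob[OF \<phi> k gc] by simp
    also have "\<dots> \<in> C_ideal e L" using assms(4)[OF g] by (rule C_ideal_gen[OF Lc \<phi>])
    finally show "\<phi> g \<in> colon (C_ideal e L) k"
      using cartier_closed[OF \<phi> gc] by (simp add: colon_def)
  qed
  then show ?thesis using y by (auto simp: colon_def)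
qed

section \<open>Powers of an ideal with \<open>r\<close> generators\<close>

definition frobenius_product :: "nat \<Rightarrow> 'a set \<Rightarrow> 'a set \<Rightarrow> 'a set" where
  "frobenius_product q K J = Idl {x [^] q \<otimes> y |x y. x \<in> K \<and> y \<in> J}"

definition monomial :: "'a set \<Rightarrow> ('a \<Rightarrow> nat) \<Rightarrow> 'a" where
  "monomial U \<alpha> = (\<Otimes>u\<in>U. u [^] \<alpha> u)"

lemma monomial_closed: "U \<subseteq> carrier R \<Longrightarrow> monomial U \<alpha> \<in> carrier R"
  unfolding monomial_def by (intro finprod_closed) auto

lemma monomial_split:
  assumes "finite U" "U \<subseteq> carrier R" "u \<in> U" "k \<le> \<alpha> u"
  shows "monomial U \<alpha> = u [^] k \<otimes> monomial U (\<alpha>(u := \<alpha> u - k))"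
proof -
  have U: "U = insert u (U - {u})" "finite (U - {u})" "U - {u} \<subseteq> carrier R" "u \<in> carrier R"
    using assms by auto
  have split: "monomial U \<beta> = u [^] \<beta> u \<otimes> monomial (U - {u}) \<beta>" for \<beta>
  proof -
    have "(\<lambda>v. v [^] \<beta> v) \<in> U - {u} \<rightarrow> carrier R" using U(3) by auto
    then have "(\<Otimes>v\<in>insert u (U - {u}). v [^] \<beta> v) = u [^] \<beta> u \<otimes> (\<Otimes>v\<in>U - {u}. v [^] \<beta> v)"
      using U by (intro finprod_insert) auto
    then show ?thesis using assms(3) by (simp add: monomial_def insert_absorb)
  qed
  have "monomial (U - {u}) (\<alpha>(u := \<alpha> u - k)) = monomial (U - {u}) \<alpha>"
    unfolding monomial_def using U(3) by (intro finprod_cong') auto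
  then show ?thesis
    using split[of \<alpha>] split[of "\<alpha>(u := \<alpha> u - k)"] U(4) assms(4) monomial_closed[OF U(3)]
    by (simp add: m_assoc[symmetric] nat_pow_mult)
qed

lemma monomial_mem_ipow:
  assumes I: "ideal I R" and "finite U" "U \<subseteq> I"
  shows "monomial U \<alpha> \<in> ipow I (sum \<alpha> U)"
  using assms(2,3)
proof (induct U rule: finite_induct)
  case empty
  then show ?case by (simp add: monomial_def)
next
  case (insert u U)
  have c: "u \<in> carrier R" "(\<lambda>v. v [^] \<alpha> v) \<in> U \<rightarrow> carrier R" using insert ideal_subset[OF I] by auto
  have "u [^] \<alpha> u \<in> ipow I (1 * \<alpha> u)" using insert ipow_1[OF I] by (intro pow_mem_ipow[OF I]) auto
  then have "u [^] \<alpha> u \<otimes> monomial U \<alpha> \<in> ipow I (\<alpha> u) \<cdot> ipow I (sum \<alpha> U)"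
    using insert by (intro ideal_prod.prod) auto
  then show ?case
    using insert c by (simp add: monomial_def ipow_add[OF I])
qed

lemma ipow_subset_monomials:
  assumes U: "finite U" "U \<subseteq> carrier R"
  shows "ipow (Idl U) n \<subseteq> Idl {monomial U \<alpha> |\<alpha>. sum \<alpha> U = n}"
proof (induct n)
  case 0
  have "monomial U (\<lambda>_. 0) = \<one>" unfolding monomial_def by (intro finprod_one_eqI) simp
  then have "\<one> \<in> {monomial U \<alpha> |\<alpha>. sum \<alpha> U = 0}"
    by (intro CollectI exI[of _ "\<lambda>_. 0"]) simp
  then have "\<one> \<in> Idl {monomial U \<alpha> |\<alpha>. sum \<alpha> U = 0}"
    using genideal_self[of "{monomial U \<alpha> |\<alpha>. sum \<alpha> U = 0}"] monomial_closed[OF U(2)] by blast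
  moreover have "ideal (Idl {monomial U \<alpha> |\<alpha>. sum \<alpha> U = 0}) R"
    using monomial_closed[OF U(2)] by (intro genideal_ideal) auto
  ultimately show ?case using ideal.one_imp_carrier by fastforce
next
  case (Suc n)
  let ?M = "\<lambda>n. {monomial U \<alpha> |\<alpha>. sum \<alpha> U = n}"
  have Mc: "?M k \<subseteq> carrier R" for k using monomial_closed[OF U(2)] by auto
  let ?L = "Idl (?M (Suc n))"
  have L: "ideal ?L R" using Mc by (rule genideal_ideal)
  have "(Idl (?M n)) \<cdot> (Idl U) \<subseteq> ?L"
  proof (rule Idl_prod_subset[OF L Mc U(2)])
    fix m u assume "m \<in> ?M n" and u: "u \<in> U"
    then obtain \<alpha> where m: "m = monomial U \<alpha>" and n: "sum \<alpha> U = n" by blast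
    have mc: "monomial U \<alpha> \<in> carrier R" using monomial_closed[OF U(2)] .
    let ?\<beta> = "\<alpha>(u := Suc (\<alpha> u))"
    have "monomial U ?\<beta> = u [^] (1::nat) \<otimes> monomial U (?\<beta>(u := ?\<beta> u - 1))"
      using u by (intro monomial_split[OF U]) auto
    then have "m \<otimes> u = monomial U ?\<beta>"
      unfolding m using u U(2) mc by (auto simp: m_comm)
    moreover have "sum ?\<beta> U = Suc n"
      using sum.remove[OF U(1) u, of ?\<beta>] sum.remove[OF U(1) u, of \<alpha>] n by simp
    ultimately have "m \<otimes> u \<in> ?M (Suc n)" by force
    then show "m \<otimes> u \<in> ?L" by (rule subsetD[OF genideal_self[OF Mc]])
  qed
  then show ?case
    unfolding ipow_Suc using ideal_prod_mono[OF Suc subset_refl] by blast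
qed

text \<open>By the pigeonhole principle, a monomial of degree more than \<open>r (q - 1)\<close> in \<open>r\<close> variables is
  divisible by the \<open>q\<close>-th power of a variable.\<close>

lemma ipow_subset_frobenius_product:
  assumes U: "finite U" "U \<subseteq> carrier R" "card U \<le> r" and q: "q > 0" "n + q > r * (q - 1)"
  shows "ipow (Idl U) (n + q) \<subseteq> frobenius_product q (Idl U) (ipow (Idl U) n)"
proof -
  have IU: "ideal (Idl U) R" using U(2) by (rule genideal_ideal)
  have UI: "U \<subseteq> Idl U" using U(2) by (rule genideal_self)
  let ?G = "{x [^] q \<otimes> y |x y. x \<in> Idl U \<and> y \<in> ipow (Idl U) n}"
  have Gc: "?G \<subseteq> carrier R" using ideal_carrier[OF IU] ideal_carrier[OF ipow_ideal[OF IU]] by auto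
  have "{monomial U \<alpha> |\<alpha>. sum \<alpha> U = n + q} \<subseteq> Idl ?G"
  proof safe
    fix \<alpha> assume \<alpha>: "sum \<alpha> U = n + q"
    have "\<exists>u\<in>U. \<alpha> u \<ge> q"
    proof (rule ccontr)
      assume "\<not> ?thesis"
      then have "\<And>u. u \<in> U \<Longrightarrow> \<alpha> u \<le> q - 1" using q(1) by force
      then have "sum \<alpha> U \<le> card U * (q - 1)" using sum_bounded_above[of U \<alpha> "q - 1"] by simp
      also have "\<dots> \<le> r * (q - 1)" using U(3) by (rule mult_le_mono1)
      finally show False using \<alpha> q(2) by simp
    qed
    then obtain u where u: "u \<in> U" "\<alpha> u \<ge> q" by blast
    let ?\<beta> = "\<alpha>(u := \<alpha> u - q)"
    have "sum ?\<beta> U = n"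
      using sum.remove[OF U(1) u(1), of ?\<beta>] sum.remove[OF U(1) u(1), of \<alpha>] \<alpha> u(2) by simp
    then have "monomial U ?\<beta> \<in> ipow (Idl U) n" using monomial_mem_ipow[OF IU U(1) UI, of ?\<beta>] by simp
    then have "u [^] q \<otimes> monomial U ?\<beta> \<in> ?G" using u(1) UI by blast
    then show "monomial U \<alpha> \<in> Idl ?G"
      using monomial_split[of U u q \<alpha>] U u genideal_self[OF Gc] by auto
  qed
  then have "Idl {monomial U \<alpha> |\<alpha>. sum \<alpha> U = n + q} \<subseteq> Idl ?G"
    by (intro genideal_minimal genideal_ideal Gc)
  then show ?thesis
    using ipow_subset_monomials[OF U(1,2), of "n + q"] unfolding frobenius_product_def by blast
qed

text \<open>Skoda's theorem: under the bound on \<open>n\<close> every generator of \<open>I\<^sup>n\<^sup>+\<^sup>q\<close>, \<open>q = p\<^sup>e\<close>, has a factor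
  \<open>x\<^sup>q\<close> with \<open>x \<in> I\<close>, and Cartier maps of level \<open>e\<close> turn \<open>x\<^sup>q\<close> into \<open>x\<close>.\<close>

lemma C_ideal_skoda:
  assumes U: "finite U" "U \<subseteq> carrier R" "card U \<le> r" "I = Idl U"
    and n: "n + p ^ e > r * (p ^ e - 1)"
  shows "C_ideal e (ipow I (n + p ^ e)) = I \<cdot> C_ideal e (ipow I n)"
proof
  have I: "ideal I R" unfolding U(4) using U(2) by (rule genideal_ideal)
  have In: "ideal (ipow I k) R" for k by (rule ipow_ideal[OF I])
  have Ic: "ipow I k \<subseteq> carrier R" for k using ideal_subset[OF In] .
  have CI: "ideal (C_ideal e (ipow I k)) R" for k by (rule C_ideal_ideal[OF Ic])
  have IC: "ideal (I \<cdot> C_ideal e (ipow I n)) R" by (intro ideal_prod_is_ideal I CI)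
  have q: "p ^ e > 0" using p_pos by simp
  show "C_ideal e (ipow I (n + p ^ e)) \<subseteq> I \<cdot> C_ideal e (ipow I n)"
  proof (rule C_ideal_subset[OF IC])
    fix \<phi> g assume \<phi>: "\<phi> \<in> C_maps e" and g: "g \<in> ipow I (n + p ^ e)"
    let ?G = "{x [^] (p ^ e) \<otimes> y |x y. x \<in> I \<and> y \<in> ipow I n}"
    show "\<phi> g \<in> I \<cdot> C_ideal e (ipow I n)"
    proof (rule cartier_map_Idl[OF IC \<phi>])
      show "?G \<subseteq> carrier R" using ideal_carrier[OF I] ideal_carrier[OF In] by auto
      show "g \<in> Idl ?G"
        using ipow_subset_frobenius_product[OF U(1-3) q n] g
        unfolding frobenius_product_def U(4) by blast
      fix s z assume s: "s \<in> carrier R" and "z \<in> ?G"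
      then obtain x y where xy: "x \<in> I" "y \<in> ipow I n" "z = x [^] (p ^ e) \<otimes> y" by blast
      have c: "x \<in> carrier R" "y \<in> carrier R" using xy ideal_carrier[OF I] ideal_carrier[OF In] by auto
      have "s \<otimes> z = x [^] (p ^ e) \<otimes> (s \<otimes> y)" unfolding xy(3) using s c by (simp add: m_ac)
      then have "\<phi> (s \<otimes> z) = x \<otimes> \<phi> (s \<otimes> y)" using cartier_frob[OF \<phi> c(1)] s c by simp
      moreover have "\<phi> (s \<otimes> y) \<in> C_ideal e (ipow I n)"
        by (rule C_ideal_gen[OF Ic \<phi> ideal_mult[OF In xy(2) s]])
      ultimately show "\<phi> (s \<otimes> z) \<in> I \<cdot> C_ideal e (ipow I n)"
        using xy(1) by (simp add: ideal_prod.prod)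
    qed
  qed
  show "I \<cdot> C_ideal e (ipow I n) \<subseteq> C_ideal e (ipow I (n + p ^ e))"
  proof (rule ideal_prod_subset[OF CI])
    fix k y assume k: "k \<in> I" and y: "y \<in> C_ideal e (ipow I n)"
    show "k \<otimes> y \<in> C_ideal e (ipow I (n + p ^ e))"
    proof (rule C_ideal_mult_mem[OF In Ic ideal_carrier[OF I k] _ y])
      fix g assume g: "g \<in> ipow I n"
      have kq: "k [^] (p ^ e) \<in> ipow I (p ^ e)"
        using pow_mem_ipow[OF I, of k "Suc 0" "p ^ e"] k ipow_1[OF I] by simp
      have "k [^] (p ^ e) \<otimes> g \<in> ipow I (p ^ e) \<cdot> ipow I n" using kq g by (rule ideal_prod.prod)
      then show "k [^] (p ^ e) \<otimes> g \<in> ipow I (n + p ^ e)"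
        using ipow_add[OF I, of "p ^ e" n] by (simp add: add.commute)
    qed
  qed
qed

lemma C_ideal_skoda_iterated:
  assumes U: "finite U" "U \<subseteq> carrier R" "card U \<le> r" "I = Idl U"
    and n: "n + p ^ e > r * (p ^ e - 1)"
  shows "C_ideal e (ipow I (n + a * p ^ e)) = ipow I a \<cdot> C_ideal e (ipow I n)"
proof (induct a)
  case 0
  have I: "ideal I R" unfolding U(4) using U(2) by (rule genideal_ideal)
  have "ideal (C_ideal e (ipow I n)) R" by (rule C_ideal_ideal[OF ideal_subset[OF ipow_ideal[OF I]]])
  then show ?case using ideal_prod_commute[OF oneideal] ideal_prod_one by simp
next
  case (Suc a)
  have I: "ideal I R" unfolding U(4) using U(2) by (rule genideal_ideal)
  have C: "ideal (C_ideal e (ipow I n)) R" by (rule C_ideal_ideal[OF ideal_subset[OF ipow_ideal[OF I]]])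
  have "C_ideal e (ipow I (n + Suc a * p ^ e)) = C_ideal e (ipow I ((n + a * p ^ e) + p ^ e))"
    by (simp add: algebra_simps)
  also have "\<dots> = I \<cdot> C_ideal e (ipow I (n + a * p ^ e))"
    using n by (intro C_ideal_skoda[OF U]) simp
  also have "\<dots> = (I \<cdot> ipow I a) \<cdot> C_ideal e (ipow I n)"
    unfolding Suc using ideal_prod_assoc[OF I ipow_ideal[OF I] C] by simp
  also have "I \<cdot> ipow I a = ipow I (Suc a)"
    using ideal_prod_commute[OF I ipow_ideal[OF I]] by simp
  finally show ?case .
qed

end

section \<open>Stabilisation of iterated Cartier images\<close>

context noetherian_cring
begin

text \<open>The argument of Hartshorne, Speiser, Lyubeznik and Gabber, in a form that needs only that
  \<open>\<Phi>\<close> is monotone and \<open>q\<close>-inverse linear. The ideals \<open>A n\<close> of all \<open>s\<close> with \<open>s K\<^sub>n \<subseteq> K\<^sub>n\<^sub>+\<^sub>1\<close>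
  increase, to \<open>A\<close> say. Near a minimal prime \<open>P\<close> of \<open>A\<close>, some power \<open>P\<^sup>k\<close> moves each \<open>K\<^sub>n\<close> into
  \<open>K\<^sub>n\<^sub>+\<^sub>1\<close>. As \<open>\<Phi>\<close> divides exponents by \<open>q\<close>, the ideal \<open>P\<^sup>2\<^sup>k\<^sup>+\<^sup>2 K\<^sub>N\<close> stays inside all later
  \<open>K\<^sub>n\<close>, so that the chain lives in a module of finite length.\<close>

lemma inverse_linear_chain_stabilises:
  assumes \<Phi>: "\<And>K. ideal K R \<Longrightarrow> ideal (\<Phi> K) R"
    and mono: "\<And>K L. ideal K R \<Longrightarrow> ideal L R \<Longrightarrow> K \<subseteq> L \<Longrightarrow> \<Phi> K \<subseteq> \<Phi> L"
    and lin: "\<And>k K L y. k \<in> carrier R \<Longrightarrow> ideal K R \<Longrightarrow> ideal L R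
      \<Longrightarrow> (\<And>g. g \<in> K \<Longrightarrow> k [^] (q::nat) \<otimes> g \<in> L) \<Longrightarrow> y \<in> \<Phi> K \<Longrightarrow> k \<otimes> y \<in> \<Phi> L"
    and q: "q \<ge> 2" and K0: "ideal (K 0) R" and K: "\<And>n. K (Suc n) = \<Phi> (K n)" and K1: "K 1 \<subseteq> K 0"
  shows "\<exists>N. \<forall>n\<ge>N. K n = K N"
proof -
  have IK: "ideal (K n) R" for n by (induct n) (auto simp: K0 K \<Phi>)
  have Kc: "x \<in> carrier R" if "x \<in> K n" for x n using that ideal_carrier[OF IK] by simp
  have dec: "K (Suc n) \<subseteq> K n" for n
  proof (induct n)
    case 0
    then show ?case using K1 by simp
  next
    case (Suc n)
    then show ?case using mono[OF IK IK Suc] K by simp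
  qed
  have anti: "K n \<subseteq> K m" if "m \<le> n" for m n using lift_Suc_antimono_le[of K, OF dec that] .
  define A where "A n = {s \<in> carrier R. \<forall>x\<in>K n. s \<otimes> x \<in> K (Suc n)}" for n
  have IA: "ideal (A n) R" for n
    unfolding A_def by (rule colon_set_ideal[OF IK ideal_subset[OF IK]])
  have "A n \<subseteq> A (Suc n)" for n
  proof
    fix s assume s: "s \<in> A n"
    then have sc: "s \<in> carrier R" by (simp add: A_def)
    have "q = Suc (q - 1)" using q by simp
    then have sq: "s [^] q = s [^] (q - 1) \<otimes> s" using nat_pow_Suc by metis
    have "s \<otimes> x \<in> \<Phi> (K (Suc n))" if "x \<in> \<Phi> (K n)" for x
    proof (rule lin[OF sc IK IK _ that])
      fix g assume g: "g \<in> K n"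
      have "s [^] q \<otimes> g = s [^] (q - 1) \<otimes> (s \<otimes> g)"
        unfolding sq using sc Kc[OF g] by (simp add: m_assoc)
      then show "s [^] q \<otimes> g \<in> K (Suc n)"
        using s g sc ideal_mult[OF IK] by (auto simp: A_def)
    qed
    then show "s \<in> A (Suc n)" using sc by (simp add: A_def K)
  qed
  then obtain N where N: "\<And>n. n \<ge> N \<Longrightarrow> A n = A N"
    using ascending_chain_stabilises[of A] IA by blast
  show ?thesis
  proof (cases "A N = carrier R")
    case True
    have inc: "K n \<subseteq> K (Suc n)" if n: "n \<ge> N" for n
    proof
      fix x assume x: "x \<in> K n"
      have "\<one> \<in> A n" using N[OF n] True by simp
      then have "\<one> \<otimes> x \<in> K (Suc n)" using x unfolding A_def by blast
      then show "x \<in> K (Suc n)" using Kc[OF x] by simp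
    qed
    have "K n = K N" if "n \<ge> N" for n
      using that
    proof (induct n rule: dec_induct)
      case (step n)
      then show ?case using dec[of n] inc[of n] by auto
    qed simp
    then show ?thesis by blast
  next
    case False
    then obtain P where P: "minimal_prime_over (A N) P"
      using exists_minimal_prime_over[OF IA] by blast
    have pP: "primeideal P R" and AP: "A N \<subseteq> P" using P by (auto simp: minimal_prime_over_def)
    have IP: "ideal P R" using pP by (rule prime_ideal)
    obtain s k where s: "s \<in> carrier R - P" "\<And>x. x \<in> ipow P k \<Longrightarrow> s \<otimes> x \<in> A N"
      using minimal_prime_power[OF IA P] by blast
    have sc: "s \<in> carrier R" using s(1) by simp
    \<comment> \<open>\<open>P\<^sup>l\<close> contains the \<open>q\<close>-th powers from \<open>P\<^sup>l\<^sup>'\<close>, and \<open>l'\<close> leaves room for another factor \<open>P\<^sup>k\<close>\<close>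
    define l where "l = 2 * k + 2"
    define l' where "l' = k + 2"
    have l': "l' * q \<ge> l" "l' + k \<le> l"
    proof -
      have "l' * 2 \<le> l' * q" using q by simp
      then show "l' * q \<ge> l" unfolding l_def l'_def by simp
      show "l' + k \<le> l" unfolding l_def l'_def by simp
    qed
    have Pl: "ideal (ipow P j) R" for j by (rule ipow_ideal[OF IP])
    have Plc: "x \<in> carrier R" if "x \<in> ipow P j" for x j using that ideal_carrier[OF Pl] by simp
    have push: "\<exists>t\<in>carrier R - P. \<forall>x\<in>ipow P l \<cdot> K N. t \<otimes> x \<in> K (N + n)" for n
    proof (induct n)
      case 0
      have "ipow P l \<cdot> K N \<subseteq> K N" using ideal_prod_inter[OF Pl IK] by auto
      then show ?case
        using s(1) ideal_mult[OF IK _ sc] by (intro bexI[of _ s]) auto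
    next
      case (Suc n)
      then obtain t where t: "t \<in> carrier R - P" "\<And>x. x \<in> ipow P l \<cdot> K N \<Longrightarrow> t \<otimes> x \<in> K (N + n)" by blast
      have tc: "t \<in> carrier R" using t(1) by simp
      have IlK: "ideal (ipow P l \<cdot> K N) R" by (intro ideal_prod_is_ideal Pl IK)
      have q1: "q = Suc (q - 1)" using q by simp
      have 1: "t \<otimes> y \<in> \<Phi> (K (N + n))" if "y \<in> \<Phi> (ipow P l \<cdot> K N)" for y
      proof (rule lin[OF tc IlK IK _ that])
        fix g assume g: "g \<in> ipow P l \<cdot> K N"
        have "t [^] q = t [^] (q - 1) \<otimes> t" using q1 nat_pow_Suc by metis
        then have "t [^] q \<otimes> g = t [^] (q - 1) \<otimes> (t \<otimes> g)"
          using tc ideal_carrier[OF IlK g] by (simp add: m_assoc)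
        then show "t [^] q \<otimes> g \<in> K (N + n)" using t(2)[OF g] tc ideal_mult[OF IK] by simp
      qed
      have 2: "i \<otimes> y \<in> \<Phi> (ipow P l \<cdot> K N)" if i: "i \<in> ipow P l'" and y: "y \<in> \<Phi> (K N)" for i y
      proof (rule lin[OF Plc[OF i] IK IlK _ y])
        fix g assume g: "g \<in> K N"
        have "i [^] q \<in> ipow P (l' * q)" by (rule pow_mem_ipow[OF IP i])
        then have "i [^] q \<in> ipow P l" using ipow_antimono[OF IP l'(1)] by blast
        then show "i [^] q \<otimes> g \<in> ipow P l \<cdot> K N" using g by (rule ideal_prod.prod)
      qed
      have "ipow P l \<cdot> K N \<subseteq> colon (K (Suc (N + n))) (t \<otimes> s)"
      proof -
        have st: "t \<otimes> s \<in> carrier R" using tc sc by simp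
        have C: "ideal (colon (K (Suc (N + n))) (t \<otimes> s)) R" using IK st by (rule colon_ideal)
        have "ipow P l \<subseteq> ipow P (l' + k)" using l'(2) by (rule ipow_antimono[OF IP])
        then have "ipow P l \<cdot> K N \<subseteq> ipow P (l' + k) \<cdot> K N" by (rule ideal_prod_mono) simp
        also have "\<dots> = ipow P l' \<cdot> (ipow P k \<cdot> K N)"
          using ipow_add[OF IP, of l' k] ideal_prod_assoc[OF Pl Pl IK] by simp
        also have "\<dots> \<subseteq> colon (K (Suc (N + n))) (t \<otimes> s)"
        proof (rule ideal_prod_subset[OF C])
          fix i z assume i: "i \<in> ipow P l'" and z: "z \<in> ipow P k \<cdot> K N"
          have zc: "z \<in> carrier R" using z ideal_carrier[OF ideal_prod_is_ideal[OF Pl IK]] by simp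
          have "ipow P k \<cdot> K N \<subseteq> colon (\<Phi> (K N)) s"
          proof (rule ideal_prod_subset[OF colon_ideal[OF \<Phi>[OF IK] sc]])
            fix a g assume a: "a \<in> ipow P k" and g: "g \<in> K N"
            have "(s \<otimes> a) \<otimes> g \<in> K (Suc N)" using s(2)[OF a] g unfolding A_def by blast
            then show "a \<otimes> g \<in> colon (\<Phi> (K N)) s"
              using sc Plc[OF a] Kc[OF g] by (simp add: colon_def K m_assoc)
          qed
          then have "s \<otimes> z \<in> \<Phi> (K N)" using z by (auto simp: colon_def)
          then have "t \<otimes> (i \<otimes> (s \<otimes> z)) \<in> \<Phi> (K (N + n))" using 1 2 i by blast
          moreover have "t \<otimes> (i \<otimes> (s \<otimes> z)) = (t \<otimes> s) \<otimes> (i \<otimes> z)"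
            using tc sc zc Plc[OF i] by (simp add: m_ac)
          ultimately show "i \<otimes> z \<in> colon (K (Suc (N + n))) (t \<otimes> s)"
            using zc Plc[OF i] by (simp add: colon_def K)
        qed
        finally show ?thesis .
      qed
      then show ?case using prime_mult[OF pP t(1) s(1)] by (intro bexI[of _ "t \<otimes> s"]) (auto simp: colon_def)
    qed
    define L where "L n = sat P (K (N + n))" for n
    have "\<exists>M. \<forall>n\<ge>M. L n = L M"
    proof (rule descending_chain_stabilises[OF pP IK, of L l N])
      fix n
      show "ideal (L n) R" unfolding L_def by (rule sat_ideal[OF pP IK])
      show "sat P (L n) = L n" unfolding L_def by (rule sat_sat[OF pP ideal_subset[OF IK]])
      show "L (Suc n) \<subseteq> L n" unfolding L_def using dec by (intro sat_mono) simp
      show "L n \<subseteq> sat P (K N)" unfolding L_def using anti by (intro sat_mono) simp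
      obtain t where t: "t \<in> carrier R - P" "\<forall>x\<in>ipow P l \<cdot> K N. t \<otimes> x \<in> K (N + n)"
        using push by blast
      show "ipow P l \<cdot> K N \<subseteq> L n"
      proof
        fix x assume x: "x \<in> ipow P l \<cdot> K N"
        then have "x \<in> carrier R" using ideal_carrier[OF ideal_prod_is_ideal[OF Pl IK]] by simp
        then show "x \<in> L n" unfolding L_def using t x by (intro satI[of _ t]) auto
      qed
    qed
    then obtain M where "\<forall>n\<ge>M. L n = L M" by blast
    then have eq: "L M = L (Suc M)" by (metis le_Suc_eq order_refl)
    have "K (N + M) \<subseteq> sat P (K (Suc (N + M)))"
      using sat_superset[OF pP ideal_subset[OF IK]] eq unfolding L_def by auto
    then obtain t where t: "t \<in> carrier R - P" "\<forall>x\<in>K (N + M). t \<otimes> x \<in> K (Suc (N + M))"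
      using sat_uniform[OF pP IK IK] by blast
    then have "t \<in> A (N + M)" by (simp add: A_def)
    then show ?thesis using N[of "N + M"] AP t(1) by auto
  qed
qed

end

section \<open>Test ideals when Frobenius is flat\<close>

context flat_frobenius
begin

lemma C_ideal_ipow_ideal: "ideal I R \<Longrightarrow> ideal (C_ideal e (ipow I n)) R"
  by (rule C_ideal_ideal[OF ideal_subset[OF ipow_ideal]])

text \<open>If \<open>1 = \<Sum> \<phi>\<^sub>i(g\<^sub>i)\<close> with Cartier maps of level 1, then \<open>k = \<Sum> \<phi>\<^sub>i(k\<^sup>p g\<^sub>i)\<close>.\<close>

lemma C_ideal_ipow_lift:
  assumes I: "ideal I R" and "n \<le> m * p"
  shows "C_ideal e (ipow I m) \<subseteq> C_ideal (Suc e) (ipow I n)"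
proof -
  have In: "ideal (ipow I k) R" for k by (rule ipow_ideal[OF I])
  have "ipow I m \<subseteq> C_ideal 1 (ipow I n)"
  proof
    fix k assume k: "k \<in> ipow I m"
    then have kc: "k \<in> carrier R" using ideal_carrier[OF In] by simp
    have "k [^] p \<in> ipow I n"
      using pow_mem_ipow[OF I k, of p] ipow_antimono[OF I assms(2)] by blast
    then have "k \<otimes> \<one> \<in> C_ideal 1 (ipow I n)"
      using ideal_mult'[OF In] C_ideal_carrier[of 1]
      by (intro C_ideal_mult_mem[OF In subset_refl kc]) auto
    then show "k \<in> C_ideal 1 (ipow I n)" using kc by simp
  qed
  then have "C_ideal e (ipow I m) \<subseteq> C_ideal e (C_ideal 1 (ipow I n))"
    using ideal_subset[OF C_ideal_ipow_ideal[OF I]] by (rule C_ideal_mono)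
  then show ?thesis using C_ideal_comp[OF In, of e 1 n] by simp
qed

lemma test_term_increasing:
  assumes I: "ideal I R"
  shows "test_term I e c \<subseteq> test_term I (Suc e) c"
  using test_exponent_lift by (rule C_ideal_ipow_lift[OF I])

lemma test_ideal_eventually:
  assumes I: "ideal I R"
  shows "\<exists>E. \<forall>e\<ge>E. test_ideal p R I c = test_term I e c"
proof -
  obtain E where E: "\<And>e. e \<ge> E \<Longrightarrow> test_term I e c = test_term I E c"
    using ascending_chain_stabilises[of "\<lambda>e. test_term I e c", OF C_ideal_ipow_ideal[OF I]
        test_term_increasing[OF I]] by blast
  have "test_term I e c \<subseteq> test_term I E c" for e
  proof (cases "e \<ge> E")
    case True
    then show ?thesis by (intro equalityD1[OF E])
  next
    case False
    then show ?thesis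
      using lift_Suc_mono_le[of "\<lambda>e. test_term I e c", OF test_term_increasing[OF I], of e E] by simp
  qed
  then have "test_ideal p R I c = test_term I E c" unfolding test_ideal_def by blast
  then show ?thesis using E by metis
qed

lemma test_ideal_ideal: "ideal I R \<Longrightarrow> ideal (test_ideal p R I c) R"
  using test_ideal_eventually[of I c] C_ideal_ipow_ideal[of I] by (metis order_refl)

lemma C_ideal_subset_test_ideal:
  assumes I: "ideal I R" and "real (p ^ e) * c \<le> real m"
  shows "C_ideal e (ipow I m) \<subseteq> test_ideal p R I c"
proof -
  have "nat \<lceil>real (p ^ e) * c\<rceil> \<le> m" using assms(2) by (simp add: nat_le_iff ceiling_le_iff)
  then have "C_ideal e (ipow I m) \<subseteq> test_term I e c" by (rule C_ideal_ipow_mono[OF I])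
  then show ?thesis unfolding test_ideal_def by blast
qed

text \<open>Together with \<open>C_ideal_subset_test_ideal\<close> this traps \<open>C e (I\<^sup>m)\<close> between test ideals whose
  exponents differ by \<open>r / p\<^sup>e\<close>: raising the level by \<open>E\<close>, Skoda's theorem extracts the factor
  \<open>I\<^sup>m\<close> from \<open>C E\<close> of the power of \<open>I\<close> with exponent \<open>(m + r) p\<^sup>E\<close>.\<close>

lemma test_ideal_subset_C_ideal:
  assumes U: "finite U" "U \<subseteq> carrier R" "card U \<le> r" "I = Idl U"
    and m: "real (p ^ e) * c \<ge> real (m + r)"
  shows "test_ideal p R I c \<subseteq> C_ideal e (ipow I m)"
proof -
  have I: "ideal I R" unfolding U(4) using U(2) by (rule genideal_ideal)
  have In: "ideal (ipow I k) R" for k by (rule ipow_ideal[OF I])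
  have CI: "ideal (C_ideal e (ipow I k)) R" for e k by (rule C_ideal_ipow_ideal[OF I])
  obtain E where E: "\<And>e'. e' \<ge> E \<Longrightarrow> test_ideal p R I c = test_term I e' c"
    using test_ideal_eventually[OF I] by blast
  let ?Q = "p ^ E"
  have Q: "?Q > 0" using p_pos by simp
  have "real ((r + m) * ?Q) = real ?Q * real (m + r)" by (simp add: algebra_simps)
  also have "\<dots> \<le> real ?Q * (real (p ^ e) * c)" using m by (intro mult_left_mono) auto
  also have "\<dots> = real (p ^ (e + E)) * c" by (simp add: power_add)
  finally have "(r + m) * ?Q \<le> nat \<lceil>real (p ^ (e + E)) * c\<rceil>"
    by (metis le_nat_iff le_of_int_ceiling of_nat_le_iff of_nat_nat of_int_of_nat_eq order_trans
        real_nat_ceiling_ge)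
  then have "test_term I (e + E) c \<subseteq> C_ideal (e + E) (ipow I ((r + m) * ?Q))"
    by (rule C_ideal_ipow_mono[OF I])
  also have "\<dots> = C_ideal e (C_ideal E (ipow I (r * ?Q + m * ?Q)))"
    using C_ideal_comp[OF In, of e E] by (simp add: add_mult_distrib)
  also have "C_ideal E (ipow I (r * ?Q + m * ?Q)) = ipow I m \<cdot> C_ideal E (ipow I (r * ?Q))"
  proof (rule C_ideal_skoda_iterated[OF U])
    have "r * (?Q - 1) \<le> r * ?Q" by simp
    then show "r * ?Q + ?Q > r * (?Q - 1)" using Q by linarith
  qed
  also have "C_ideal e (ipow I m \<cdot> C_ideal E (ipow I (r * ?Q))) \<subseteq> C_ideal e (ipow I m)"
    using ideal_prod_inter[OF In CI] by (intro C_ideal_mono ideal_subset[OF In]) auto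
  finally show ?thesis using E[of "e + E"] by simp
qed

lemma C_ideal_test_ideal:
  assumes I: "ideal I R"
  shows "C_ideal 1 (test_ideal p R I (real p * c)) = test_ideal p R I c"
proof -
  obtain E where E: "\<And>e. e \<ge> E \<Longrightarrow> test_ideal p R I (real p * c) = test_term I e (real p * c)"
    using test_ideal_eventually[OF I] by blast
  obtain E' where E': "\<And>e. e \<ge> E' \<Longrightarrow> test_ideal p R I c = test_term I e c"
    using test_ideal_eventually[OF I] by blast
  let ?e = "max E E'"
  have "C_ideal 1 (test_term I ?e (real p * c)) = C_ideal (1 + ?e) (ipow I (nat \<lceil>real (p ^ ?e) * (real p * c)\<rceil>))"
    by (rule C_ideal_comp[OF ipow_ideal[OF I]])
  also have "\<dots> = test_term I (Suc ?e) c" by (simp add: algebra_simps)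
  finally show ?thesis using E[of ?e] E'[of "Suc ?e"] by simp
qed

lemma test_ideal_skoda:
  assumes U: "finite U" "U \<subseteq> carrier R" "card U \<le> r" "I = Idl U" and r: "r \<ge> 1" "c \<ge> real r"
  shows "test_ideal p R I c = I \<cdot> test_ideal p R I (c - 1)"
proof -
  have I: "ideal I R" unfolding U(4) using U(2) by (rule genideal_ideal)
  obtain E where E: "\<And>e. e \<ge> E \<Longrightarrow> test_ideal p R I c = test_term I e c"
    using test_ideal_eventually[OF I] by blast
  obtain E' where E': "\<And>e. e \<ge> E' \<Longrightarrow> test_ideal p R I (c - 1) = test_term I e (c - 1)"
    using test_ideal_eventually[OF I] by blast
  let ?e = "max E E'"
  let ?Q = "p ^ ?e"
  have Q: "?Q > 0" using p_pos by simp
  define n where "n = nat \<lceil>real ?Q * (c - 1)\<rceil>"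
  have "real ?Q * (c - 1) \<ge> 0" using r by simp
  then have "\<lceil>real ?Q * (c - 1)\<rceil> \<ge> 0" by linarith
  moreover have "\<lceil>real ?Q * c\<rceil> = \<lceil>real ?Q * (c - 1)\<rceil> + int ?Q"
    using ceiling_add_of_int[of "real ?Q * (c - 1)" "int ?Q"] by (simp add: algebra_simps)
  ultimately have n: "nat \<lceil>real ?Q * c\<rceil> = n + ?Q" unfolding n_def
    by (metis nat_add_distrib nat_int of_nat_0_le_iff)
  have "real (r * ?Q) = real ?Q * real r" by simp
  also have "\<dots> \<le> real ?Q * c" using r(2) by (intro mult_left_mono) auto
  also have "\<dots> \<le> real (n + ?Q)" unfolding n[symmetric] by (rule real_nat_ceiling_ge)
  finally have "r * ?Q \<le> n + ?Q" by linarith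
  moreover have "r * (?Q - 1) < r * ?Q" using r Q by simp
  ultimately have "n + ?Q > r * (?Q - 1)" by linarith
  then have "C_ideal ?e (ipow I (n + ?Q)) = I \<cdot> C_ideal ?e (ipow I n)"
    by (rule C_ideal_skoda[OF U])
  then show ?thesis using E[of ?e] E'[of ?e] n unfolding n_def by simp
qed

lemma F_jumpingD:
  assumes "c \<in> F_jumping_numbers p R I" "\<epsilon> > 0" "c - \<epsilon> > 0"
  shows "test_ideal p R I c \<noteq> test_ideal p R I (c - \<epsilon>)"
  using assms unfolding F_jumping_numbers_def by blast

text \<open>Applying Cartier maps of level 1 divides exponents by \<open>p\<close>.\<close>

lemma F_jumping_times_p:
  assumes I: "ideal I R" and c: "c \<in> F_jumping_numbers p R I"
  shows "real p * c \<in> F_jumping_numbers p R I"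
proof -
  have c0: "c > 0" using c by (simp add: F_jumping_numbers_def)
  have "test_ideal p R I (real p * c) \<noteq> test_ideal p R I (real p * c - \<epsilon>)"
    if \<epsilon>: "\<epsilon> > 0" "real p * c - \<epsilon> > 0" for \<epsilon>
  proof
    assume eq: "test_ideal p R I (real p * c) = test_ideal p R I (real p * c - \<epsilon>)"
    have "real p * (c - \<epsilon> / real p) = real p * c - \<epsilon>" using p_pos by (simp add: algebra_simps)
    then have "test_ideal p R I c = test_ideal p R I (c - \<epsilon> / real p)"
      using C_ideal_test_ideal[OF I, of c] C_ideal_test_ideal[OF I, of "c - \<epsilon> / real p"] eq by simp
    moreover have "\<epsilon> / real p > 0" "c - \<epsilon> / real p > 0"
      using \<epsilon> p_pos by (auto simp: field_simps)
    ultimately show False using F_jumpingD[OF c] by blast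
  qed
  then show ?thesis using c0 p_pos by (simp add: F_jumping_numbers_def)
qed

text \<open>Above \<open>r\<close>, the test ideal of exponent \<open>c\<close> is \<open>I\<close> times that of exponent \<open>c - 1\<close>. The number
  \<open>\<delta>\<close> keeps the second exponent above \<open>r\<close>, too.\<close>

lemma F_jumping_minus_1:
  assumes U: "finite U" "U \<subseteq> carrier R" "card U \<le> r" "I = Idl U" and r: "r \<ge> 1"
    and c: "c \<in> F_jumping_numbers p R I" "c > real r"
  shows "c - 1 \<in> F_jumping_numbers p R I"
proof -
  have I: "ideal I R" unfolding U(4) using U(2) by (rule genideal_ideal)
  have "test_ideal p R I (c - 1) \<noteq> test_ideal p R I (c - 1 - \<epsilon>)"
    if \<epsilon>: "\<epsilon> > 0" "c - 1 - \<epsilon> > 0" for \<epsilon>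
  proof
    assume eq: "test_ideal p R I (c - 1) = test_ideal p R I (c - 1 - \<epsilon>)"
    define \<delta> where "\<delta> = min \<epsilon> (c - real r)"
    have \<delta>: "\<delta> > 0" "\<delta> \<le> \<epsilon>" "c - \<delta> \<ge> real r" using \<epsilon> c(2) by (auto simp: \<delta>_def)
    have "test_ideal p R I (c - 1) = test_ideal p R I (c - \<delta> - 1)"
      using test_ideal_antimono[OF I, of "c - \<delta> - 1" "c - 1"]
        test_ideal_antimono[OF I, of "c - 1 - \<epsilon>" "c - \<delta> - 1"] eq \<delta> by auto
    then have "test_ideal p R I c = test_ideal p R I (c - \<delta>)"
      using test_ideal_skoda[OF U r, of c] test_ideal_skoda[OF U r, of "c - \<delta>"] \<delta> c(2) by simp
    moreover have "c - \<delta> > 0" using \<delta>(3) r by simp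
    ultimately show False using F_jumpingD[OF c(1) \<delta>(1)] by blast
  qed
  then show ?thesis using r c(2) by (simp add: F_jumping_numbers_def)
qed

text \<open>A maximal member of the test ideals with exponents above \<open>c\<close> is attained at some \<open>d0\<close>, and they
  are constant on \<open>(c, d0]\<close>.\<close>

lemma F_jumping_right_gap:
  assumes I: "ideal I R" and c: "c \<ge> 0"
  shows "\<exists>\<epsilon>>0. \<forall>d\<in>F_jumping_numbers p R I. \<not> (c < d \<and> d < c + \<epsilon>)"
proof -
  let ?T = "test_ideal p R I ` {c<..}"
  have "?T \<subseteq> {J. ideal J R}" "?T \<noteq> {}" using test_ideal_ideal[OF I] by auto
  then obtain M where M: "M \<in> ?T" "\<forall>N\<in>?T. M \<subseteq> N \<longrightarrow> N = M"
    by (rule exists_maximal_ideal[THEN bexE])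
  then obtain d0 where d0: "d0 > c" "M = test_ideal p R I d0" by auto
  have const: "test_ideal p R I d = M" if "c < d" "d \<le> d0" for d
    using M(2) that test_ideal_antimono[OF I that(2)] d0(2) by auto
  have False if d: "d \<in> F_jumping_numbers p R I" "c < d" "d < d0" for d
  proof -
    define \<epsilon> where "\<epsilon> = (d - c) / 2"
    have "\<epsilon> > 0" "c < d - \<epsilon>" "d - \<epsilon> \<le> d0" using d by (auto simp: \<epsilon>_def field_simps)
    then show False
      using d const[of d] const[of "d - \<epsilon>"] c by (auto simp: F_jumping_numbers_def)
  qed
  then show ?thesis using d0(1) by (intro exI[of _ "d0 - c"]) auto
qed

text \<open>Let \<open>q = p\<^sup>k\<close>. The ideals \<open>K n\<close> of level \<open>k n\<close> formed from the power of \<open>I\<close> with exponent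
  \<open>m n = a (1 + q + \<dots> + q\<^sup>n\<^sup>-\<^sup>1) = c (q\<^sup>n - 1)\<close> arise by iterating \<open>L \<mapsto> C k (I\<^sup>a L)\<close>, by Skoda's theorem
  and \<open>c > r\<close>; so they stabilise. The test ideals just below \<open>c\<close> are trapped between the \<open>K n\<close>:
  that of exponent \<open>c - c / q\<^sup>n\<close> contains \<open>K n\<close>, that of exponent \<open>c - (c - r) / q\<^sup>n\<close> is contained
  in it.\<close>

lemma F_jumping_left_gap:
  assumes U: "finite U" "U \<subseteq> carrier R" "card U \<le> r" "I = Idl U" and r: "r \<ge> 1"
    and k: "k > 0" and c: "c * (real (p ^ k) - 1) = real a" "c > real r"
  shows "\<exists>\<epsilon>>0. \<forall>d\<in>F_jumping_numbers p R I. \<not> (c - \<epsilon> < d \<and> d < c)"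
proof -
  have I: "ideal I R" unfolding U(4) using U(2) by (rule genideal_ideal)
  have In: "ideal (ipow I n) R" for n by (rule ipow_ideal[OF I])
  have CI: "ideal (C_ideal e (ipow I n)) R" for e n by (rule C_ideal_ipow_ideal[OF I])
  define q where "q = p ^ k"
  have q: "q \<ge> 2"
    using self_le_power[of p k] k p_gt_1 unfolding q_def by simp
  define m where "m n = a * (\<Sum>i<n. q ^ i)" for n
  have m_Suc: "m (Suc n) = m n + a * q ^ n" for n by (simp add: m_def algebra_simps)
  have m_real: "real (m n) = c * (real q ^ n - 1)" for n
  proof (induct n)
    case 0
    then show ?case by (simp add: m_def)
  next
    case (Suc n)
    have "real a = c * (real q - 1)" using c(1) by (simp add: q_def)
    then have "real (m (Suc n)) = c * (real q ^ n - 1) + c * (real q - 1) * real q ^ n"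
      using Suc by (simp add: m_Suc)
    then show ?case by (simp add: algebra_simps)
  qed
  define K where "K n = C_ideal (k * n) (ipow I (m n))" for n
  define \<Phi> where "\<Phi> L = C_ideal k (ipow I a \<cdot> L)" for L
  have Ia: "ideal (ipow I a \<cdot> L) R" if "ideal L R" for L
    by (intro ideal_prod_is_ideal In that)
  have "\<exists>N. \<forall>n\<ge>N. K n = K N"
  proof (rule inverse_linear_chain_stabilises[where \<Phi> = \<Phi> and q = q])
    show "ideal (\<Phi> L) R" if "ideal L R" for L
      unfolding \<Phi>_def by (rule C_ideal_ideal[OF ideal_subset[OF Ia[OF that]]])
    show "\<Phi> L \<subseteq> \<Phi> L'" if "ideal L R" "ideal L' R" "L \<subseteq> L'" for L L'
      unfolding \<Phi>_def using ideal_prod_mono[OF subset_refl that(3)] ideal_subset[OF Ia[OF that(2)]]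
      by (rule C_ideal_mono)
    show "x \<otimes> y \<in> \<Phi> L'" if h: "x \<in> carrier R" "ideal L R" "ideal L' R"
      "\<And>g. g \<in> L \<Longrightarrow> x [^] q \<otimes> g \<in> L'" "y \<in> \<Phi> L" for x L L' y
      unfolding \<Phi>_def
    proof (rule C_ideal_mult_mem[OF Ia[OF h(3)] ideal_subset[OF Ia[OF h(2)]] h(1)])
      show "y \<in> C_ideal k (ipow I a \<cdot> L)" using h(5) unfolding \<Phi>_def .
      have xq: "x [^] q \<in> carrier R" using h(1) by simp
      have "ipow I a \<cdot> L \<subseteq> colon (ipow I a \<cdot> L') (x [^] q)"
      proof (rule ideal_prod_subset[OF colon_ideal[OF Ia[OF h(3)] xq]])
        fix i g assume i: "i \<in> ipow I a" and g: "g \<in> L"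
        have ig: "i \<in> carrier R" "g \<in> carrier R"
          using ideal_carrier[OF In i] ideal_carrier[OF h(2) g] by auto
        have "i \<otimes> (x [^] q \<otimes> g) \<in> ipow I a \<cdot> L'" using i h(4)[OF g] by (rule ideal_prod.prod)
        then show "i \<otimes> g \<in> colon (ipow I a \<cdot> L') (x [^] q)"
          using ig xq by (simp add: colon_def m_lcomm)
      qed
      then show "x [^] (p ^ k) \<otimes> g \<in> ipow I a \<cdot> L'" if "g \<in> ipow I a \<cdot> L" for g
        using that unfolding q_def by (auto simp: colon_def)
    qed
    show "q \<ge> 2" by (rule q)
    show "ideal (K 0) R" unfolding K_def by (rule CI)
    have "K 0 = carrier R" unfolding K_def m_def using C_ideal_carrier[of 0] by simp
    then show "K 1 \<subseteq> K 0" unfolding K_def using ideal_subset[OF CI] by simp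
    show "K (Suc n) = \<Phi> (K n)" for n
    proof -
      have pq: "p ^ (k * n) = q ^ n" by (simp add: q_def power_mult)
      have "real r * (real q ^ n - 1) \<le> c * (real q ^ n - 1)"
        using c(2) q by (intro mult_right_mono) auto
      then have "real (r * (q ^ n - 1)) \<le> real (m n)"
        unfolding m_real using q by (simp add: of_nat_diff)
      then have "r * (q ^ n - 1) \<le> m n" by linarith
      moreover have "q ^ n > 0" using q by simp
      ultimately have "m n + p ^ (k * n) > r * (p ^ (k * n) - 1)" unfolding pq by linarith
      then have "C_ideal (k * n) (ipow I (m n + a * p ^ (k * n))) = ipow I a \<cdot> K n"
        unfolding K_def by (rule C_ideal_skoda_iterated[OF U])
      then have "\<Phi> (K n) = C_ideal k (C_ideal (k * n) (ipow I (m (Suc n))))"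
        unfolding \<Phi>_def m_Suc pq by simp
      also have "\<dots> = K (Suc n)"
        unfolding K_def using C_ideal_comp[OF In, of k "k * n"] by simp
      finally show ?thesis by simp
    qed
  qed
  then obtain N where N: "\<And>n. n \<ge> N \<Longrightarrow> K n = K N" by blast
  define \<delta> where "\<delta> = (c - real r) / real q ^ N"
  have qN: "real q ^ n > 0" for n using q by simp
  have \<delta>: "\<delta> > 0" "c - \<delta> > 0"
  proof -
    show "\<delta> > 0" unfolding \<delta>_def using c(2) qN by simp
    have "\<delta> \<le> c - real r"
      unfolding \<delta>_def using c(2) q by (simp add: divide_le_eq mult_le_cancel_left1)
    then show "c - \<delta> > 0" using r by simp
  qed
  have upper: "test_ideal p R I (c - \<delta>) \<subseteq> K N"
    unfolding K_def
  proof (rule test_ideal_subset_C_ideal[OF U])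
    have "real q ^ N * \<delta> = c - real r" unfolding \<delta>_def using qN[of N] by simp
    then have "real q ^ N * (c - \<delta>) = real (m N) + real r"
      unfolding m_real by (simp add: algebra_simps)
    then show "real (m N + r) \<le> real (p ^ (k * N)) * (c - \<delta>)"
      by (simp add: q_def power_mult)
  qed
  have lower: "K N \<subseteq> test_ideal p R I d" if d: "d < c" for d
  proof -
    have "\<exists>n. c / (c - d) < real q ^ n" using q by (intro real_arch_pow) simp
    then obtain n0 where n0: "c / (c - d) < real q ^ n0" by blast
    define n where "n = max N n0"
    have "real q ^ n0 \<le> real q ^ n" using q by (intro power_increasing) (auto simp: n_def)
    then have "c / (c - d) \<le> real q ^ n" using n0 by linarith
    then have "c \<le> real q ^ n * (c - d)" using d by (simp add: pos_divide_le_eq)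
    then have "real (p ^ (k * n)) * d \<le> real (m n)"
      unfolding m_real by (simp add: q_def power_mult algebra_simps)
    then have "K n \<subseteq> test_ideal p R I d"
      unfolding K_def by (rule C_ideal_subset_test_ideal[OF I])
    then show ?thesis using N[of n] by (simp add: n_def)
  qed
  have const: "test_ideal p R I d = K N" if "c - \<delta> \<le> d" "d < c" for d
    using lower[OF that(2)] upper test_ideal_antimono[OF I that(1)] by blast
  have False if d: "d \<in> F_jumping_numbers p R I" "c - \<delta> < d" "d < c" for d
  proof -
    have "test_ideal p R I d = test_ideal p R I (d - (d - (c - \<delta>)))"
      using const[of d] const[of "c - \<delta>"] d \<delta> by simp
    moreover have "d - (c - \<delta>) > 0" "d - (d - (c - \<delta>)) > 0" using d \<delta> by auto
    ultimately show False using d(1) unfolding F_jumping_numbers_def by blast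
  qed
  then show ?thesis using \<delta>(1) by blast
qed

end

section \<open>A discreteness criterion for sets of real numbers\<close>

definition left_limit :: "real set \<Rightarrow> real \<Rightarrow> bool" where
  "left_limit J x \<longleftrightarrow> (\<forall>\<epsilon>>0. \<exists>c\<in>J. x - \<epsilon> < c \<and> c < x)"

definition right_gap :: "real set \<Rightarrow> real \<Rightarrow> bool" where
  "right_gap J x \<longleftrightarrow> (\<exists>\<epsilon>>0. \<forall>c\<in>J. \<not> (x < c \<and> c < x + \<epsilon>))"

lemma Inf_mem_if_right_gap:
  assumes "S \<noteq> {}" "bdd_below S" "right_gap S (Inf S)"
  shows "Inf S \<in> S"
proof (rule ccontr)
  assume no: "Inf S \<notin> S"
  obtain \<epsilon> where \<epsilon>: "\<epsilon> > 0" "\<forall>c\<in>S. \<not> (Inf S < c \<and> c < Inf S + \<epsilon>)"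
    using assms(3) by (auto simp: right_gap_def)
  obtain c where c: "c \<in> S" "c < Inf S + \<epsilon>"
    using cInf_lessD[OF assms(1), of "Inf S + \<epsilon>"] \<epsilon>(1) by auto
  have "Inf S \<le> c" using assms(2) c(1) by (rule cInf_lower[rotated])
  then show False using no c \<epsilon>(2) by (cases "c = Inf S") auto
qed

lemma not_islimpt_if_gaps:
  assumes "\<not> left_limit J x" "right_gap J x"
  shows "\<not> x islimpt J"
proof
  assume lim: "x islimpt J"
  obtain \<epsilon> where \<epsilon>: "\<epsilon> > 0" "\<forall>c\<in>J. \<not> (x - \<epsilon> < c \<and> c < x)"
    using assms(1) by (auto simp: left_limit_def)
  obtain \<delta> where \<delta>: "\<delta> > 0" "\<forall>c\<in>J. \<not> (x < c \<and> c < x + \<delta>)"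
    using assms(2) by (auto simp: right_gap_def)
  have "x \<in> {x - \<epsilon><..<x + \<delta>}" using \<epsilon>(1) \<delta>(1) by simp
  then obtain c where "c \<in> J" "c \<in> {x - \<epsilon><..<x + \<delta>}" "c \<noteq> x"
    using lim unfolding islimpt_def by (meson open_greaterThanLessThan)
  then show False using \<epsilon>(2) \<delta>(2) by (cases "c < x") auto
qed

text \<open>Multiplication by \<open>p\<close>, normalised to the half-open interval \<open>(r, r + 1]\<close> so as to be
  continuous from the left.\<close>

definition shift_map :: "nat \<Rightarrow> nat \<Rightarrow> real \<Rightarrow> real" where
  "shift_map p r x = real p * x - of_int (\<lceil>real p * x\<rceil> - int r - 1)"

lemma shift_map_range: "real r < shift_map p r x" "shift_map p r x \<le> real r + 1"
  unfolding shift_map_def by linarith+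

lemma shift_map_power: "\<exists>k::int. (shift_map p r ^^ n) x = real p ^ n * x - of_int k"
proof (induct n)
  case 0
  then show ?case by (intro exI[of _ 0]) simp
next
  case (Suc n)
  then obtain k where k: "(shift_map p r ^^ n) x = real p ^ n * x - of_int k" by blast
  let ?y = "real p ^ n * x - of_int k"
  have "(shift_map p r ^^ Suc n) x
    = real p ^ Suc n * x - of_int (int p * k + (\<lceil>real p * ?y\<rceil> - int r - 1))"
    unfolding funpow.simps o_apply k shift_map_def by (simp add: algebra_simps)
  then show ?case by blast
qed

lemma shift_map_left_continuous:
  assumes p: "p \<ge> 1" and \<epsilon>: "\<epsilon> > 0"
  shows "\<exists>\<delta>>0. \<forall>z. x - \<delta> < z \<and> z \<le> x \<longrightarrow>
    shift_map p r x - \<epsilon> < shift_map p r z \<and> shift_map p r z \<le> shift_map p r x"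
proof -
  let ?y = "real p * x"
  define \<delta> where "\<delta> = min \<epsilon> (?y - of_int (\<lceil>?y\<rceil> - 1)) / real p"
  have pos: "real p > 0" using p by simp
  have "?y - of_int (\<lceil>?y\<rceil> - 1) > 0" by linarith
  then have \<delta>: "\<delta> > 0" unfolding \<delta>_def using \<epsilon> pos by simp
  have "shift_map p r x - \<epsilon> < shift_map p r z \<and> shift_map p r z \<le> shift_map p r x"
    if z: "x - \<delta> < z" "z \<le> x" for z
  proof -
    have "real p * z \<le> ?y" using z(2) pos by simp
    moreover have "x - z < \<delta>" using z by simp
    then have "(x - z) * real p < \<delta> * real p" using pos by (rule mult_strict_right_mono)
    then have "?y - real p * z < min \<epsilon> (?y - of_int (\<lceil>?y\<rceil> - 1))"
      unfolding \<delta>_def using pos by (simp add: algebra_simps)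
    ultimately have *: "real p * z \<le> ?y" "?y - \<epsilon> < real p * z" "of_int (\<lceil>?y\<rceil> - 1) < real p * z"
      by auto
    have "\<lceil>real p * z\<rceil> = \<lceil>?y\<rceil>" using *(1,3) by (intro ceiling_unique) linarith+
    then show ?thesis using * unfolding shift_map_def by simp
  qed
  then show ?thesis using \<delta> by blast
qed

lemma shift_map_power_left_continuous:
  assumes p: "p \<ge> 1"
  shows "\<epsilon> > 0 \<Longrightarrow> \<exists>\<delta>>0. \<forall>z. x - \<delta> < z \<and> z \<le> x \<longrightarrow>
    (shift_map p r ^^ n) x - \<epsilon> < (shift_map p r ^^ n) z \<and> (shift_map p r ^^ n) z \<le> (shift_map p r ^^ n) x"
proof (induct n arbitrary: \<epsilon>)
  case 0
  then show ?case by auto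
next
  case (Suc n)
  obtain \<delta>1 where 1: "\<delta>1 > 0" "\<And>z. (shift_map p r ^^ n) x - \<delta>1 < z \<and> z \<le> (shift_map p r ^^ n) x \<Longrightarrow>
    shift_map p r ((shift_map p r ^^ n) x) - \<epsilon> < shift_map p r z
      \<and> shift_map p r z \<le> shift_map p r ((shift_map p r ^^ n) x)"
    using shift_map_left_continuous[OF p Suc(2)] by blast
  obtain \<delta>2 where "\<delta>2 > 0" "\<And>z. x - \<delta>2 < z \<and> z \<le> x \<Longrightarrow>
    (shift_map p r ^^ n) x - \<delta>1 < (shift_map p r ^^ n) z \<and> (shift_map p r ^^ n) z \<le> (shift_map p r ^^ n) x"
    using Suc(1)[OF 1(1)] by blast
  then show ?case using 1(2) by (intro exI[of _ \<delta>2]) simp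
qed

lemma shift_map_periodic:
  assumes p: "p \<ge> 2" and n: "n > 0" and x: "x > 0" and per: "(shift_map p r ^^ n) x = x"
  shows "\<exists>a::nat. x * (real (p ^ n) - 1) = real a"
proof -
  obtain k :: int where k: "(shift_map p r ^^ n) x = real p ^ n * x - of_int k"
    using shift_map_power by blast
  then have eq: "x * (real (p ^ n) - 1) = of_int k" using per by (simp add: algebra_simps)
  have "p ^ n \<ge> 1" using p by simp
  then have "x * (real (p ^ n) - 1) \<ge> 0" using x by (simp del: of_nat_power)
  then have "k \<ge> 0" using eq by (metis of_int_0_le_iff)
  then have "of_int k = real (nat k)" by simp
  then show ?thesis using eq by metis
qed

text \<open>The properties of the set of F-jumping numbers of an ideal with \<open>r\<close> generators from which
  discreteness and rationality follow. The numbers in \<open>left\<close> are the periodic points of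
  multiplication by \<open>p\<close> modulo 1.\<close>

locale jump_set =
  fixes J :: "real set" and p r :: nat
  assumes p: "p \<ge> 2" and r: "r \<ge> 1"
    and pos: "\<And>c. c \<in> J \<Longrightarrow> c > 0"
    and times_p: "\<And>c. c \<in> J \<Longrightarrow> real p * c \<in> J"
    and minus_1: "\<And>c. c \<in> J \<Longrightarrow> c > real r \<Longrightarrow> c - 1 \<in> J"
    and right: "\<And>x. x \<ge> 0 \<Longrightarrow> right_gap J x"
    and left: "\<And>x n a. n > 0 \<Longrightarrow> x * (real (p ^ n) - 1) = real a \<Longrightarrow> x > real r \<Longrightarrow> \<not> left_limit J x"
begin

abbreviation T :: "real \<Rightarrow> real" where "T \<equiv> shift_map p r"

lemma minus_nat: "c \<in> J \<Longrightarrow> c - real n > real r \<Longrightarrow> c - real n \<in> J"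
proof (induct n)
  case (Suc n)
  then have "c - real n \<in> J" "c - real n > real r" by simp_all
  then have "c - real n - 1 \<in> J" by (rule minus_1)
  then show ?case by (simp add: algebra_simps)
qed simp

lemma times_p_power: "c \<in> J \<Longrightarrow> real p ^ n * c \<in> J"
  by (induct n) (auto simp: times_p mult.assoc)

lemma shift_nat:
  assumes "x > real r"
  obtains n :: nat where "shift_map p r x = real p * x - real n"
proof -
  have "2 * x \<le> real p * x" using assms p by (intro mult_right_mono) auto
  then have "real p * x > real r + 1" using assms r by linarith
  then have "\<lceil>real p * x\<rceil> - int r - 1 \<ge> 0" by linarith
  then show thesis using that[of "nat (\<lceil>real p * x\<rceil> - int r - 1)"] unfolding shift_map_def by simp
qed

lemma T_mem: "c \<in> J \<Longrightarrow> c > real r \<Longrightarrow> T c \<in> J"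
  using shift_nat[of c] times_p[of c] minus_nat[of "real p * c"] shift_map_range(1)[of r p c] by metis

lemma left_limit_times_p:
  assumes "left_limit J x"
  shows "left_limit J (real p * x)"
  unfolding left_limit_def
proof (intro allI impI)
  fix \<epsilon> :: real assume "\<epsilon> > 0"
  then have "\<epsilon> / real p > 0" using p by simp
  then obtain c where c: "c \<in> J" "x - \<epsilon> / real p < c" "c < x"
    using assms unfolding left_limit_def by blast
  have "real p * (x - \<epsilon> / real p) < real p * c" "real p * c < real p * x"
    using c p by (auto intro: mult_strict_left_mono)
  then show "\<exists>c\<in>J. real p * x - \<epsilon> < c \<and> c < real p * x"
    using times_p[OF c(1)] p by (intro bexI[of _ "real p * c"]) (auto simp: algebra_simps)
qed

lemma left_limit_minus:
  assumes "left_limit J x" "x - real n > real r"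
  shows "left_limit J (x - real n)"
  unfolding left_limit_def
proof (intro allI impI)
  fix \<epsilon> :: real assume "\<epsilon> > 0"
  then have "min \<epsilon> (x - real n - real r) > 0" using assms(2) by simp
  then obtain c where c: "c \<in> J" "x - min \<epsilon> (x - real n - real r) < c" "c < x"
    using assms(1) unfolding left_limit_def by blast
  then have "c - real n > real r" by simp
  from minus_nat[OF c(1) this] show "\<exists>c\<in>J. x - real n - \<epsilon> < c \<and> c < x - real n"
    using c by (intro bexI[of _ "c - real n"]) auto
qed

definition limits :: "real set" where
  "limits = {x. real r < x \<and> x \<le> real r + 1 \<and> left_limit J x}"

lemma T_limits:
  assumes "x \<in> limits"
  shows "T x \<in> limits"
proof -
  have x: "real r < x" "left_limit J x" using assms by (auto simp: limits_def)
  obtain n where n: "T x = real p * x - real n" using shift_nat[OF x(1)] .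
  have T: "real r < T x" "T x \<le> real r + 1" by (rule shift_map_range)+
  then have "left_limit J (T x)"
    using left_limit_minus[OF left_limit_times_p[OF x(2)], of n] unfolding n by simp
  then show ?thesis using T by (simp add: limits_def)
qed

lemma T_power_limits: "x \<in> limits \<Longrightarrow> (T ^^ n) x \<in> limits"
  by (induct n) (auto intro: T_limits)

text \<open>A left limit point in a gap of \<open>J\<close> would be approached by elements of \<open>J\<close> in that gap.\<close>

lemma right_gap_limits:
  assumes "x \<ge> 0" "S \<subseteq> limits"
  shows "right_gap S x"
proof -
  obtain \<epsilon> where \<epsilon>: "\<epsilon> > 0" "\<forall>c\<in>J. \<not> (x < c \<and> c < x + \<epsilon>)"
    using right[OF assms(1)] by (auto simp: right_gap_def)
  have False if y: "y \<in> S" "x < y" "y < x + \<epsilon>" for y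
  proof -
    have "left_limit J y" using y(1) assms(2) by (auto simp: limits_def)
    then obtain c where "c \<in> J" "y - (y - x) < c" "c < y"
      using y(2) unfolding left_limit_def by (metis diff_gt_0_iff_gt)
    then show False using \<epsilon>(2) y by force
  qed
  then show ?thesis unfolding right_gap_def using \<epsilon>(1) by blast
qed

lemma orbit_minimum:
  assumes x: "x \<in> limits"
  shows "\<exists>k. \<forall>n. (T ^^ k) x \<le> (T ^^ n) x"
proof -
  let ?S = "range (\<lambda>n. (T ^^ n) x)"
  have sub: "?S \<subseteq> limits" using T_power_limits[OF x] by auto
  have low: "real r \<le> y" if "y \<in> ?S" for y using subsetD[OF sub that] by (simp add: limits_def)
  then have bdd: "bdd_below ?S" by (rule bdd_belowI)
  have "real r \<le> Inf ?S" using low by (intro cInf_greatest) auto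
  then have "Inf ?S \<in> ?S" using bdd sub by (intro Inf_mem_if_right_gap right_gap_limits) auto
  then obtain k where k: "Inf ?S = (T ^^ k) x" by (rule rangeE)
  have "(T ^^ k) x \<le> (T ^^ n) x" for n
    unfolding k[symmetric] using bdd by (intro cInf_lower) auto
  then show ?thesis by blast
qed

text \<open>Left limits admit no decreasing sequences, so every orbit has a minimum, which is a point
  that is minimal in its own orbit. The supremum \<open>s\<close> of all such points is one of them, because
  \<open>T\<close> is continuous from the left. The minimum of the orbit of \<open>T s\<close> is another, and can neither
  be smaller nor larger than \<open>s\<close>. So \<open>s\<close> is periodic, which is excluded.\<close>

lemma limits_empty: "limits = {}"
proof (rule ccontr)
  assume "limits \<noteq> {}"
  define Y where "Y = {x \<in> limits. \<forall>n. x \<le> (T ^^ n) x}"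
  have min_Y: "\<exists>k. (T ^^ k) x \<in> Y" if x: "x \<in> limits" for x
  proof -
    obtain k where k: "\<And>n. (T ^^ k) x \<le> (T ^^ n) x" using orbit_minimum[OF x] by blast
    have "(T ^^ k) x \<le> (T ^^ n) ((T ^^ k) x)" for n
      using k[of "n + k"] by (simp add: funpow_add)
    then show ?thesis using T_power_limits[OF x] unfolding Y_def by blast
  qed
  have Y: "Y \<noteq> {}" "Y \<subseteq> limits" using \<open>limits \<noteq> {}\<close> min_Y by (auto simp: Y_def)
  have bdd: "bdd_above Y" using Y(2) by (intro bdd_aboveI[of _ "real r + 1"]) (auto simp: limits_def)
  define s where "s = Sup Y"
  have le_s: "y \<le> s" if "y \<in> Y" for y unfolding s_def using that bdd by (rule cSup_upper)
  have approx: "\<exists>y\<in>Y. s - \<epsilon> < y" if "\<epsilon> > 0" for \<epsilon>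
    using less_cSupD[OF Y(1), of "s - \<epsilon>"] that unfolding s_def by auto
  obtain y0 where y0: "y0 \<in> Y" using Y(1) by blast
  have s_range: "real r < s" "s \<le> real r + 1"
  proof -
    show "real r < s" using le_s[OF y0] y0 Y(2) by (force simp: limits_def)
    show "s \<le> real r + 1" unfolding s_def using Y by (intro cSup_least) (auto simp: limits_def)
  qed
  have s_lim: "left_limit J s"
    unfolding left_limit_def
  proof (intro allI impI)
    fix \<epsilon> :: real assume \<epsilon>: "\<epsilon> > 0"
    obtain y where y: "y \<in> Y" "s - \<epsilon> < y" using approx[OF \<epsilon>] by blast
    have "left_limit J y" using y(1) Y(2) by (auto simp: limits_def)
    moreover have "y - (s - \<epsilon>) > 0" using y(2) by simp
    ultimately obtain c where "c \<in> J" "y - (y - (s - \<epsilon>)) < c" "c < y"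
      unfolding left_limit_def by blast
    then show "\<exists>c\<in>J. s - \<epsilon> < c \<and> c < s" using le_s[OF y(1)] by (intro bexI[of _ c]) auto
  qed
  have s_mem: "s \<in> limits" using s_range s_lim by (simp add: limits_def)
  have s_le: "s \<le> (T ^^ n) s" for n
  proof (rule ccontr)
    assume "\<not> s \<le> (T ^^ n) s"
    then have lt: "(T ^^ n) s < s" by simp
    obtain \<delta> where \<delta>: "\<delta> > 0" "\<And>z. s - \<delta> < z \<and> z \<le> s \<Longrightarrow> (T ^^ n) z \<le> (T ^^ n) s"
      using shift_map_power_left_continuous[of p 1 s n r] p by auto
    have "min \<delta> (s - (T ^^ n) s) > 0" using \<delta>(1) lt by simp
    then obtain y where y: "y \<in> Y" "s - min \<delta> (s - (T ^^ n) s) < y" using approx by blast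
    then have "(T ^^ n) y \<le> (T ^^ n) s" using \<delta>(2)[of y] le_s[OF y(1)] by simp
    also have "\<dots> < y" using y(2) by simp
    also have "y \<le> (T ^^ n) y" using y(1) by (simp add: Y_def)
    finally show False by simp
  qed
  obtain k where k: "(T ^^ k) (T s) \<in> Y" using min_Y[OF T_limits[OF s_mem]] by blast
  have "(T ^^ Suc k) s = s"
    using le_s[OF k] s_le[of "Suc k"] by (simp add: funpow_swap1)
  then obtain a :: nat where "s * (real (p ^ Suc k) - 1) = real a"
    using shift_map_periodic[of p "Suc k" s r] p s_range(1) by auto
  then show False using left[of "Suc k" s a] s_lim s_range(1) by simp
qed

text \<open>Every positive number is moved into the fundamental interval by the two operations under which
  \<open>J\<close> is stable.\<close>

lemma normalise:
  assumes "x > 0"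
  obtains b n :: nat where "real r < real p ^ b * x - real n" "real p ^ b * x - real n \<le> real r + 1"
proof -
  obtain b where "real r / x < real p ^ b" using real_arch_pow[of "real p" "real r / x"] p by auto
  then have b: "real r < real p ^ b * x" using assms by (simp add: pos_divide_less_eq)
  let ?y = "real p ^ b * x"
  have "\<lceil>?y\<rceil> - int r - 1 \<ge> 0" using b by linarith
  then have "real (nat (\<lceil>?y\<rceil> - int r - 1)) = of_int \<lceil>?y\<rceil> - real r - 1" by simp
  then have "real r < ?y - real (nat (\<lceil>?y\<rceil> - int r - 1))"
    "?y - real (nat (\<lceil>?y\<rceil> - int r - 1)) \<le> real r + 1" by linarith+
  then show thesis by (rule that)
qed

lemma no_left_limit: "\<not> left_limit J x"
proof
  assume lim: "left_limit J x"
  then obtain c where "c \<in> J" "c < x" unfolding left_limit_def by (metis zero_less_one)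
  then have x: "x > 0" using pos by force
  have "left_limit J (real p ^ b * x)" for b
    using lim by (induct b) (auto dest: left_limit_times_p simp: mult.assoc)
  moreover obtain b n where "real r < real p ^ b * x - real n" "real p ^ b * x - real n \<le> real r + 1"
    using normalise[OF x] by blast
  ultimately have "real p ^ b * x - real n \<in> limits"
    using left_limit_minus by (simp add: limits_def)
  then show False using limits_empty by simp
qed

lemma discrete: "\<not> x islimpt J"
proof (rule not_islimpt_if_gaps[OF no_left_limit])
  show "right_gap J x"
  proof (cases "x \<ge> 0")
    case False
    then have "\<forall>c\<in>J. \<not> (x < c \<and> c < x + (- x))" using pos by force
    then show ?thesis unfolding right_gap_def using False by (intro exI[of _ "- x"]) auto
  qed (rule right)
qed

text \<open>The orbit of \<open>z\<close> stays in a finite set and is eventually periodic, so some iterate has the form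
  \<open>a / (p\<^sup>n - 1)\<close>; passing back to \<open>c\<close> only involves rational operations.\<close>

lemma rational: "J \<subseteq> \<rat>"
proof
  fix c assume c: "c \<in> J"
  have c0: "c > 0" using pos[OF c] .
  obtain b n where bn: "real r < real p ^ b * c - real n" "real p ^ b * c - real n \<le> real r + 1"
    using normalise[OF c0] by blast
  define z where "z = real p ^ b * c - real n"
  let ?F = "{real r .. real r + 1} \<inter> J"
  have "finite ?F" using discrete by (intro finite_not_islimpt_in_compact) auto
  have z: "z \<in> J" "real r < z" "z \<le> real r + 1"
    using minus_nat[OF times_p_power[OF c]] bn by (auto simp: z_def)
  have orbit: "(T ^^ i) z \<in> J \<and> real r < (T ^^ i) z \<and> (T ^^ i) z \<le> real r + 1" for i
    by (induct i) (use z T_mem shift_map_range in auto)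
  have "(T ^^ i) z \<in> ?F" for i using orbit[of i] by simp
  then have "range (\<lambda>i. (T ^^ i) z) \<subseteq> ?F" by blast
  then have "finite (range (\<lambda>i. (T ^^ i) z))" using \<open>finite ?F\<close> by (rule finite_subset)
  then have "\<not> inj (\<lambda>i. (T ^^ i) z)" using finite_imageD infinite_UNIV_nat by blast
  then obtain i j where ij: "i < j" "(T ^^ i) z = (T ^^ j) z"
    unfolding inj_def by (metis linorder_neqE_nat)
  define w where "w = (T ^^ i) z"
  have "j = (j - i) + i" using ij(1) by simp
  then have "(T ^^ (j - i)) w = w" unfolding w_def by (metis comp_apply funpow_add ij(2))
  moreover have "w > 0" using orbit[of i] unfolding w_def by simp
  ultimately obtain a :: nat where a: "w * (real (p ^ (j - i)) - 1) = real a"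
    using shift_map_periodic[of p "j - i" w r] p ij(1) by auto
  have "1 < p ^ (j - i)" using p ij(1) by (intro one_less_power) auto
  then have "real 1 < real (p ^ (j - i))" by (simp only: of_nat_less_iff)
  then have "real (p ^ (j - i)) - 1 \<noteq> 0" by simp
  then have "w = real a / (real (p ^ (j - i)) - 1)"
    using a by (metis nonzero_eq_divide_eq)
  then have w_rat: "w \<in> \<rat>" by (auto intro!: Rats_divide Rats_diff simp del: of_nat_power)
  obtain k :: int where "w = real p ^ i * z - of_int k" using shift_map_power unfolding w_def by blast
  then have "z = (w + of_int k) / real p ^ i" using p by simp
  then have z_rat: "z \<in> \<rat>" using w_rat by (auto intro!: Rats_divide Rats_add Rats_power)
  have "c = (z + real n) / real p ^ b" unfolding z_def using p by simp
  then show "c \<in> \<rat>" using z_rat by (auto intro!: Rats_divide Rats_add Rats_power)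
qed

end

lemma discrete_positive_has_minimum:
  assumes "J \<noteq> {}" "\<And>c. c \<in> J \<Longrightarrow> c > (0::real)" "\<And>x. \<not> x islimpt J"
  shows "\<exists>c\<in>J. \<forall>d\<in>J. c \<le> d"
proof -
  obtain c0 where c0: "c0 \<in> J" using assms(1) by blast
  have fin: "finite ({0..c0} \<inter> J)" using assms(3) by (intro finite_not_islimpt_in_compact) auto
  have ne: "c0 \<in> {0..c0} \<inter> J" using c0 assms(2)[OF c0] by simp
  then have m: "Min ({0..c0} \<inter> J) \<in> J" using Min_in[OF fin] by blast
  have "Min ({0..c0} \<inter> J) \<le> d" if d: "d \<in> J" for d
  proof (cases "d \<le> c0")
    case True
    then show ?thesis using fin d assms(2)[OF d] by (intro Min_le) auto
  next
    case False
    then show ?thesis using Min_le[OF fin ne] by simp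
  qed
  then show ?thesis using m by blast
qed

section \<open>Direct summands\<close>

context flat_frobenius
begin

text \<open>The values at 1 of Cartier maps form an ideal, namely \<open>C e R\<close>, which is the unit ideal. Such a
  map splits Frobenius, a property that passes to direct summands.\<close>

lemma exists_cartier_map_onto_one: "\<exists>\<phi>\<in>C_maps e. \<phi> \<one> = \<one>"
proof -
  let ?V = "{\<phi> \<one> |\<phi>. \<phi> \<in> C_maps e}"
  have zero: "(\<lambda>x. \<zero>) \<in> C_maps e" by (rule cartier_mapsI) auto
  have "ideal ?V R"
  proof (rule idealI_mult)
    show "?V \<subseteq> carrier R" using cartier_closed by auto
    show "\<zero> \<in> ?V" using zero by force
    fix x y assume "x \<in> ?V" "y \<in> ?V"
    then obtain \<phi> \<psi> where *: "\<phi> \<in> C_maps e" "x = \<phi> \<one>" "\<psi> \<in> C_maps e" "y = \<psi> \<one>" by blast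
    have "(\<lambda>z. \<phi> z \<oplus> \<psi> z) \<in> C_maps e"
      by (rule cartier_mapsI)
        (use *(1,3) cartier_closed[OF *(1)] cartier_closed[OF *(3)] cartier_plus[OF *(1)]
          cartier_plus[OF *(3)] cartier_frob[OF *(1)] cartier_frob[OF *(3)] in \<open>auto simp: a_ac r_distr\<close>)
    then show "x \<oplus> y \<in> ?V" unfolding *(2,4) by (intro CollectI exI[of _ "\<lambda>z. \<phi> z \<oplus> \<psi> z"]) simp
  next
    fix a x assume a: "a \<in> carrier R" and "x \<in> ?V"
    then obtain \<phi> where \<phi>: "\<phi> \<in> C_maps e" "x = \<phi> \<one>" by blast
    have aq: "a [^] (p ^ e) \<in> carrier R" using a by simp
    have "a \<otimes> x = \<phi> (a [^] (p ^ e) \<otimes> \<one>)" unfolding \<phi>(2) using cartier_frob[OF \<phi>(1) a] by simp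
    then show "a \<otimes> x \<in> ?V"
      using cartier_premult[OF \<phi>(1) aq]
      by (intro CollectI exI[of _ "\<lambda>z. \<phi> (a [^] (p ^ e) \<otimes> z)"]) simp
  qed
  moreover have "\<phi> g \<in> ?V" if "\<phi> \<in> C_maps e" "g \<in> carrier R" for \<phi> g
    using cartier_premult[OF that] that(2) by (intro CollectI exI[of _ "\<lambda>z. \<phi> (g \<otimes> z)"]) simp
  ultimately have "C_ideal e (carrier R) \<subseteq> ?V" by (intro C_ideal_subset) auto
  then have "\<one> \<in> ?V" using C_ideal_carrier by auto
  then obtain \<phi> where \<phi>: "\<phi> \<in> C_maps e" "\<one> = \<phi> \<one>" by blast
  from \<phi>(2)[symmetric] \<phi>(1) show ?thesis by (rule bexI)
qed

end

text \<open>The splitting \<open>\<beta>\<close> exhibits the subring \<open>T\<close> as a direct summand of \<open>S\<close>.\<close>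

locale frobenius_summand = flat_frobenius S p + sub: char_p_cring "S\<lparr>carrier := T\<rparr>" p
  for S :: "('a, 'b) ring_scheme" (structure) and p :: nat and T :: "'a set" +
  fixes \<beta> :: "'a \<Rightarrow> 'a"
  assumes T_subset: "T \<subseteq> carrier S"
    and \<beta>_closed: "x \<in> carrier S \<Longrightarrow> \<beta> x \<in> T"
    and \<beta>_add: "x \<in> carrier S \<Longrightarrow> y \<in> carrier S \<Longrightarrow> \<beta> (x \<oplus> y) = \<beta> x \<oplus> \<beta> y"
    and \<beta>_mult: "r \<in> T \<Longrightarrow> x \<in> carrier S \<Longrightarrow> \<beta> (r \<otimes> x) = r \<otimes> \<beta> x"
    and \<beta>_id: "r \<in> T \<Longrightarrow> \<beta> r = r"
begin

abbreviation ST where "ST \<equiv> S\<lparr>carrier := T\<rparr>"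

lemma sub_pow [simp]: "x [^]\<^bsub>ST\<^esub> (n::nat) = x [^] n"
  by (simp add: nat_pow_def)

lemma \<beta>_zero: "\<beta> \<zero> = \<zero>"
  using sub.zero_closed by (intro \<beta>_id) simp

lemma T_one: "\<one> \<in> T" using sub.one_closed by simp

lemma sub_ideal_subset: "ideal I ST \<Longrightarrow> I \<subseteq> T"
  using sub.ideal_subset by simp

lemma ideal_prod_sub: "A \<subseteq> A' \<Longrightarrow> B \<subseteq> B' \<Longrightarrow> A \<cdot>\<^bsub>ST\<^esub> B \<subseteq> A' \<cdot> B'"
proof
  fix x assume AB: "A \<subseteq> A'" "B \<subseteq> B'" and x: "x \<in> A \<cdot>\<^bsub>ST\<^esub> B"
  show "x \<in> A' \<cdot> B'"
    using x
  proof induct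
    case (prod i j)
    have "i \<otimes> j \<in> A' \<cdot> B'" using prod AB by (intro ideal_prod.prod) auto
    then show ?case by simp
  next
    case (sum s1 s2)
    have "s1 \<oplus> s2 \<in> A' \<cdot> B'" using sum(2,4) by (rule ideal_prod.sum)
    then show ?case by simp
  qed
qed

lemma ipow_sub_subset:
  assumes I: "ideal I ST"
  shows "sub.ipow I n \<subseteq> ipow (Idl I) n"
proof (induct n)
  case 0
  then show ?case using T_subset by simp
next
  case (Suc n)
  have "I \<subseteq> Idl I" using sub_ideal_subset[OF I] T_subset by (intro genideal_self) auto
  then show ?case using ideal_prod_sub[OF Suc] by simp
qed

lemma ipow_extension_subset:
  assumes I: "ideal I ST"
  shows "ipow (Idl I) n \<subseteq> Idl (sub.ipow I n)"
proof -
  have pc: "sub.ipow I n \<subseteq> carrier S" for n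
    using sub_ideal_subset[OF sub.ipow_ideal[OF I]] T_subset by blast
  have Ic: "I \<subseteq> carrier S" using sub_ideal_subset[OF I] T_subset by blast
  show ?thesis
  proof (induct n)
    case 0
    have "\<one> \<in> Idl T" using genideal_self[OF T_subset] T_one by blast
    then have "Idl T = carrier S" by (rule ideal.one_imp_carrier[OF genideal_ideal[OF T_subset]])
    then show ?case by simp
  next
    case (Suc n)
    have "(Idl (sub.ipow I n)) \<cdot> (Idl I) \<subseteq> Idl (sub.ipow I (Suc n))"
    proof (rule Idl_prod_subset[OF genideal_ideal[OF pc] pc Ic])
      fix a b assume "a \<in> sub.ipow I n" "b \<in> I"
      then have "a \<otimes>\<^bsub>ST\<^esub> b \<in> sub.ipow I (Suc n)" unfolding sub.ipow_Suc by (rule ideal_prod.prod)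
      then have "a \<otimes> b \<in> sub.ipow I (Suc n)" by simp
      then show "a \<otimes> b \<in> Idl (sub.ipow I (Suc n))" by (rule subsetD[OF genideal_self[OF pc]])
    qed
    then show ?case unfolding ipow_Suc using ideal_prod_mono[OF Suc subset_refl] by blast
  qed
qed

lemma \<beta>_cartier_map:
  assumes \<phi>: "\<phi> \<in> C_maps e"
  shows "(\<lambda>x. \<beta> (\<phi> x)) \<in> sub.C_maps e"
proof (rule sub.cartier_mapsI)
  note T = subsetD[OF T_subset]
  show "\<beta> (\<phi> x) \<in> carrier ST" if "x \<in> carrier ST" for x
    using that T cartier_closed[OF \<phi>] \<beta>_closed by simp
  show "\<beta> (\<phi> (x \<oplus>\<^bsub>ST\<^esub> y)) = \<beta> (\<phi> x) \<oplus>\<^bsub>ST\<^esub> \<beta> (\<phi> y)" if "x \<in> carrier ST" "y \<in> carrier ST" for x y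
    using that T cartier_closed[OF \<phi>] cartier_plus[OF \<phi>] \<beta>_add by simp
  show "\<beta> (\<phi> (r [^]\<^bsub>ST\<^esub> (p ^ e) \<otimes>\<^bsub>ST\<^esub> x)) = r \<otimes>\<^bsub>ST\<^esub> \<beta> (\<phi> x)"
    if "r \<in> carrier ST" "x \<in> carrier ST" for r x
    using that T cartier_closed[OF \<phi>] cartier_frob[OF \<phi>] \<beta>_mult by simp
qed

text \<open>The Frobenius splitting \<open>\<chi>\<close> of \<open>T\<close> gives \<open>\<psi> g = \<psi> (\<chi> (g\<^sup>p))\<close>.\<close>

lemma sub_test_term_increasing:
  assumes I: "ideal I ST"
  shows "sub.test_term I e c \<subseteq> sub.test_term I (Suc e) c"
proof (rule sub.C_ideal_subset)
  let ?m = "nat \<lceil>real (p ^ e) * c\<rceil>" and ?n = "nat \<lceil>real (p ^ Suc e) * c\<rceil>"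
  have Ic: "sub.ipow I k \<subseteq> carrier ST" for k by (rule sub.ideal_subset[OF sub.ipow_ideal[OF I]])
  show "ideal (sub.test_term I (Suc e) c) ST" by (rule sub.C_ideal_ideal[OF Ic])
  obtain \<phi>1 where \<phi>1: "\<phi>1 \<in> C_maps 1" "\<phi>1 \<one> = \<one>" using exists_cartier_map_onto_one by blast
  let ?\<chi> = "\<lambda>x. \<beta> (\<phi>1 x)"
  have \<chi>: "?\<chi> \<in> sub.C_maps 1" "?\<chi> \<one> = \<one>"
    using \<beta>_cartier_map[OF \<phi>1(1)] \<phi>1(2) \<beta>_id[OF T_one] by simp_all
  fix \<psi> g assume \<psi>: "\<psi> \<in> sub.C_maps e" and g: "g \<in> sub.ipow I ?m"
  have gT: "g \<in> T" using g Ic by auto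
  have "?\<chi> (g [^] p) = g"
    using sub.cartier_frob[OF \<chi>(1), of g \<one>] gT T_one \<chi>(2) T_subset by (auto simp: subset_iff)
  moreover have "g [^] p \<in> sub.ipow I ?n"
  proof -
    have "g [^]\<^bsub>ST\<^esub> p \<in> sub.ipow I (?m * p)" by (rule sub.pow_mem_ipow[OF I g])
    then have "g [^] p \<in> sub.ipow I (?m * p)" by simp
    then show ?thesis by (rule subsetD[OF sub.ipow_antimono[OF I test_exponent_lift]])
  qed
  ultimately show "\<psi> g \<in> sub.test_term I (Suc e) c"
    using sub.C_ideal_gen[OF Ic sub.cartier_comp[OF \<psi> \<chi>(1)], of "g [^] p" ?n] by simp
qed

text \<open>If \<open>f\<close> lies in the Frobenius power of \<open>C (I\<^sup>n S)\<close>, it is a sum of terms \<open>s \<phi>(h)\<^sup>q\<close> with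
  \<open>h \<in> I\<^sup>n\<close>, i.e. of images of \<open>h\<close> under differential operators \<open>h \<mapsto> s \<phi>(h)\<^sup>q\<close>. Composing
  these with \<open>\<beta>\<close> and with a Cartier map \<open>\<psi>\<close> of \<open>T\<close> gives Cartier maps of \<open>T\<close>.\<close>

lemma C_ideal_sub_subset:
  assumes I: "ideal I ST"
    and le: "C_ideal e (ipow (Idl I) m) \<subseteq> C_ideal e (ipow (Idl I) n)"
  shows "sub.C_ideal e (sub.ipow I m) \<subseteq> sub.C_ideal e (sub.ipow I n)"
proof (rule sub.C_ideal_subset)
  note T = subsetD[OF T_subset]
  have Ic: "sub.ipow I k \<subseteq> carrier ST" for k by (rule sub.ideal_subset[OF sub.ipow_ideal[OF I]])
  have IT: "sub.ipow I k \<subseteq> T" for k using Ic by simp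
  have IcS: "sub.ipow I k \<subseteq> carrier S" for k using IT T_subset by blast
  have "I \<subseteq> carrier S" using sub_ideal_subset[OF I] T_subset by blast
  then have IS: "ideal (ipow (Idl I) k) S" for k by (intro ipow_ideal genideal_ideal)
  have Cc: "C_ideal e (ipow (Idl I) n) \<subseteq> carrier S"
    by (rule ideal_subset[OF C_ideal_ideal[OF ideal_subset[OF IS]]])
  let ?L = "sub.C_ideal e (sub.ipow I n)"
  show L: "ideal ?L ST" by (rule sub.C_ideal_ideal[OF Ic])
  define G where "G = {\<phi> h [^] (p ^ e) |\<phi> h. \<phi> \<in> C_maps e \<and> h \<in> sub.ipow I n}"
  have Gc: "G \<subseteq> carrier S" unfolding G_def using cartier_closed IcS by blast
  have IG: "ideal (Idl G) S" using Gc by (rule genideal_ideal)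
  let ?F = "{c \<in> carrier S. c [^] (p ^ e) \<in> Idl G}"
  have F: "ideal ?F S" using IG by (rule frob_vimage_ideal)
  have "C_ideal e (ipow (Idl I) n) \<subseteq> ?F"
  proof (rule C_ideal_subset[OF F])
    fix \<phi> g assume \<phi>: "\<phi> \<in> C_maps e" and g: "g \<in> ipow (Idl I) n"
    show "\<phi> g \<in> ?F"
    proof (rule cartier_map_Idl[OF F \<phi> IcS])
      show "g \<in> Idl (sub.ipow I n)" using g ipow_extension_subset[OF I] by blast
      fix r h assume r: "r \<in> carrier S" and h: "h \<in> sub.ipow I n"
      have "\<phi> (r \<otimes> h) [^] (p ^ e) \<in> G"
        unfolding G_def using cartier_premult[OF \<phi> r] h
        by (intro CollectI exI[of _ "\<lambda>x. \<phi> (r \<otimes> x)"] exI[of _ h]) simp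
      then have "\<phi> (r \<otimes> h) [^] (p ^ e) \<in> Idl G" by (rule subsetD[OF genideal_self[OF Gc]])
      moreover have "h \<in> carrier S" using h IcS by blast
      ultimately show "\<phi> (r \<otimes> h) \<in> ?F" using cartier_closed[OF \<phi>] r by simp
    qed
  qed
  then have "frobenius_power e (C_ideal e (ipow (Idl I) n)) \<subseteq> Idl G"
    by (intro frobenius_power_subset[OF IG]) auto
  then have f_Idl: "f \<in> Idl G" if "f \<in> sub.ipow I m" for f
    using that ipow_sub_subset[OF I, of m] subset_frobenius_power[OF IS, of m e]
      frobenius_power_mono[OF le Cc, of e] by blast
  fix \<psi> f assume \<psi>: "\<psi> \<in> sub.C_maps e" and f: "f \<in> sub.ipow I m"
  have \<psi>_closed: "\<psi> x \<in> T" if "x \<in> T" for x using sub.cartier_closed[OF \<psi>, of x] that by simp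
  have \<psi>_plus: "\<psi> (x \<oplus> y) = \<psi> x \<oplus> \<psi> y" if "x \<in> T" "y \<in> T" for x y
    using sub.cartier_plus[OF \<psi>, of x y] that by simp
  have \<psi>_frob: "\<psi> (r [^] (p ^ e) \<otimes> x) = r \<otimes> \<psi> x" if "r \<in> T" "x \<in> T" for r x
    using sub.cartier_frob[OF \<psi>, of r x] that by simp
  \<comment> \<open>quantifying over \<open>s\<close> makes this an ideal, so that it suffices to treat generators\<close>
  let ?W = "{x \<in> carrier S. \<forall>s\<in>carrier S. \<psi> (\<beta> (s \<otimes> x)) \<in> ?L}"
  have "ideal ?W S"
  proof (rule idealI_mult)
    have "\<psi> \<zero> = \<zero>" using sub.cartier_map_zero[OF \<psi>] by simp
    then show "\<zero> \<in> ?W" using \<beta>_zero sub.ideal_zero[OF L] by simp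
    show "x \<oplus> y \<in> ?W" if "x \<in> ?W" "y \<in> ?W" for x y
      using that sub.ideal_add[OF L] by (simp add: r_distr \<beta>_add \<psi>_plus \<beta>_closed)
    show "a \<otimes> x \<in> ?W" if "a \<in> carrier S" "x \<in> ?W" for a x
      using that by (simp add: m_assoc[symmetric])
  qed auto
  moreover have "G \<subseteq> ?W"
  proof
    fix y assume "y \<in> G"
    then obtain \<phi> h where y: "y = \<phi> h [^] (p ^ e)" and \<phi>: "\<phi> \<in> C_maps e" and h: "h \<in> sub.ipow I n"
      unfolding G_def by blast
    have \<phi>c: "\<phi> x \<in> carrier S" if "x \<in> T" for x using cartier_closed[OF \<phi>] T that by blast
    have "\<psi> (\<beta> (s \<otimes> y)) \<in> ?L" if s: "s \<in> carrier S" for s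
    proof -
      have "(\<lambda>x. \<psi> (\<beta> (s \<otimes> \<phi> x [^] (p ^ e)))) \<in> sub.C_maps e"
      proof (rule sub.cartier_mapsI)
        show "\<psi> (\<beta> (s \<otimes> \<phi> x [^] (p ^ e))) \<in> carrier ST" if "x \<in> carrier ST" for x
          using that s \<phi>c by (simp add: \<psi>_closed \<beta>_closed)
        show "\<psi> (\<beta> (s \<otimes> \<phi> (x \<oplus>\<^bsub>ST\<^esub> z) [^] (p ^ e)))
          = \<psi> (\<beta> (s \<otimes> \<phi> x [^] (p ^ e))) \<oplus>\<^bsub>ST\<^esub> \<psi> (\<beta> (s \<otimes> \<phi> z [^] (p ^ e)))"
          if "x \<in> carrier ST" "z \<in> carrier ST" for x z
          using that s \<phi>c T cartier_plus[OF \<phi>, of x z]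
          by (simp add: frob_add r_distr \<beta>_add \<psi>_plus \<beta>_closed)
        show "\<psi> (\<beta> (s \<otimes> \<phi> (r [^]\<^bsub>ST\<^esub> (p ^ e) \<otimes>\<^bsub>ST\<^esub> x) [^] (p ^ e)))
          = r \<otimes>\<^bsub>ST\<^esub> \<psi> (\<beta> (s \<otimes> \<phi> x [^] (p ^ e)))"
          if rx: "r \<in> carrier ST" "x \<in> carrier ST" for r x
        proof -
          have rT: "r \<in> T" "x \<in> T" "r \<in> carrier S" "x \<in> carrier S" using rx T by simp_all
          have rq: "r [^] (p ^ e) \<in> T" using sub.nat_pow_closed[of r "p ^ e"] rT by simp
          have "s \<otimes> \<phi> (r [^] (p ^ e) \<otimes> x) [^] (p ^ e) = r [^] (p ^ e) \<otimes> (s \<otimes> \<phi> x [^] (p ^ e))"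
            using rT s \<phi>c cartier_frob[OF \<phi>, of r x] by (simp add: nat_pow_distrib m_lcomm)
          then show ?thesis
            using rT rq s \<phi>c by (simp add: \<beta>_mult \<psi>_frob \<beta>_closed)
        qed
      qed
      from sub.C_ideal_gen[OF Ic this h] show ?thesis unfolding y .
    qed
    then show "y \<in> ?W" using Gc \<open>y \<in> G\<close> by blast
  qed
  ultimately have "Idl G \<subseteq> ?W" by (rule genideal_minimal)
  then have "\<psi> (\<beta> (\<one> \<otimes> f)) \<in> ?L" using f_Idl[OF f] by blast
  moreover have "f \<in> T" using f IT by blast
  ultimately show "\<psi> f \<in> ?L" using T \<beta>_id by simp
qed

lemma F_jumping_numbers_sub_subset:
  assumes I: "ideal I ST"
  shows "F_jumping_numbers p ST I \<subseteq> F_jumping_numbers p S (Idl I)"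
proof
  have "I \<subseteq> carrier S" using sub_ideal_subset[OF I] T_subset by blast
  then have IS: "ideal (Idl I) S" by (rule genideal_ideal)
  fix c assume c: "c \<in> F_jumping_numbers p ST I"
  have "test_ideal p S (Idl I) c \<noteq> test_ideal p S (Idl I) (c - \<epsilon>)" if \<epsilon>: "\<epsilon> > 0" "c - \<epsilon> > 0" for \<epsilon>
  proof
    assume eq: "test_ideal p S (Idl I) c = test_ideal p S (Idl I) (c - \<epsilon>)"
    obtain E where E: "\<And>e. e \<ge> E \<Longrightarrow> test_ideal p S (Idl I) c = test_term (Idl I) e c"
      using test_ideal_eventually[OF IS] by blast
    obtain E' where E': "\<And>e. e \<ge> E' \<Longrightarrow> test_ideal p S (Idl I) (c - \<epsilon>) = test_term (Idl I) e (c - \<epsilon>)"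
      using test_ideal_eventually[OF IS] by blast
    have "sub.test_term I e (c - \<epsilon>) \<subseteq> test_ideal p ST I c" for e
    proof -
      let ?e = "max e (max E E')"
      have "sub.test_term I e (c - \<epsilon>) \<subseteq> sub.test_term I ?e (c - \<epsilon>)"
        using lift_Suc_mono_le[of "\<lambda>e. sub.test_term I e (c - \<epsilon>)", OF sub_test_term_increasing[OF I]]
        by simp
      also have "\<dots> \<subseteq> sub.test_term I ?e c"
        using eq E[of ?e] E'[of ?e] by (intro C_ideal_sub_subset[OF I]) simp
      also have "\<dots> \<subseteq> test_ideal p ST I c" unfolding test_ideal_def by blast
      finally show ?thesis .
    qed
    then have "test_ideal p ST I (c - \<epsilon>) \<subseteq> test_ideal p ST I c"
      unfolding test_ideal_def[of p ST I "c - \<epsilon>"] by blast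
    moreover have "test_ideal p ST I c \<subseteq> test_ideal p ST I (c - \<epsilon>)"
      using \<epsilon> by (intro sub.test_ideal_antimono[OF I]) simp
    ultimately show False using c \<epsilon> unfolding F_jumping_numbers_def by blast
  qed
  then show "c \<in> F_jumping_numbers p S (Idl I)" using c by (simp add: F_jumping_numbers_def)
qed

end

section \<open>Jumping numbers of a direct summand of a regular ring\<close>

context flat_frobenius
begin

lemma F_jumping_numbers_jump_set:
  assumes I: "ideal I R"
  shows "\<exists>r. jump_set (F_jumping_numbers p R I) p r"
proof -
  obtain U where U: "U \<subseteq> carrier R" "finite U" "I = Idl U" "U \<subseteq> I"
    using finite_generators[OF I] .
  define r where "r = max 1 (card U)"
  have r: "r \<ge> 1" "card U \<le> r" by (auto simp: r_def)
  have "jump_set (F_jumping_numbers p R I) p r"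
  proof
    show "p \<ge> 2" using p_gt_1 by simp
    show "r \<ge> 1" by (rule r)
    show "c > 0" if "c \<in> F_jumping_numbers p R I" for c using that by (simp add: F_jumping_numbers_def)
    show "real p * c \<in> F_jumping_numbers p R I" if "c \<in> F_jumping_numbers p R I" for c
      using I that by (rule F_jumping_times_p)
    show "c - 1 \<in> F_jumping_numbers p R I" if "c \<in> F_jumping_numbers p R I" "c > real r" for c
      using F_jumping_minus_1[OF U(2,1) r(2) U(3) r(1) that] .
    show "right_gap (F_jumping_numbers p R I) x" if "x \<ge> 0" for x
      using F_jumping_right_gap[OF I that] unfolding right_gap_def .
    show "\<not> left_limit (F_jumping_numbers p R I) x"
      if "n > 0" "x * (real (p ^ n) - 1) = real a" "x > real r" for x n a
      using F_jumping_left_gap[OF U(2,1) r(2) U(3) r(1) that] unfolding left_limit_def by blast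
  qed
  then show ?thesis by blast
qed

end

theorem theorem3:
  fixes S :: "('a, 'm) ring_scheme" and R I :: "'a set" and p :: nat
  assumes "domain S" and "regular_ring S" and "contains_field_of_char p S" and "F_finite p S"
    and "subring R S"
    and "noetherian_ring (S\<lparr>carrier := R\<rparr>)"
    and "contains_field_of_char p (S\<lparr>carrier := R\<rparr>)"
    and "F_finite p (S\<lparr>carrier := R\<rparr>)"
    and "is_direct_summand R S"
    and "ideal I (S\<lparr>carrier := R\<rparr>)"
  shows "F_jumping_numbers p (S\<lparr>carrier := R\<rparr>) I \<subseteq> F_jumping_numbers p S (Idl\<^bsub>S\<^esub> I)
    \<and> F_jumping_numbers p (S\<lparr>carrier := R\<rparr>) I \<subseteq> \<rat>
    \<and> (\<forall>x. \<not> x islimpt F_jumping_numbers p (S\<lparr>carrier := R\<rparr>) I)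
    \<and> (F_jumping_numbers p (S\<lparr>carrier := R\<rparr>) I \<noteq> {} \<longrightarrow>
         (\<exists>c. is_F_pure_threshold p (S\<lparr>carrier := R\<rparr>) I c \<and> c \<in> \<rat>))"
proof -
  let ?R = "S\<lparr>carrier := R\<rparr>"
  let ?JR = "F_jumping_numbers p ?R I" and ?JS = "F_jumping_numbers p S (Idl\<^bsub>S\<^esub> I)"
  have S: "cring S" "noetherian_ring S" using assms(2) by (auto simp: regular_ring_def)
  interpret S: cring S by (rule S)
  have char_S: "char_p_cring S p"
    using assms(3) S unfolding contains_field_of_char_def
    by (auto intro!: char_p_cring.intro noetherian_cring.intro char_p_cring_axioms.intro)
  have flat: "flat_frobenius S p"
    using char_p_cring.regular_subset_frobenius_power[OF char_S assms(1,2,4)]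
    by (intro flat_frobenius.intro[OF char_S] flat_frobenius_axioms.intro)
  have R: "R \<subseteq> carrier S" using subringE(1)[OF assms(5)] .
  have "cring ?R"
    using S.subcring_iff[OF R] S.subcringI'[OF assms(5)] by simp
  then have char_R: "char_p_cring ?R p"
    using assms(6,7) unfolding contains_field_of_char_def
    by (auto intro!: char_p_cring.intro noetherian_cring.intro char_p_cring_axioms.intro)
  obtain \<beta> where \<beta>: "\<beta> \<in> carrier S \<rightarrow> R"
    "\<And>x y. x \<in> carrier S \<Longrightarrow> y \<in> carrier S \<Longrightarrow> \<beta> (x \<oplus>\<^bsub>S\<^esub> y) = \<beta> x \<oplus>\<^bsub>S\<^esub> \<beta> y"
    "\<And>r x. r \<in> R \<Longrightarrow> x \<in> carrier S \<Longrightarrow> \<beta> (r \<otimes>\<^bsub>S\<^esub> x) = r \<otimes>\<^bsub>S\<^esub> \<beta> x" "\<And>r. r \<in> R \<Longrightarrow> \<beta> r = r"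
    using assms(9) unfolding is_direct_summand_def by blast
  have "frobenius_summand S p R \<beta>"
    by (intro frobenius_summand.intro flat char_R frobenius_summand_axioms.intro R)
      (use \<beta> in auto)
  then have subset: "?JR \<subseteq> ?JS"
    by (rule frobenius_summand.F_jumping_numbers_sub_subset[OF _ assms(10)])
  have "I \<subseteq> carrier S" using ideal.Icarr[OF assms(10)] R by auto
  then have "ideal (Idl\<^bsub>S\<^esub> I) S" by (rule S.genideal_ideal)
  then obtain r where "jump_set ?JS p r"
    using flat_frobenius.F_jumping_numbers_jump_set[OF flat] by blast
  then interpret J: jump_set ?JS p r .
  have rat: "?JR \<subseteq> \<rat>" using subset J.rational by blast
  have lim: "\<not> x islimpt ?JR" for x using J.discrete islimpt_subset[OF _ subset] by blast
  have "\<exists>c. is_F_pure_threshold p ?R I c \<and> c \<in> \<rat>" if "?JR \<noteq> {}"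
    using discrete_positive_has_minimum[OF that _ lim] subset J.pos rat
    unfolding is_F_pure_threshold_def by blast
  then show ?thesis using subset rat lim by blast
qed

end
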